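(* There exists a bounded, connected, unicritical, hyperbolic polynomial sequence $\{P_m\}_{m=1}^\infty$ consisting of quadratic and cubic polynomials (each $P_m$ has degree $2$ or $3$, both degrees occurring) which possesses an orbit portrait (that is, some formal orbit portrait of valence at least $2$ is realized by $\{P_m\}_{m=1}^\infty$ with some orbit) for which there is a complementary arc with irrational length.
   Context: Bounded sequences. A bounded polynomial sequence (with bounds $d\ge 2$, $K\ge 1$, $M\ge 0$) is a sequence $\{P_m\}_{m=1}^\infty$ of polynomials $P_m(z)=\sum_{k=0}^{d_m} a_{k,m}z^k$ with $2\le d_m\le d$, $1/K\le |a_{d_m,m}|\le K$ and $|a_{k,m}|\le M$ for $0\le k\le d_m-1$, for all $m\ge1$. For $0\le m\le n$ put $Q_{m,n}=P_n\circ\cdots\circ P_{m+1}$ ($Q_{m,m}=\mathrm{id}$). Put $\mathcal K_m=\{z\in\mathbb C:\limsup_{n}|Q_{m,n}(z)|<\infty\}$, $\mathcal A_{\infty,m}=\{z\in\mathbb C:\lim_n|Q_{m,n}(z)|=\infty\}$ (iterated basin of infinity; $\infty$ is added to it when regarded as a domain in $\overline{\mathbb C}$), $\mathcal J_m=\partial\mathcal K_m=\partial\mathcal A_{\infty,m}$ (iterated Julia set). The sequence is connected if all $\mathcal J_m$, $m\ge 0$, are connected. It is hyperbolic if there are $C>0$, $\mu>1$ with $|Q_{m,m+i}'(z)|\ge C\mu^i$ for all $i,m\ge0$ and $z\in\mathcal J_m$. It is unicritical if each $P_m$ has exactly one critical point in $\mathbb C$. An orbit is a sequence $\{z_m\}_{m=0}^\infty$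 with $P_{m+1}(z_m)=z_{m+1}$ for all $m\ge0$. External rays. If the sequence is connected, there are Böttcher maps $\phi_m$, $m\ge 0$: conformal bijections $\phi_m:\mathcal A_{\infty,m}\to\overline{\mathbb C}\setminus\overline{\mathbb D}$ fixing $\infty$ with $\phi_{m+1}\circ P_{m+1}\circ\phi_m^{-1}(z)=z^{d_{m+1}}$. (If all $P_m$ are monic they are made unique by requiring derivative $1$ at $\infty$.) The external ray of angle $\theta\in\mathbb R/\mathbb Z$ at time $m$ is $R_{\theta;m}=\phi_m^{-1}(\{Re^{2\pi i\theta}:R>1\})$; it lands at $p\in\mathcal J_m$ if $\lim_{R\to1^+}\phi_m^{-1}(Re^{2\pi i\theta})=p$. Formal portraits. Let $2\le d\le\infty$, $N\ge1$, and let $d_m$, $m\ge1$, be integers with $2\le d_m\le d$. A formal orbit portrait of valence $N$ (and degree bound $d$) is a sequence $\mathcal P=\{A_m\}_{m=0}^\infty$, where each $A_m$ is a set of $N$ distinct angles in $\mathbb R/\mathbb Z$ and $\theta\mapsto d_{m+1}\theta\pmod 1$ maps $A_m$ bijectively onto $A_{m+1}$ preserving cyclic ordering (a vacuous condition when $N=2$). The complementary arcs of the portrait at time $m$ are the components of $(\mathbb R/\mathbb Z)\setminus A_m$; $\mathbb R/\mathbb Z$ has total length $1$. Realization. $\mathcal P$ is realized by a bounded sequence $\{P_m\}$ with orbit $\{p_m\}_{m=0}^\infty$ if $\deg P_m=d_m$ for all $m\ge1$, all $\mathcal J_m$ are connected, $p_m\in\mathcal J_m$ for all $m\ge0$, and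 for each $m\ge 0$ the rays $R_{\theta;m}$ with $\theta\in A_m$, and no others, land at $p_m$. *)

theory Defs
  imports "HOL-Complex_Analysis.Complex_Analysis" "HOL-Library.Extended_Nat"
begin

text \<open>Polynomial sequences are functions \<open>P :: nat \<Rightarrow> complex poly\<close> of which only the
  entries with index \<open>m \<ge> 1\<close> are used; \<open>P 0\<close> is irrelevant.\<close>

definition bounded_poly_seq_with ::
    "nat \<Rightarrow> real \<Rightarrow> real \<Rightarrow> (nat \<Rightarrow> complex poly) \<Rightarrow> bool" where
  "bounded_poly_seq_with d K M P \<longleftrightarrow> d \<ge> 2 \<and> K \<ge> 1 \<and> M \<ge> 0 \<and>
     (\<forall>m\<ge>1. 2 \<le> degree (P m) \<and> degree (P m) \<le> d \<and>
        1 / K \<le> cmod (lead_coeff (P m)) \<and> cmod (lead_coeff (P m)) \<le> K \<and>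
        (\<forall>k<degree (P m). cmod (coeff (P m) k) \<le> M))"

definition bounded_poly_seq :: "(nat \<Rightarrow> complex poly) \<Rightarrow> bool" where
  "bounded_poly_seq P \<longleftrightarrow> (\<exists>d K M. bounded_poly_seq_with d K M P)"

text \<open>For \<open>m \<le> n\<close>, \<open>Q P m n\<close> is \<open>P\<^sub>n \<circ> \<dots> \<circ> P\<^sub>m\<^sub>+\<^sub>1\<close>; for \<open>n < m\<close> it is a dummy value.\<close>

primrec Q :: "(nat \<Rightarrow> complex poly) \<Rightarrow> nat \<Rightarrow> nat \<Rightarrow> complex \<Rightarrow> complex" where
  "Q P m 0 = id"
| "Q P m (Suc n) = (if m \<le> n then poly (P (Suc n)) \<circ> Q P m n else id)"

definition filled_julia :: "(nat \<Rightarrow> complex poly) \<Rightarrow> nat \<Rightarrow> complex set" where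
  "filled_julia P m = {z. limsup (\<lambda>n. ereal (cmod (Q P m n z))) < \<infinity>}"

text \<open>The basin without the point at infinity.\<close>

definition basin_inf :: "(nat \<Rightarrow> complex poly) \<Rightarrow> nat \<Rightarrow> complex set" where
  "basin_inf P m = {z. filterlim (\<lambda>n. cmod (Q P m n z)) at_top sequentially}"

definition julia :: "(nat \<Rightarrow> complex poly) \<Rightarrow> nat \<Rightarrow> complex set" where
  "julia P m = frontier (filled_julia P m)"

definition connected_seq :: "(nat \<Rightarrow> complex poly) \<Rightarrow> bool" where
  "connected_seq P \<longleftrightarrow> (\<forall>m. connected (julia P m))"

definition hyperbolic_seq :: "(nat \<Rightarrow> complex poly) \<Rightarrow> bool" where
  "hyperbolic_seq P \<longleftrightarrow> (\<exists>C>0. \<exists>\<mu>>1. \<forall>i m. \<forall>z\<in>julia P m.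
     cmod (deriv (Q P m (m + i)) z) \<ge> C * \<mu> ^ i)"

definition unicritical_seq :: "(nat \<Rightarrow> complex poly) \<Rightarrow> bool" where
  "unicritical_seq P \<longleftrightarrow> (\<forall>m\<ge>1. \<exists>!z. poly (pderiv (P m)) z = 0)"

definition orbit_seq :: "(nat \<Rightarrow> complex poly) \<Rightarrow> (nat \<Rightarrow> complex) \<Rightarrow> bool" where
  "orbit_seq P z \<longleftrightarrow> (\<forall>m. poly (P (Suc m)) (z m) = z (Suc m))"

text \<open>The inverse \<open>\<phi>\<^sub>m\<^sup>-\<^sup>1\<close> of the \<open>m\<close>-th map on the exterior of the closed unit disc.\<close>

abbreviation bottcher_inv ::
    "(nat \<Rightarrow> complex poly) \<Rightarrow> (nat \<Rightarrow> complex \<Rightarrow> complex) \<Rightarrow> nat \<Rightarrow> complex \<Rightarrow> complex" where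
  "bottcher_inv P \<phi> m \<equiv> inv_into (basin_inf P m) (\<phi> m)"

text \<open>Conformal maps between domains of the Riemann sphere fixing infinity are written on
  the finite parts: the holomorphic bijection tends to infinity at infinity.
  In general the maps are unique only up to rotations \<open>\<phi>\<^sub>m \<mapsto> c\<^sub>m \<phi>\<^sub>m\<close> with
  \<open>c\<^sub>m\<^sub>+\<^sub>1 = c\<^sub>m ^ d\<^sub>m\<^sub>+\<^sub>1\<close> and \<open>\<bar>c\<^sub>m\<bar> = 1\<close>. In the monic case the derivative at infinity,
  i.e. the derivative at 0 of \<open>\<zeta> \<mapsto> 1 / \<phi>\<^sub>m (1 / \<zeta>)\<close>, is normalized to be 1, which says
  that \<open>\<phi>\<^sub>m z / z\<close> tends to 1.\<close>

definition bottcher_maps ::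
    "(nat \<Rightarrow> complex poly) \<Rightarrow> (nat \<Rightarrow> complex \<Rightarrow> complex) \<Rightarrow> bool" where
  "bottcher_maps P \<phi> \<longleftrightarrow>
     (\<forall>m. \<phi> m holomorphic_on basin_inf P m \<and>
          bij_betw (\<phi> m) (basin_inf P m) (- cball 0 1) \<and>
          filterlim (\<phi> m) at_infinity at_infinity \<and>
          (\<forall>z\<in>- cball 0 1.
             \<phi> (Suc m) (poly (P (Suc m)) (bottcher_inv P \<phi> m z)) = z ^ degree (P (Suc m)))) \<and>
     ((\<forall>m\<ge>1. lead_coeff (P m) = 1) \<longrightarrow> (\<forall>m. ((\<lambda>z. \<phi> m z / z) \<longlongrightarrow> 1) at_infinity))"

definition ray_lands_at ::
    "(nat \<Rightarrow> complex poly) \<Rightarrow> (nat \<Rightarrow> complex \<Rightarrow> complex) \<Rightarrow> nat \<Rightarrow> real \<Rightarrow> complex \<Rightarrow> bool" where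
  "ray_lands_at P \<phi> m \<theta> p \<longleftrightarrow> p \<in> julia P m \<and>
     ((\<lambda>R. bottcher_inv P \<phi> m (of_real R * cis (2 * pi * \<theta>))) \<longlongrightarrow> p) (at_right 1)"

text \<open>Angles in \<open>\<real>/\<int>\<close> are represented by their representatives in \<open>{0..<1}\<close>, so that
  multiplication by \<open>d\<close> becomes \<open>\<theta> \<mapsto> frac (d \<theta>)\<close>. \<open>cyclic_less a b c\<close> says
  that \<open>a, b, c\<close> are distinct and met in this order when moving in the positive direction.\<close>

definition cyclic_less :: "real \<Rightarrow> real \<Rightarrow> real \<Rightarrow> bool" where
  "cyclic_less a b c \<longleftrightarrow> a < b \<and> b < c \<or> b < c \<and> c < a \<or> c < a \<and> a < b"

definition preserves_cyclic_order :: "(real \<Rightarrow> real) \<Rightarrow> real set \<Rightarrow> bool" where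
  "preserves_cyclic_order f S \<longleftrightarrow>
     (\<forall>a\<in>S. \<forall>b\<in>S. \<forall>c\<in>S. cyclic_less a b c \<longrightarrow> cyclic_less (f a) (f b) (f c))"

definition formal_orbit_portrait ::
    "enat \<Rightarrow> nat \<Rightarrow> (nat \<Rightarrow> nat) \<Rightarrow> (nat \<Rightarrow> real set) \<Rightarrow> bool" where
  "formal_orbit_portrait d N dm A \<longleftrightarrow> 2 \<le> d \<and> 1 \<le> N \<and>
     (\<forall>m\<ge>1. 2 \<le> dm m \<and> enat (dm m) \<le> d) \<and>
     (\<forall>m. A m \<subseteq> {0..<1} \<and> finite (A m) \<and> card (A m) = N \<and>
          bij_betw (\<lambda>\<theta>. frac (of_nat (dm (Suc m)) * \<theta>)) (A m) (A (Suc m)) \<and>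
          preserves_cyclic_order (\<lambda>\<theta>. frac (of_nat (dm (Suc m)) * \<theta>)) (A m))"

text \<open>For topological purposes \<open>\<real>/\<int>\<close> is the unit circle, via \<open>\<theta> \<mapsto> exp (2\<pi>i\<theta>)\<close>;
  lengths are measured in \<open>\<real>/\<int>\<close>, so the whole circle has length 1.\<close>

definition complementary_arcs :: "(nat \<Rightarrow> real set) \<Rightarrow> nat \<Rightarrow> complex set set" where
  "complementary_arcs A m = components (sphere 0 1 - (\<lambda>\<theta>. cis (2 * pi * \<theta>)) ` A m)"

definition arc_length :: "complex set \<Rightarrow> real" where
  "arc_length I = measure lborel {\<theta>\<in>{0..<1}. cis (2 * pi * \<theta>) \<in> I}"

text \<open>Changing the maps \<open>\<phi>\<close> by admissible rotations rotates the sets \<open>A m\<close> and does not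
  affect arc lengths; a single compatible family \<open>\<phi>\<close> serves all times \<open>m\<close>.\<close>

definition realized_by ::
    "(nat \<Rightarrow> nat) \<Rightarrow> (nat \<Rightarrow> real set) \<Rightarrow> (nat \<Rightarrow> complex poly) \<Rightarrow> (nat \<Rightarrow> complex) \<Rightarrow> bool" where
  "realized_by dm A P p \<longleftrightarrow>
     bounded_poly_seq P \<and> orbit_seq P p \<and> (\<forall>m\<ge>1. degree (P m) = dm m) \<and>
     connected_seq P \<and> (\<forall>m. p m \<in> julia P m) \<and>
     (\<exists>\<phi>. bottcher_maps P \<phi> \<and>
        (\<forall>m. \<forall>\<theta>\<in>{0..<1}. ray_lands_at P \<phi> m \<theta> (p m) \<longleftrightarrow> \<theta> \<in> A m))"

end

theory Submission
  imports Defs "HOL-Real_Asymp.Real_Asymp"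
begin

text \<open>The sequence consists of the maps \<open>z \<mapsto> 1 - z ^ d\<^sub>m\<close> with \<open>d\<^sub>m = 3\<close> for square \<open>m\<close> and
  \<open>d\<^sub>m = 2\<close> otherwise. All of them share the superattracting cycle \<open>0 \<mapsto> 1 \<mapsto> 0\<close>, so every
  critical orbit is bounded and stays away from the Julia sets; the metric
  \<open>\<bar>dz\<bar> / (\<bar>z\<bar> powr (2/5) * \<bar>1 - z\<bar> powr (3/5))\<close> is uniformly expanded outside neighbourhoods of the
  cycle, which gives hyperbolicity and uniform landing of all rays.
  All maps reverse \<open>[0, 1]\<close>, which contains a repelling orbit \<open>p\<close>. By symmetry under
  complex conjugation the rays landing at \<open>p\<^sub>m\<close> have angles \<open>\<plusminus> \<alpha>\<^sub>m\<close> from the positive axis, where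
  \<open>\<alpha>\<^sub>m\<^sub>+\<^sub>1 = 1/2 - d\<^sub>m\<^sub>+\<^sub>1 \<alpha>\<^sub>m\<close>, and \<open>\<alpha>\<^sub>m\<close> determines \<open>d\<^sub>m\<^sub>+\<^sub>1\<close>. If \<open>\<alpha>\<^sub>0\<close> were rational, the \<open>\<alpha>\<^sub>m\<close> would take
  finitely many values and the degrees would be eventually periodic, which they are not.\<close>

section \<open>Expansion and trapping estimates\<close>

text \<open>All critical orbits stay on one common cycle whatever the order of the degrees, so no
  parameter has to be tuned along the sequence: every word in 2 and 3 yields a connected hyperbolic
  sequence, and the word is free to encode irrationality. The delicate side is that of the rays. The
  conjugacies to powers are not built as limits of roots: in the coordinate \<open>1 / z\<close>
  each basin is a bounded simply connected domain, and its Riemann map, made unique by a positive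
  derivative at 0, inherits the functional equation and all symmetries from the Schwarz lemma. Since
  the leading coefficients are -1, it conjugates \<open>P m\<close> to \<open>- w ^ d\<close>, and a
  sign is inserted at the end. What is needed from the uniform convergence of rays is that each
  Julia point is the landing point of at least one ray; that exactly two rays reach
  \<open>p m\<close> follows from half-plane arguments and from the expansion of angle differences.
  The exponents 2/5 and 3/5 add up to 1, so at infinity the metric looks like
  \<open>\<bar>dz\<bar> / \<bar>z\<bar>\<close> and \<open>z \<mapsto> 1 - z ^ d\<close> expands it
  by a factor close to \<open>d\<close>.\<close>

definition fmap :: "nat \<Rightarrow> complex \<Rightarrow> complex" where
  "fmap d z = 1 - z ^ d"

text \<open>\<open>\<sigma> powr (-1/5)\<close> is the density of an expanded metric with poles at the cycle \<open>0, 1\<close>; the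
  fifth power keeps the estimates polynomial.\<close>

definition \<sigma> :: "complex \<Rightarrow> real" where
  "\<sigma> z = cmod z ^ 2 * cmod (1 - z) ^ 3"

text \<open>Parallelogram law. It eliminates \<open>cmod (1 + z)\<close>, so that the quadratic
  estimate becomes an inequality between \<open>cmod z\<close> and
  \<open>cmod (1 - z)\<close>.\<close>

lemma norm_one_plus_sq:
  "cmod (1 + z) ^ 2 = 2 + 2 * cmod z ^ 2 - cmod (1 - z) ^ 2"
  unfolding cmod_power2 by (simp add: power2_eq_square algebra_simps)

lemma norm_one_minus_bounds:
  "1 - cmod z \<le> cmod (1 - z)" "cmod z - 1 \<le> cmod (1 - z)" "cmod (1 - z) \<le> 1 + cmod z"
  using norm_triangle_ineq2[of 1 z] norm_triangle_ineq2[of z 1] norm_triangle_ineq4[of 1 z]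
  by (auto simp: norm_minus_commute)

lemma fmap_escape:
  assumes "2 \<le> cmod z" "2 \<le> d"
  shows "3 / 2 * cmod z \<le> cmod (fmap d z)"
proof -
  have "cmod z ^ 2 \<le> cmod z ^ d" using assms by (intro power_increasing) auto
  moreover have "cmod z ^ d - 1 \<le> cmod (fmap d z)"
    unfolding fmap_def using norm_triangle_ineq2[of "z^d" 1]
    by (simp add: norm_minus_commute norm_power)
  moreover have "2 * cmod z \<le> cmod z * cmod z" using assms by (intro mult_right_mono) auto
  ultimately show ?thesis using assms by (simp add: power2_eq_square)
qed

text \<open>The coefficients of \<open>1 - (1 - w) ^ d\<close> are dominated by those of
  \<open>(1 + x) ^ d - 1\<close>; the cubic majorant serves both degrees.\<close>

lemma norm_fmap_one_minus:
  assumes "d = 2 \<or> d = 3" shows "cmod (fmap d (1 - w)) \<le> (1 + cmod w) ^ 3 - 1"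
proof -
  let ?x = "cmod w"
  from assms show ?thesis
  proof
    assume d: "d = 2"
    have "fmap d (1 - w) = 2 * w - w^2" by (simp add: fmap_def d power2_eq_square algebra_simps)
    then have "cmod (fmap d (1 - w)) \<le> 2 * ?x + ?x^2"
      using norm_triangle_ineq4[of "2*w" "w^2"] by (simp add: norm_mult norm_power)
    also have "\<dots> \<le> (1 + ?x) ^ 3 - 1"
      by (simp add: power2_eq_square power3_eq_cube algebra_simps)
    finally show ?thesis .
  next
    assume d: "d = 3"
    have "fmap d (1 - w) = 3 * w - 3 * w^2 + w^3"
      by (simp add: fmap_def d power2_eq_square power3_eq_cube algebra_simps)
    then have "cmod (fmap d (1 - w)) \<le> 3 * ?x + 3 * ?x^2 + ?x^3"
      using norm_triangle_ineq[of "3*w - 3*w^2" "w^3"] norm_triangle_ineq4[of "3*w" "3*w^2"]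
      by (simp add: norm_mult norm_power)
    also have "\<dots> = (1 + ?x) ^ 3 - 1"
      by (simp add: power2_eq_square power3_eq_cube algebra_simps)
    finally show ?thesis by simp
  qed
qed

text \<open>The disc about 0 is first sent near 1 and only then back, so two steps of independent
  degrees are taken. The radius fits because \<open>(3/10)^2 = 9/100\<close> and
  \<open>(109/100)^3 - 1 < 3/10\<close>.\<close>

lemma fmap_trap:
  assumes z: "cmod z \<le> 3/10" and d: "d = 2 \<or> d = 3" "d' = 2 \<or> d' = 3"
  shows "cmod (fmap d' (fmap d z)) \<le> 3/10"
proof -
  have "cmod z ^ d \<le> cmod z ^ 2" using z d by (intro power_decreasing) auto
  also have "\<dots> \<le> (3/10)^2" using z by (intro power_mono) auto
  finally have *: "cmod (z ^ d) \<le> 9/100" by (simp add: norm_power power2_eq_square)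
  have "cmod (fmap d' (fmap d z)) \<le> (1 + cmod (z^d)) ^ 3 - 1"
    using norm_fmap_one_minus[OF d(2), of "z^d"] by (simp add: fmap_def)
  also have "\<dots> \<le> (1 + 9/100) ^ 3 - 1" using * by (intro diff_right_mono power_mono) auto
  also have "\<dots> \<le> 3/10" by (simp add: power3_eq_cube)
  finally show ?thesis .
qed

text \<open>Radii for which one step of degree \<open>d\<close> falls into the disc of radius 3/10
  about 0. They differ because the quadratic expansion estimate needs the larger one: it fails at
  \<open>z = 92/100\<close>.\<close>

definition trap1 :: "nat \<Rightarrow> real" where
  "trap1 d = (if d = 2 then 14/100 else 8/100)"

lemma trap1_bounds: "8/100 \<le> trap1 d" "trap1 d > 0"
  by (auto simp: trap1_def)

lemma fmap_trap1:
  assumes z: "cmod (1 - z) \<le> trap1 d" and d: "d = 2 \<or> d = 3"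
  shows "cmod (fmap d z) \<le> 3/10"
proof -
  define w where "w = 1 - z"
  let ?x = "cmod w"
  have zw: "z = 1 - w" by (simp add: w_def)
  from d show ?thesis
  proof
    assume d: "d = 2"
    have x: "?x \<le> 14/100" using z d by (simp add: w_def trap1_def)
    have "fmap d z = w * (2 - w)" by (simp add: fmap_def zw d power2_eq_square algebra_simps)
    then have "cmod (fmap d z) = ?x * cmod (2 - w)" by (simp add: norm_mult)
    also have "\<dots> \<le> (14/100) * (2 + 14/100)"
      using x norm_triangle_ineq4[of 2 w] by (intro mult_mono) auto
    finally show ?thesis by simp
  next
    assume d: "d = 3"
    have x: "?x \<le> 8/100" using z d by (simp add: w_def trap1_def)
    have "cmod (fmap d z) \<le> (1 + ?x)^3 - 1" using norm_fmap_one_minus[of d w] d zw by simp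
    also have "\<dots> \<le> (1 + 8/100)^3 - 1" using x by (intro diff_right_mono power_mono) auto
    finally show ?thesis by (simp add: power3_eq_cube)
  qed
qed

text \<open>With \<open>x = cmod z\<close> and \<open>y = cmod (1 - z)\<close> one has
  \<open>y \<ge> \<bar>1 - x\<bar>\<close> besides \<open>y \<ge> 14/100\<close>. The breakpoints
  86/100 and 114/100 are where these two lower bounds agree; on each piece the stronger one is
  used.\<close>

lemma quadratic_expansion:
  assumes "3/10 \<le> cmod z" "14/100 \<le> cmod (1 - z)"
  shows "11/10 * cmod (1 + z) ^ 2 \<le> 32 * cmod z * cmod (1 - z)"
proof -
  define x y where "x = cmod z" and "y = cmod (1 - z)"
  have xy: "3/10 \<le> x" "14/100 \<le> y" "1 - x \<le> y" "x - 1 \<le> y"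
    using assms norm_one_minus_bounds[of z] by (auto simp: x_def y_def)
  have "11/10 * (2 + 2 * x^2) - 11/10 * y^2 \<le> 32 * x * y"
  proof (cases "86/100 \<le> x \<and> x \<le> 114/100")
    case True
    have "32 * x * (14/100) \<le> 32 * x * y" using xy by (intro mult_left_mono) auto
    then have "448/100 * x \<le> 32 * x * y" by linarith
    \<comment> \<open>On the middle piece the convex function \<open>x^2\<close> is replaced by its
      chord, which leaves a linear inequality.\<close>
    moreover have "(x - 86/100) * (114/100 - x) \<ge> 0" using True by (intro mult_nonneg_nonneg) auto
    then have "x^2 \<le> 2 * x - 86/100*114/100" by (simp add: power2_eq_square algebra_simps)
    moreover have "y^2 \<ge> (14/100)^2" using xy by (intro power_mono) auto
    moreover have "14/100 * (14/100) = (196/10000 :: real)" "86 / 100 * (114 / 100) = (9804/10000 :: real)" by simp_all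
    ultimately show ?thesis using True unfolding power2_eq_square by argo
  next
    case False
    then consider "x < 86/100" | "x > 114/100" by linarith
    then show ?thesis
    proof cases
      case 1
      have "32 * x * (1 - x) \<le> 32 * x * y" using xy by (intro mult_left_mono) auto
      moreover have "(x - 3/10) * (86/100 - x) \<ge> 0" using 1 xy by (intro mult_nonneg_nonneg) auto
      then have "x^2 \<le> 116/100 * x - 3/10*86/100" by (simp add: power2_eq_square field_simps)
      moreover have "y^2 \<ge> (1-x)^2" using xy 1 by (intro power_mono) auto
      ultimately show ?thesis using xy 1 by (simp add: power2_eq_square algebra_simps)
    next
      case 2
      have "x * (x - 1) \<le> x * y" using xy by (intro mult_left_mono) auto
      then have a: "x * x - x \<le> x * y" by (simp add: algebra_simps)
      have b: "114/100 * x \<le> x * x" using 2 xy by (intro mult_right_mono) auto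
      have "(x - 1)^2 \<le> y^2" using xy 2 by (intro power_mono) auto
      then have c: "x * x - 2 * x + 1 \<le> y * y" by (simp add: power2_eq_square algebra_simps)
      have "11/10 * (2 + 2 * (x * x)) - 11/10 * (y * y) \<le> 32 * (x * y)"
        using a b c 2 by argo
      then show ?thesis by (simp add: power2_eq_square)
    qed
  qed
  then show ?thesis unfolding norm_one_plus_sq x_def y_def by argo
qed

lemma cubic_expansion:
  assumes "3/10 \<le> cmod z" "8/100 \<le> cmod (1 - z)"
  shows "11/10 * cmod (1 + z + z^2) ^ 2 \<le> 243 * cmod z ^ 3 * cmod (1 - z)"
proof -
  define x y where "x = cmod z" and "y = cmod (1 - z)"
  have xy: "3/10 \<le> x" "8/100 \<le> y" "1 - x \<le> y" "x - 1 \<le> y"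
    using assms norm_one_minus_bounds[of z] by (auto simp: x_def y_def)
  have n: "cmod (1 + z + z^2) \<le> 1 + x + x^2"
    using norm_triangle_ineq[of "1+z" "z^2"] norm_triangle_ineq[of 1 z]
    by (simp add: x_def norm_power)
  have n2: "cmod (1 + z + z^2)^2 \<le> (1 + x + x^2)^2" using n by (intro power_mono) auto
  \<comment> \<open>Interval check: on \<open>[a, b]\<close> the left side is evaluated at
    \<open>b\<close> and the right side at \<open>a\<close>, with a lower bound \<open>c\<close> for
    \<open>y\<close>. In the pieces below \<open>c\<close> is the larger of \<open>1 - b\<close> and
    the trap radius 8/100; they are short enough for the resulting numerical inequalities to
    hold.\<close>
  have mono: "11/10 * (1 + x + x^2)^2 \<le> 243 * x^3 * y"
    if "a \<le> x" "x \<le> b" "0 \<le> a" "11/10 * (1 + b + b^2)^2 \<le> 243 * a^3 * c" "0 \<le> c" "c \<le> y" for a b c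
  proof -
    have "(1 + x + x^2)^2 \<le> (1 + b + b^2)^2" using that
      by (intro power_mono add_mono) auto
    moreover have "243 * a^3 * c \<le> 243 * x^3 * y"
      using that xy by (intro mult_mono power_mono) auto
    ultimately show ?thesis using that by linarith
  qed
  consider "x \<le> 1/2" | "1/2 \<le> x" "x \<le> 8/10" | "8/10 \<le> x" "x \<le> 92/100" | "92/100 \<le> x" "x \<le> 107/100" | "107/100 \<le> x"
    by linarith
  then have "11/10 * (1 + x + x^2)^2 \<le> 243 * x^3 * y"
  proof cases
    case 1
    show ?thesis
    proof (cases "x \<le> 35/100")
      case True then show ?thesis using xy by (intro mono[of "3/10" "35/100" "65/100"]) (auto simp: power2_eq_square power3_eq_cube)
    next
      case False then show ?thesis using 1 xy by (intro mono[of "35/100" "1/2" "1/2"]) (auto simp: power2_eq_square power3_eq_cube)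
    qed
  next
    case 2 then show ?thesis using xy
      by (cases "x \<le> 7/10"; intro mono[of "1/2" "7/10" "3/10"] mono[of "7/10" "8/10" "2/10"])
         (auto simp: power2_eq_square power3_eq_cube)
  next
    case 3 then show ?thesis using xy
      by (intro mono[of "8/10" "92/100" "8/100"]) (auto simp: power2_eq_square power3_eq_cube)
  next
    case 4 then show ?thesis using xy
      by (intro mono[of "92/100" "107/100" "8/100"]) (auto simp: power2_eq_square power3_eq_cube)
  next
    case 5
    have "107/100 * x \<le> x * x" using 5 by (intro mult_right_mono) auto
    then have "1 + x + x^2 \<le> 3 * x^2" using 5 unfolding power2_eq_square by linarith
    then have "(1 + x + x^2)^2 \<le> (3*x^2)^2" using 5 by (intro power_mono) auto
    also have "\<dots> = 9 * x * x^3" by (simp add: power2_eq_square power3_eq_cube algebra_simps)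
    finally have "11/10 * (1 + x + x^2)^2 \<le> (99/10 * x) * x^3" by simp
    also have "\<dots> \<le> (243 * (x - 1)) * x^3" using 5 by (intro mult_right_mono) auto
    also have "\<dots> \<le> (243 * y) * x^3" using 5 xy by (intro mult_right_mono) auto
    finally show ?thesis by (simp add: algebra_simps)
  qed
  with n2 show ?thesis unfolding x_def y_def by linarith
qed

text \<open>After cancelling common factors, the ratio of the right side to
  \<open>\<sigma> (fmap d z)\<close> is
  \<open>32 \<bar>z\<bar> \<bar>1 - z\<bar> / \<bar>1 + z\<bar>^2\<close> for degree 2 and
  \<open>243 \<bar>z\<bar>^3 \<bar>1 - z\<bar> / \<bar>1 + z + z^2\<bar>^2\<close> for degree 3.
  Both degenerate only at the cycle points 0 and 1, which the two discs remove.\<close>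

lemma \<sigma>_expand:
  assumes "3/10 \<le> cmod z" "trap1 d \<le> cmod (1 - z)" "d = 2 \<or> d = 3"
  shows "11/10 * \<sigma> (fmap d z) \<le> cmod (of_nat d * z ^ (d - 1)) ^ 5 * \<sigma> z"
proof -
  let ?x = "cmod z" and ?y = "cmod (1 - z)"
  from assms(3) show ?thesis
  proof
    assume d: "d = 2"
    have f: "fmap d z = (1 - z) * (1 + z)" by (simp add: fmap_def d power2_eq_square algebra_simps)
    have "\<sigma> (fmap d z) = (?y * cmod (1 + z))^2 * (?x^2)^3"
      unfolding \<sigma>_def by (subst f) (simp add: norm_mult norm_power fmap_def d)
    then have "11/10 * \<sigma> (fmap d z) = 11/10 * cmod (1 + z)^2 * (?y^2 * ?x^6)"
      by (simp add: power_mult_distrib)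
    also have "\<dots> \<le> 32 * ?x * ?y * (?y^2 * ?x^6)"
      using quadratic_expansion[of z] assms d by (intro mult_right_mono) (auto simp: trap1_def)
    also have "\<dots> = cmod (of_nat d * z ^ (d - 1)) ^ 5 * \<sigma> z"
      by (simp add: \<sigma>_def d norm_mult norm_power power_mult_distrib eval_nat_numeral algebra_simps)
    finally show ?thesis .
  next
    assume d: "d = 3"
    have f: "fmap d z = (1 - z) * (1 + z + z^2)"
      by (simp add: fmap_def d power2_eq_square power3_eq_cube algebra_simps)
    have "\<sigma> (fmap d z) = (?y * cmod (1 + z + z^2))^2 * (?x^3)^3"
      unfolding \<sigma>_def by (subst f) (simp add: norm_mult norm_power fmap_def d)
    then have "11/10 * \<sigma> (fmap d z) = 11/10 * cmod (1 + z + z^2)^2 * (?y^2 * ?x^9)"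
      by (simp add: power_mult_distrib)
    also have "\<dots> \<le> 243 * ?x^3 * ?y * (?y^2 * ?x^9)"
      using cubic_expansion[of z] assms d by (intro mult_right_mono) (auto simp: trap1_def)
    also have "\<dots> = cmod (of_nat d * z ^ (d - 1)) ^ 5 * \<sigma> z"
      by (simp add: \<sigma>_def d norm_mult norm_power power_mult_distrib eval_nat_numeral algebra_simps)
    finally show ?thesis .
  qed
qed

section \<open>Filled Julia sets\<close>

lemma fmap_has_field_derivative [derivative_intros]:
  "(fmap d has_field_derivative - (of_nat d * z ^ (d - 1))) (at z within A)"
  unfolding fmap_def by (auto intro!: derivative_eq_intros)

lemma fmap_holomorphic [holomorphic_intros]: "fmap d holomorphic_on A"
  unfolding fmap_def by (intro holomorphic_intros)

lemma continuous_on_fmap: "continuous_on A (fmap d)"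
  by (intro holomorphic_on_imp_continuous_on holomorphic_intros)

text \<open>Each component of the preimage maps onto \<open>S\<close>, hence contains the only preimage \<open>0\<close> of
  the critical value \<open>1\<close>.\<close>

lemma connected_fmap_vimage:
  assumes S: "compact S" "connected S" "1 \<in> S" and d: "0 < d"
  shows "connected (fmap d -` S)"
proof (rule ccontr)
  define V where "V = fmap d -` S"
  assume "\<not> connected (fmap d -` S)"
  then obtain A B where AB: "openin (top_of_set V) A" "openin (top_of_set V) B"
      "V \<subseteq> A \<union> B" "A \<inter> B = {}" "A \<noteq> {}" "B \<noteq> {}"
    unfolding connected_openin V_def by blast
  have op: "open (fmap d ` U)" if "open U" for U
  proof (rule open_mapping_thm[of "fmap d" UNIV])
    show "\<not> fmap d constant_on UNIV"
    proof
      assume "fmap d constant_on UNIV"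
      then have "fmap d 0 = fmap d 1" unfolding constant_on_def by auto
      then show False using d by (simp add: fmap_def power_0_left)
    qed
  qed (use that in \<open>auto intro: holomorphic_intros\<close>)
  have opS: "openin (top_of_set S) (fmap d ` W)" if "openin (top_of_set V) W" for W
  proof -
    from that obtain O' where O': "open O'" "W = V \<inter> O'" by (auto simp: openin_open)
    have "fmap d ` W = S \<inter> fmap d ` O'" using O' by (auto simp: V_def)
    then show ?thesis using op[OF O'(1)] by (auto simp: openin_open)
  qed
  have surj: "\<exists>z. fmap d z = w" for w
  proof -
    obtain z where "1 - w = z ^ d" using exists_complex_root[of d "1 - w"] d by auto
    then have "fmap d z = w" by (simp add: fmap_def flip: \<open>1 - w = z ^ d\<close>)
    then show ?thesis ..
  qed
  have SAB: "S \<subseteq> fmap d ` A \<union> fmap d ` B"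
  proof
    fix w assume "w \<in> S"
    moreover obtain z where "fmap d z = w" using surj by blast
    ultimately show "w \<in> fmap d ` A \<union> fmap d ` B" using AB(3) unfolding V_def by blast
  qed
  have sub: "A \<subseteq> V" "B \<subseteq> V" using AB openin_imp_subset by blast+
  have VAB: "V = A \<union> B" using sub AB by blast
  have comp: "compact V"
  proof -
    have "bounded V"
    proof -
      obtain b where b: "\<And>x. x \<in> S \<Longrightarrow> cmod x \<le> b"
        using compact_imp_bounded[OF S(1)] by (auto simp: bounded_iff)
      have "cmod z \<le> b + 1" if "z \<in> V" for z
      proof (rule ccontr)
        assume "\<not> cmod z \<le> b + 1"
        then have z: "cmod z > b + 1" by simp
        have fz: "cmod (fmap d z) \<le> b" using b that by (auto simp: V_def)
        then have "b \<ge> 0" using norm_ge_zero order_trans by blast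
        then have "cmod z ^ 1 \<le> cmod z ^ d" using z d by (intro power_increasing) auto
        moreover have "cmod (z^d) \<le> b + 1"
          using fz norm_triangle_ineq4[of 1 "fmap d z"] by (simp add: fmap_def)
        ultimately show False using z by (simp add: norm_power)
      qed
      then show ?thesis by (auto simp: bounded_iff)
    qed
    moreover have "closed V" unfolding V_def
      using continuous_closed_vimage[of S "fmap d"] compact_imp_closed[OF S(1)] continuous_on_fmap[of UNIV d]
      by (simp add: continuous_on_eq_continuous_at)
    ultimately show ?thesis by (simp add: compact_eq_bounded_closed)
  qed
  have one: "0 \<in> W" if W: "openin (top_of_set V) W" "W \<noteq> {}" "compact W" for W
  proof -
    have "closedin (top_of_set S) (fmap d ` W)"
    proof (rule closed_subset)
      show "fmap d ` W \<subseteq> S" using openin_imp_subset[OF W(1)] by (auto simp: V_def)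
      show "closed (fmap d ` W)"
        using W(3) compact_continuous_image continuous_on_fmap compact_imp_closed by blast
    qed
    then have "fmap d ` W = S"
      using opS[OF W(1)] W(2) S(2) unfolding connected_clopen by blast
    then obtain z where "z \<in> W" "fmap d z = 1" using S(3) by (metis imageE)
    then show ?thesis by (auto simp: fmap_def)
  qed
  have cA: "compact A" "compact B"
  proof -
    have "V - A = B" "V - B = A" using VAB AB by auto
    then have "closedin (top_of_set V) A" "closedin (top_of_set V) B"
      using AB(1,2) sub by (simp_all add: closedin_def)
    then show "compact A" "compact B" using comp closedin_compact by blast+
  qed
  show False using one[of A] one[of B] AB cA by blast
qed

section \<open>Dynamics of an arbitrary sequence of the maps of degrees 2 and 3\<close>

locale mixed_seq =
  fixes d :: "nat \<Rightarrow> nat"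
  assumes deg: "d m = 2 \<or> d m = 3"
begin

lemma deg_ge: "2 \<le> d m" and deg_le: "d m \<le> 3" and deg_pos: "0 < d m" and deg_ne: "d m \<noteq> 0"
  using deg[of m] by auto

definition P :: "nat \<Rightarrow> complex poly" where
  "P m = [:1:] - monom 1 (d m)"

definition it :: "nat \<Rightarrow> nat \<Rightarrow> complex \<Rightarrow> complex" where
  "it m k = Q P m (m + k)"

text \<open>Escape-radius form of the filled Julia set: beyond modulus 2 orbits grow geometrically,
  so a limsup condition becomes a family of closed conditions.\<close>

definition K :: "nat \<Rightarrow> complex set" where
  "K m = {z. \<forall>k. cmod (it m k z) \<le> 2}"

lemma poly_P: "poly (P m) z = fmap (d m) z"
  by (simp add: P_def fmap_def poly_monom)

lemma coeff_P: "coeff (P m) k = (if k = 0 then 1 else if k = d m then -1 else 0)"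
  using deg_pos[of m] by (auto simp: P_def coeff_pCons split: nat.splits)

lemma degree_P: "degree (P m) = d m"
proof (rule antisym)
  show "degree (P m) \<le> d m" using deg_pos[of m] by (intro degree_le) (auto simp: coeff_P)
  show "d m \<le> degree (P m)" using deg_pos[of m] by (intro le_degree) (simp add: coeff_P)
qed

lemma lead_coeff_P: "lead_coeff (P m) = -1"
  using deg_pos[of m] by (simp add: degree_P coeff_P)

lemma bounded_P: "bounded_poly_seq P"
  unfolding bounded_poly_seq_def bounded_poly_seq_with_def
proof (rule exI[of _ 3], rule exI[of _ 1], rule exI[of _ 1], intro conjI allI impI)
  fix m k assume "k < degree (P m)"
  then show "cmod (coeff (P m) k) \<le> 1" by (simp add: coeff_P degree_P)
qed (use deg_ge deg_le lead_coeff_P in \<open>auto simp: degree_P\<close>)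

lemma unicritical_P: "unicritical_seq P"
  unfolding unicritical_seq_def
proof (intro allI impI)
  fix m :: nat
  have "pderiv (P m) = - monom (of_nat (d m)) (d m - 1)"
    by (simp add: P_def pderiv_diff pderiv_monom pderiv_pCons)
  then have "poly (pderiv (P m)) z = - (of_nat (d m) * z ^ (d m - 1))" for z
    by (simp add: poly_monom)
  then show "\<exists>!z. poly (pderiv (P m)) z = 0"
    using deg[of m] by (intro ex1I[of _ 0]) auto
qed

lemma it_0 [simp]: "it m 0 z = z"
proof -
  have "Q P m m = id" by (cases m) auto
  then show ?thesis by (simp add: it_def)
qed

lemma it_Suc: "it m (Suc k) z = fmap (d (Suc (m + k))) (it m k z)"
  by (simp add: it_def poly_P)

lemma it_add: "it m (j + k) z = it (m + j) k (it m j z)"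
  by (induction k) (simp_all add: it_Suc add.assoc)

lemma it_Suc': "it m (Suc k) z = it (Suc m) k (fmap (d (Suc m)) z)"
  using it_add[of m 1 k z] by (simp add: it_Suc)

lemma it_escape:
  assumes "2 \<le> cmod z" shows "(3/2)^k * cmod z \<le> cmod (it m k z)"
proof (induction k)
  case (Suc k)
  have "1 * cmod z \<le> (3/2)^k * cmod z" using assms by (intro mult_right_mono) auto
  then have "2 \<le> cmod (it m k z)" using Suc assms by linarith
  then have "3/2 * cmod (it m k z) \<le> cmod (it m (Suc k) z)"
    unfolding it_Suc by (intro fmap_escape deg_ge)
  moreover have "3/2 * ((3/2)^k * cmod z) \<le> 3/2 * cmod (it m k z)" using Suc by (intro mult_left_mono) auto
  ultimately show ?case by (simp only: power_Suc mult.assoc)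
qed auto

lemma escape_limit:
  assumes "2 < cmod (it m k z)"
  shows "filterlim (\<lambda>n. cmod (Q P m n z)) at_top sequentially"
proof -
  have l: "filterlim (\<lambda>n. (3/2::real)^n * 2) at_top sequentially" by real_asymp
  have b: "eventually (\<lambda>n. (3/2)^n * 2 \<le> cmod (Q P m (n + (m + k)) z)) sequentially"
  proof (rule always_eventually, rule allI)
    fix n
    have "(3/2)^n * 2 \<le> (3/2)^n * cmod (it m k z)" using assms by (intro mult_left_mono) auto
    also have "\<dots> \<le> cmod (it (m + k) n (it m k z))" using assms by (intro it_escape) auto
    also have "it (m + k) n (it m k z) = Q P m (n + (m + k)) z"
      using it_add[of m k n z] by (simp add: it_def add_ac)
    finally show "(3/2)^n * 2 \<le> cmod (Q P m (n + (m + k)) z)" .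
  qed
  have "filterlim (\<lambda>n. cmod (Q P m (n + (m + k)) z)) at_top sequentially"
    by (rule filterlim_at_top_mono[OF l b])
  then show ?thesis
    unfolding filterlim_at_top
    using eventually_sequentially_seg[of "\<lambda>n. _ \<le> cmod (Q P m n z)" "m + k"] by blast
qed

lemma filled_julia_P: "filled_julia P m = K m"
  and basin_P: "basin_inf P m = - K m"
proof -
  have out: "\<not> limsup (\<lambda>n. ereal (cmod (Q P m n z))) < \<infinity> \<and> filterlim (\<lambda>n. cmod (Q P m n z)) at_top sequentially"
    if "z \<notin> K m" for z
  proof -
    from that obtain k where k: "cmod (it m k z) > 2" by (auto simp: K_def not_le)
    note l = escape_limit[OF k]
    then have "(\<lambda>n. ereal (cmod (Q P m n z))) \<longlonglongrightarrow> \<infinity>"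
      by (metis tendsto_PInfty_eq_at_top)
    then have "limsup (\<lambda>n. ereal (cmod (Q P m n z))) = \<infinity>"
      by (intro lim_imp_Limsup) auto
    with l show ?thesis by simp
  qed
  have inn: "limsup (\<lambda>n. ereal (cmod (Q P m n z))) < \<infinity> \<and> \<not> filterlim (\<lambda>n. cmod (Q P m n z)) at_top sequentially"
    if "z \<in> K m" for z
  proof -
    have ev: "eventually (\<lambda>n. cmod (Q P m n z) \<le> 2) sequentially"
      using eventually_ge_at_top[of m]
    proof eventually_elim
      case (elim n)
      then obtain k where "n = m + k" using le_Suc_ex by blast
      with that show ?case by (auto simp: K_def it_def)
    qed
    then have "limsup (\<lambda>n. ereal (cmod (Q P m n z))) \<le> 2"
      by (intro Limsup_bounded) (auto elim: eventually_mono)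
    then have "limsup (\<lambda>n. ereal (cmod (Q P m n z))) < \<infinity>" by (rule le_less_trans) simp
    moreover have "\<not> filterlim (\<lambda>n. cmod (Q P m n z)) at_top sequentially"
    proof
      assume "filterlim (\<lambda>n. cmod (Q P m n z)) at_top sequentially"
      then have "eventually (\<lambda>n. cmod (Q P m n z) > 2) sequentially"
        by (simp add: filterlim_at_top_dense)
      with ev have "eventually (\<lambda>_::nat. False) sequentially" by eventually_elim auto
      then show False by simp
    qed
    ultimately show ?thesis by blast
  qed
  show "filled_julia P m = K m" "basin_inf P m = - K m"
    unfolding filled_julia_def basin_inf_def using out inn by blast+
qed

lemma K_subset: "K m \<subseteq> cball 0 2"
proof
  fix z assume "z \<in> K m"
  then have "cmod (it m 0 z) \<le> 2" unfolding K_def by blast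
  then show "z \<in> cball 0 2" by simp
qed

lemma fmap_in_K_iff: "fmap (d (Suc m)) z \<in> K (Suc m) \<longleftrightarrow> z \<in> K m"
proof
  assume f: "fmap (d (Suc m)) z \<in> K (Suc m)"
  have "cmod z \<le> 2"
  proof (rule ccontr)
    assume "\<not> cmod z \<le> 2"
    then show False
      using fmap_escape[of z "d (Suc m)"] deg_ge K_subset[of "Suc m"] f by auto
  qed
  moreover have "cmod (it m (Suc k) z) \<le> 2" for k
    using f by (simp add: K_def it_Suc')
  ultimately show "z \<in> K m" unfolding K_def by (auto, metis it_0 not0_implies_Suc)
next
  assume "z \<in> K m"
  then have "cmod (it m (Suc k) z) \<le> 2" for k unfolding K_def by blast
  then show "fmap (d (Suc m)) z \<in> K (Suc m)" by (simp add: K_def it_Suc')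
qed

lemma it_in_K_iff: "it m k z \<in> K (m + k) \<longleftrightarrow> z \<in> K m"
  by (induction k) (simp_all add: it_Suc fmap_in_K_iff)

lemma it_holomorphic [holomorphic_intros]: "it m k holomorphic_on A"
proof (induction k)
  case 0 then show ?case by (simp cong: holomorphic_cong)
next
  case (Suc k)
  then show ?case
    using holomorphic_on_compose[of "it m k" A "fmap (d (Suc (m + k)))"] fmap_holomorphic
    by (simp add: it_Suc o_def cong: holomorphic_cong)
qed

lemma continuous_on_it: "continuous_on A (it m k)"
  by (intro holomorphic_on_imp_continuous_on holomorphic_intros)

lemma compact_K: "compact (K m)"
proof -
  have "K m = (\<Inter>k. it m k -` cball 0 2)" by (auto simp: K_def)
  moreover have "closed (it m k -` cball 0 2)" for k
    using continuous_closed_vimage[of "cball 0 2" "it m k"] continuous_on_it[of UNIV m k]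
    by (simp add: continuous_on_eq_continuous_at)
  ultimately have "closed (K m)" by auto
  moreover have "bounded (K m)" using K_subset bounded_cball bounded_subset by blast
  ultimately show ?thesis by (simp add: compact_eq_bounded_closed)
qed

text \<open>At even times the orbit is back in the small disc; at odd times it is the image of a
  point of that disc, hence bounded by 1 + 1.\<close>

lemma trap0_in_K: assumes "cmod z \<le> 3/10" shows "z \<in> K m"
proof -
  have even: "cmod (it m (2 * k) z) \<le> 3/10" for k
  proof (induction k)
    case (Suc k)
    have "it m (2 * Suc k) z = fmap (d (Suc (Suc (m + 2 * k)))) (fmap (d (Suc (m + 2 * k))) (it m (2 * k) z))"
      by (simp add: it_Suc)
    with fmap_trap[OF Suc deg deg] show ?case by simp
  qed (use assms in simp)
  have "cmod (it m k z) \<le> 2" for k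
  proof (cases "even k")
    case True then show ?thesis using even[of "k div 2"] by simp
  next
    case False
    then obtain j where k: "k = Suc (2 * j)" by (metis oddE Suc_eq_plus1)
    let ?w = "it m (2 * j) z"
    have "cmod ?w ^ d (Suc (m + 2*j)) \<le> 1" using even[of j] by (intro power_le_one) auto
    then show ?thesis
      using norm_triangle_ineq4[of 1 "?w ^ d (Suc (m + 2*j))"] by (simp add: k it_Suc fmap_def norm_power)
  qed
  then show ?thesis by (simp add: K_def)
qed

lemma trap1_in_K: "cmod (1 - z) \<le> trap1 (d (Suc m)) \<Longrightarrow> z \<in> K m"
  using fmap_trap1[OF _ deg] trap0_in_K fmap_in_K_iff by blast

lemma zero_in_K [simp]: "0 \<in> K m" by (simp add: trap0_in_K)
lemma one_in_K [simp]: "1 \<in> K m" using trap1_bounds(2)[of "d (Suc m)"] by (intro trap1_in_K) auto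

text \<open>\<open>K m\<close> is the decreasing intersection of the preimages of the disc of radius
  2. Each is obtained by successive pullbacks, and connectedness survives each of them because the
  critical value 1 has its whole orbit in \<open>{0, 1}\<close>, inside every set that is pulled
  back.\<close>

lemma connected_K: "connected (K m)"
proof -
  define V where "V m k = it m k -` cball 0 2" for m k
  have it01: "it m k 0 \<in> {0, 1}" "it m k 1 \<in> {0,1}" for m k
    by (induction k) (use deg_ne in \<open>auto simp: it_Suc fmap_def\<close>)
  have V: "compact (V m k) \<and> connected (V m k) \<and> 1 \<in> V m k \<and> V m k \<subseteq> cball 0 2" for m k
  proof (induction k arbitrary: m)
    case 0
    have "V m 0 = cball 0 2" by (auto simp: V_def)
    then show ?case by (simp add: convex_connected)
  next
    case (Suc k)
    have V: "V m (Suc k) = fmap (d (Suc m)) -` V (Suc m) k"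
      by (auto simp: V_def it_Suc')
    have "connected (V m (Suc k))"
      unfolding V using Suc deg_pos by (intro connected_fmap_vimage) auto
    moreover have sub: "V m (Suc k) \<subseteq> cball 0 2"
    proof
      fix z assume "z \<in> V m (Suc k)"
      then have "cmod (fmap (d (Suc m)) z) \<le> 2" using V Suc by force
      then show "z \<in> cball 0 2"
        using fmap_escape[of z "d (Suc m)"] deg_ge by force
    qed
    moreover have "closed (V m (Suc k))" unfolding V_def
      using continuous_closed_vimage[of "cball 0 2" "it m (Suc k)"] continuous_on_it[of UNIV m "Suc k"]
      by (simp add: continuous_on_eq_continuous_at)
    then have "compact (V m (Suc k))"
      using sub bounded_subset[OF bounded_cball] by (auto simp: compact_eq_bounded_closed)
    moreover have "1 \<in> V m (Suc k)" using it01(2)[of m "Suc k"] by (auto simp: V_def)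
    ultimately show ?case by blast
  qed
  \<comment> \<open>A point that has left the disc of radius 2 never returns to it.\<close>
  have dec: "V m (Suc k) \<subseteq> V m k" for k
  proof
    fix z assume z: "z \<in> V m (Suc k)"
    then show "z \<in> V m k"
      using fmap_escape[of "it m k z" "d (Suc (m + k))"] deg_ge
      by (force simp: V_def it_Suc)
  qed
  have "connected (\<Inter> (range (V m)))"
    using V lift_Suc_antimono_le[of "V m", OF dec] by (intro connected_nest) auto
  moreover have "\<Inter> (range (V m)) = K m" by (auto simp: V_def K_def)
  ultimately show ?thesis by simp
qed

text \<open>A bounded component of the basin has its boundary in \<open>K m\<close>, so by the
  maximum principle all iterates are bounded by 2 on it, which puts it inside \<open>K m\<close>. An
  open set with bounded complement and no bounded component is connected.\<close>

lemma connected_basin: "connected (- K m)"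
proof -
  have op: "open (- K m)" using compact_K compact_imp_closed by auto
  have unb: "\<not> bounded C" if C: "C \<in> components (- K m)" for C
  proof
    assume b: "bounded C"
    have oC: "open C" using open_components[OF op C] .
    have fr: "frontier C \<subseteq> K m"
    proof
      fix z assume z: "z \<in> frontier C"
      show "z \<in> K m"
        using z frontier_of_components_subset[OF C] frontier_complement[of "K m"]
          compact_imp_closed[OF compact_K] frontier_subset_closed by blast
    qed
    have "C \<subseteq> K m"
    proof
      fix z assume z: "z \<in> C"
      have "cmod (it m k z) \<le> 2" for k
      proof (rule maximum_modulus_frontier[of "it m k" C])
        show "cmod (it m k w) \<le> 2" if "w \<in> frontier C" for w
          using fr that by (auto simp: K_def)
      qed (use b z continuous_on_it it_holomorphic in auto)
      then show "z \<in> K m" by (simp add: K_def)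
    qed
    then show False using in_components_subset[OF C] in_components_nonempty[OF C] by blast
  qed
  with unb show ?thesis
    using cobounded_has_bounded_component[of "- K m"] compact_imp_bounded[OF compact_K] by auto
qed

lemma connected_P: "connected_seq P"
  unfolding connected_seq_def julia_def filled_julia_P
  using connected_frontier_simple[OF connected_K connected_basin] by simp

end

section \<open>Normalised Riemann maps\<close>

text \<open>Removable singularity at 0. The factorisation itself holds for all \<open>z\<close>,
  also outside \<open>S\<close>, so it can be rewritten with freely.\<close>

lemma holomorphic_factor_0:
  fixes f :: "complex \<Rightarrow> complex"
  assumes "f holomorphic_on S" "open S" "f 0 = 0"
  obtains h where "h holomorphic_on S" "\<And>z. f z = z * h z" "h 0 = deriv f 0"
proof -
  define h where "h z = (if z = 0 then deriv f 0 else f z / z)" for z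
  have "h holomorphic_on S"
    by (rule pole_theorem_open_0 [OF assms(1,2), of 0]) (auto simp: h_def assms(3))
  then show ?thesis by (rule that) (auto simp: h_def assms(3))
qed

text \<open>Schwarz lemma for a zero of order \<open>n\<close>: on the circle of radius
  \<open>r\<close> the quotient is at most \<open>1 / r ^ n\<close>, the maximum principle carries
  this inside, and \<open>r\<close> tends to 1.\<close>

lemma Schwarz_order:
  assumes j: "j holomorphic_on ball 0 1"
    and b: "\<And>w. cmod w < 1 \<Longrightarrow> cmod (w ^ n * j w) \<le> 1" and w: "cmod w < 1"
  shows "cmod (j w) \<le> 1"
proof -
  have step: "cmod (j w) * r ^ n \<le> 1" if r: "cmod w < r" "r < 1" for r
  proof -
    have r0: "0 < r" using r(1) norm_ge_zero[of w] by linarith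
    have "cmod (j w) \<le> 1 / r ^ n"
    proof (rule maximum_modulus_frontier[of j "cball 0 r" "1 / r ^ n" w])
      show "j holomorphic_on interior (cball 0 r)"
        using j by (rule holomorphic_on_subset) (use r in auto)
      show "continuous_on (closure (cball 0 r)) j"
        using holomorphic_on_imp_continuous_on[OF j] by (rule continuous_on_subset) (use r in auto)
      show "cmod (j z) \<le> 1 / r ^ n" if "z \<in> frontier (cball 0 r)" for z
      proof -
        have z: "cmod z = r" using that r0 by (simp add: frontier_def)
        then show ?thesis using b[of z] r r0
          by (simp add: norm_mult norm_power field_simps)
      qed
    qed (use r in auto)
    then show ?thesis using r0 by (simp add: field_simps)
  qed
  have "((\<lambda>r. cmod (j w) * r ^ n) \<longlongrightarrow> cmod (j w) * 1 ^ n) (at_left 1)"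
    by (intro tendsto_intros)
  moreover have "eventually (\<lambda>r. cmod (j w) * r ^ n \<le> 1) (at_left 1)"
    unfolding eventually_at_left[OF w] using step w by (intro exI[of _ "cmod w"]) auto
  ultimately show ?thesis
    using tendsto_upperbound[of "\<lambda>r. cmod (j w) * r ^ n"] by force
qed

text \<open>The Riemann map with its inverse kept explicitly. The positive derivative at 0 removes
  the rotational freedom; this is what turns symmetries of the domain into symmetries of the
  map.\<close>

definition disc_map :: "complex set \<Rightarrow> (complex \<Rightarrow> complex) \<Rightarrow> (complex \<Rightarrow> complex) \<Rightarrow> bool" where
  "disc_map W f g \<longleftrightarrow> f holomorphic_on W \<and> g holomorphic_on ball 0 1 \<and>
     (\<forall>z\<in>W. f z \<in> ball 0 1 \<and> g (f z) = z) \<and> (\<forall>w\<in>ball 0 1. g w \<in> W \<and> f (g w) = w) \<and>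
     f 0 = 0 \<and> (\<exists>r>0. deriv f 0 = of_real r)"

lemma disc_mapD:
  assumes "disc_map W f g"
  shows "f holomorphic_on W" "g holomorphic_on ball 0 1"
    "\<And>z. z \<in> W \<Longrightarrow> cmod (f z) < 1" "\<And>z. z \<in> W \<Longrightarrow> g (f z) = z"
    "\<And>w. cmod w < 1 \<Longrightarrow> g w \<in> W" "\<And>w. cmod w < 1 \<Longrightarrow> f (g w) = w"
    "f 0 = 0" "\<exists>r>0. deriv f 0 = of_real r"
  using assms unfolding disc_map_def by auto

lemma disc_map_deriv:
  assumes D: "disc_map W f g" and W: "open W" "0 \<in> W"
  shows "g 0 = 0" "deriv f 0 * deriv g 0 = 1" "\<exists>r>0. deriv g 0 = of_real r"
proof -
  note [simp] = disc_mapD(7)[OF D]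
  show g0 [simp]: "g 0 = 0" using disc_mapD(4)[OF D W(2)] by simp
  have "(g has_field_derivative deriv g 0) (at 0)"
    using holomorphic_derivI[OF disc_mapD(2)[OF D], of 0] by simp
  moreover have "(f has_field_derivative deriv f 0) (at (g 0))"
    using holomorphic_derivI[OF disc_mapD(1)[OF D] W] by simp
  ultimately have "((\<lambda>w. f (g w)) has_field_derivative deriv f 0 * deriv g 0) (at 0)"
    by (rule DERIV_chain2[rotated])
  then have "((\<lambda>w. w) has_field_derivative deriv f 0 * deriv g 0) (at 0)"
    by (rule has_field_derivative_transform_within_open[of _ _ _ "ball 0 1"])
       (use disc_mapD(6)[OF D] in auto)
  then show e: "deriv f 0 * deriv g 0 = 1" using DERIV_ident DERIV_unique by blast
  obtain r where r: "r > 0" "deriv f 0 = of_real r" using disc_mapD(8)[OF D] by blast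
  then have "deriv g 0 = of_real (1 / r)" using e by (auto simp: field_simps)
  then show "\<exists>r>0. deriv g 0 = of_real r" using r by (intro exI[of _ "1/r"]) auto
qed

lemma disc_map_exists:
  assumes W: "open W" "simply_connected W" "0 \<in> W" "W \<noteq> UNIV"
  shows "\<exists>f g. disc_map W f g"
proof -
  obtain f g where f: "f holomorphic_on W" and g: "g holomorphic_on ball 0 1"
    and fg: "\<And>z. z \<in> W \<Longrightarrow> f z \<in> ball 0 1 \<and> g (f z) = z"
    and gf: "\<And>w. w \<in> ball 0 1 \<Longrightarrow> g w \<in> W \<and> f (g w) = w"
    using iffD1[OF simply_connected_eq_biholomorphic_to_disc[OF W(1)] W(2)] W(3,4) by blast
  obtain p q where pq: "p (f 0) = 0" "p holomorphic_on ball 0 1" "p ` ball 0 1 \<subseteq> ball 0 1"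
      "q holomorphic_on ball 0 1" "q ` ball 0 1 \<subseteq> ball 0 1"
      "\<And>z. z \<in> ball 0 1 \<Longrightarrow> p (q z) = z" "\<And>z. z \<in> ball 0 1 \<Longrightarrow> q (p z) = z"
    using ball_biholomorphism_exists[of "f 0"] fg[OF W(3)] by metis
  define F G where "F = p \<circ> f" and "G = g \<circ> q"
  have F: "F holomorphic_on W" unfolding F_def
    using f pq(2) fg by (intro holomorphic_on_compose holomorphic_on_subset[OF pq(2)]) auto
  have G: "G holomorphic_on ball 0 1" unfolding G_def
    using pq by (intro holomorphic_on_compose holomorphic_on_subset[OF g]) auto
  have FG: "F z \<in> ball 0 1 \<and> G (F z) = z" if "z \<in> W" for z
    using fg[OF that] pq(3) pq(7)[of "f z"] by (auto simp: F_def G_def image_subset_iff)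
  have GF: "G w \<in> W \<and> F (G w) = w" if "w \<in> ball 0 1" for w
    using gf[of "q w"] pq(5) pq(6)[OF that] that by (auto simp: F_def G_def image_subset_iff)
  have F0: "F 0 = 0" using pq(1) by (simp add: F_def)
  have inj: "inj_on F W" using FG by (metis inj_onI)
  have nz: "deriv F 0 \<noteq> 0" using holomorphic_injective_imp_regular[OF F W(1) inj W(3)] .
  \<comment> \<open>The unimodular factor that turns the derivative at 0 onto the positive
    axis.\<close>
  define c where "c = cnj (deriv F 0) / of_real (cmod (deriv F 0))"
  have c: "cmod c = 1" using nz by (simp add: c_def norm_divide)
  have c0: "c \<noteq> 0" using c by auto
  have "disc_map W (\<lambda>z. c * F z) (\<lambda>w. G (w / c))"
    unfolding disc_map_def
  proof (intro conjI ballI)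
    show "(\<lambda>z. c * F z) holomorphic_on W" by (intro holomorphic_intros F)
    have "G \<circ> (\<lambda>w. w / c) holomorphic_on ball 0 1"
      by (intro holomorphic_on_compose holomorphic_intros holomorphic_on_subset[OF G] c0)
         (auto simp: norm_divide c)
    then show "(\<lambda>w. G (w / c)) holomorphic_on ball 0 1" by (simp add: o_def)
    show "\<exists>r>0. deriv (\<lambda>z. c * F z) 0 = complex_of_real r"
    proof (intro exI[of _ "cmod (deriv F 0)"] conjI)
      have "deriv (\<lambda>z. c * F z) 0 = c * deriv F 0"
        by (intro deriv_cmult holomorphic_on_imp_differentiable_at[OF F W(1,3)])
      also have "\<dots> = of_real (cmod (deriv F 0))"
        using nz complex_norm_square[of "deriv F 0"]
        by (simp add: c_def field_simps power2_eq_square)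
      finally show "deriv (\<lambda>z. c * F z) 0 = complex_of_real (cmod (deriv F 0))" .
    qed (use nz in auto)
  qed (use FG GF F0 c c0 in \<open>auto simp: norm_mult norm_divide\<close>)
  then show ?thesis by blast
qed

lemma Schwarz_deriv_1:
  assumes "h holomorphic_on ball 0 1" "h 0 = 0" "\<And>w. cmod w < 1 \<Longrightarrow> cmod (h w) < 1"
    and "deriv h 0 = 1" "cmod w < 1"
  shows "h w = w"
proof -
  obtain \<alpha> where a: "\<And>z. cmod z < 1 \<Longrightarrow> h z = \<alpha> * z"
    using Schwarz_Lemma(3)[OF assms(1-3), of 0] assms(4) by auto
  have "(h has_field_derivative deriv h 0) (at 0)"
    using holomorphic_derivI[OF assms(1), of 0] by simp
  then have "((\<lambda>z. \<alpha> * z) has_field_derivative 1) (at 0)"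
    unfolding assms(4) by (rule has_field_derivative_transform_within_open[of _ _ _ "ball 0 1"]) (use a in auto)
  moreover have "((\<lambda>z. \<alpha> * z) has_field_derivative \<alpha>) (at 0)"
    by (auto intro!: derivative_eq_intros)
  ultimately have "\<alpha> = 1" using DERIV_unique by blast
  then show ?thesis using a assms(5) by simp
qed

text \<open>The two transition maps fix 0 and have the positive derivatives \<open>r / s\<close> and
  \<open>s / r\<close>. Schwarz bounds both by 1, so \<open>r = s\<close>, and the equality case
  makes the transition the identity.\<close>

lemma disc_map_unique:
  assumes D: "disc_map W f g" "disc_map W f' g'" and W: "open W" "0 \<in> W" and w: "cmod w < 1"
  shows "g w = g' w"
proof -
  have main: "h2 holomorphic_on ball 0 1 \<and> h2 0 = 0 \<and> (\<forall>w. cmod w < 1 \<longrightarrow> cmod (h2 w) < 1) \<and>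
      deriv h2 0 = deriv f2 0 * deriv g1 0"
    if D: "disc_map W f1 g1" "disc_map W f2 g2" and h2: "h2 = f2 \<circ> g1" for f1 g1 f2 g2 h2
  proof (intro conjI allI impI)
    note [simp] = disc_map_deriv(1)[OF D(1) W] disc_mapD(7)[OF D(2)]
    show "h2 holomorphic_on ball 0 1" unfolding h2
      by (intro holomorphic_on_compose disc_mapD(2)[OF D(1)] holomorphic_on_subset[OF disc_mapD(1)[OF D(2)]])
         (use disc_mapD(5)[OF D(1)] in auto)
    show "h2 0 = 0" by (simp add: h2)
    show "cmod (h2 w) < 1" if "cmod w < 1" for w
      using disc_mapD(3)[OF D(2)] disc_mapD(5)[OF D(1)] that by (simp add: h2)
    show "deriv h2 0 = deriv f2 0 * deriv g1 0"
      unfolding h2 using holomorphic_on_imp_differentiable_at[OF disc_mapD(2)[OF D(1)] open_ball, of 0]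
        holomorphic_on_imp_differentiable_at[OF disc_mapD(1)[OF D(2)] W]
      by (subst deriv_chain) auto
  qed
  note d1 = disc_map_deriv[OF D(1) W] and d2 = disc_map_deriv[OF D(2) W]
  have h: "(f' \<circ> g) holomorphic_on ball 0 1" "(f' \<circ> g) 0 = 0" "\<And>w. cmod w < 1 \<Longrightarrow> cmod ((f' \<circ> g) w) < 1"
    "deriv (f' \<circ> g) 0 = deriv f' 0 * deriv g 0"
    using main[OF D refl] by blast+
  have k: "(f \<circ> g') holomorphic_on ball 0 1" "(f \<circ> g') 0 = 0" "\<And>w. cmod w < 1 \<Longrightarrow> cmod ((f \<circ> g') w) < 1"
    "deriv (f \<circ> g') 0 = deriv f 0 * deriv g' 0"
    using main[OF D(2,1) refl] by blast+
  have le: "cmod (deriv f' 0 * deriv g 0) \<le> 1" "cmod (deriv f 0 * deriv g' 0) \<le> 1"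
    using Schwarz_Lemma(2)[OF h(1-3), of 0] Schwarz_Lemma(2)[OF k(1-3), of 0]
    unfolding h(4) k(4) by auto
  obtain r s where rs: "r > 0" "s > 0" "deriv f' 0 = of_real r" "deriv f 0 = of_real s"
    using disc_mapD(8) D by metis
  have gd: "deriv g 0 = 1 / of_real s" "deriv g' 0 = 1 / of_real r"
    using d1(2) d2(2) rs by (auto simp: field_simps)
  have "r / s \<le> 1" "s / r \<le> 1" using le rs(1,2) unfolding rs gd by (auto simp: norm_mult norm_divide)
  then have "r = s" using rs by (simp add: field_simps)
  then have "deriv (f' \<circ> g) 0 = 1" using h(4) rs(1) unfolding rs gd by simp
  from Schwarz_deriv_1[OF h(1-3) this w] have "f' (g w) = w" by simp
  then show ?thesis using disc_mapD(4)[OF D(2)] disc_mapD(5)[OF D(1) w] by metis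
qed

text \<open>The conjugated pair is again a normalised Riemann pair, since conjugation fixes a real
  derivative; uniqueness identifies it with the original. The rotational symmetry below is obtained
  in the same manner.\<close>

lemma disc_map_cnj:
  assumes D: "disc_map W f g" and W: "open W" "0 \<in> W" and sym: "\<And>z. z \<in> W \<Longrightarrow> cnj z \<in> W" and w: "cmod w < 1"
  shows "g (cnj w) = cnj (g w)"
proof -
  have im: "cnj ` W = W" using sym by (metis complex_cnj_cnj image_iff subsetI subset_antisym image_subset_iff)
  have "disc_map W (cnj \<circ> f \<circ> cnj) (cnj \<circ> g \<circ> cnj)"
    unfolding disc_map_def
  proof (intro conjI ballI)
    show "cnj \<circ> f \<circ> cnj holomorphic_on W"
      using disc_mapD(1)[OF D] im W by (intro holomorphic_on_compose_cnj_cnj) auto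
    have "cnj ` ball 0 1 = ball 0 1"
      by (auto simp: image_iff intro!: bexI[of _ "cnj _"])
    then show "cnj \<circ> g \<circ> cnj holomorphic_on ball 0 1"
      using disc_mapD(2)[OF D] by (intro holomorphic_on_compose_cnj_cnj) auto
    obtain r where r: "r > 0" "deriv f 0 = of_real r" using disc_mapD(8)[OF D] by blast
    have "(f has_field_derivative deriv f 0) (at (cnj 0))"
      using holomorphic_derivI[OF disc_mapD(1)[OF D] W] by simp
    then have "(cnj \<circ> f \<circ> cnj has_field_derivative cnj (deriv f 0)) (at 0)"
      by (rule has_field_derivative_cnj_cnj)
    then have "deriv (cnj \<circ> f \<circ> cnj) 0 = of_real r" using r by (simp add: DERIV_imp_deriv)
    then show "\<exists>r>0. deriv (cnj \<circ> f \<circ> cnj) 0 = complex_of_real r" using r by blast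
  qed (use disc_mapD[OF D] sym in auto)
  from disc_map_unique[OF D this W, of "cnj w"] w show ?thesis by simp
qed

lemma disc_map_rotate:
  assumes D: "disc_map W f g" and W: "open W" "0 \<in> W" and c: "cmod c = 1"
    and sym: "\<And>z. c * z \<in> W \<longleftrightarrow> z \<in> W" and w: "cmod w < 1"
  shows "g (c * w) = c * g w"
proof -
  have c0: "c \<noteq> 0" using c by auto
  have sym': "z / c \<in> W" if "z \<in> W" for z using sym[of "z / c"] that c0 by simp
  have D': "disc_map W (\<lambda>z. f (c * z) / c) (\<lambda>w. g (c * w) / c)"
    unfolding disc_map_def
  proof (intro conjI ballI)
    have "f \<circ> (\<lambda>z. c * z) holomorphic_on W"
      by (intro holomorphic_on_compose holomorphic_intros holomorphic_on_subset[OF disc_mapD(1)[OF D]]) (use sym in auto)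
    then show "(\<lambda>z. f (c * z) / c) holomorphic_on W"
      using c0 by (auto simp: o_def intro!: holomorphic_intros)
    have "g \<circ> (\<lambda>z. c * z) holomorphic_on ball 0 1"
      by (intro holomorphic_on_compose holomorphic_intros holomorphic_on_subset[OF disc_mapD(2)[OF D]]) (auto simp: norm_mult c)
    then show "(\<lambda>z. g (c * z) / c) holomorphic_on ball 0 1"
      using c0 by (auto simp: o_def intro!: holomorphic_intros)
    obtain r where r: "r > 0" "deriv f 0 = of_real r" using disc_mapD(8)[OF D] by blast
    have "(f has_field_derivative deriv f 0) (at (c * 0))"
      using holomorphic_derivI[OF disc_mapD(1)[OF D] W] by simp
    then have "((\<lambda>z. f (c * z)) has_field_derivative deriv f 0 * c) (at 0)"
      by (rule DERIV_chain2) (auto intro!: derivative_eq_intros)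
    then have "((\<lambda>z. f (c * z) / c) has_field_derivative deriv f 0 * c / c) (at 0)"
      by (rule DERIV_cdivide)
    then have "deriv (\<lambda>z. f (c * z) / c) 0 = of_real r" using r c0 by (simp add: DERIV_imp_deriv)
    then show "\<exists>r>0. deriv (\<lambda>z. f (c * z) / c) 0 = complex_of_real r" using r by blast
  qed (use disc_mapD[OF D] sym sym' c c0 in \<open>auto simp: norm_mult norm_divide\<close>)
  from disc_map_unique[OF D D' W w] c0 show ?thesis by (simp add: field_simps)
qed

lemma disc_map_nonzero:
  assumes D: "disc_map W f g" and W: "open W" "0 \<in> W" and w: "cmod w < 1" "w \<noteq> 0"
  shows "g w \<noteq> 0"
  using disc_mapD(6)[OF D w(1)] disc_mapD(7)[OF D] w by auto

lemma disc_map_factor: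
  assumes D: "disc_map W f g" and W: "open W" "0 \<in> W"
  obtains h where "h holomorphic_on ball 0 1" "\<And>w. g w = w * h w" "\<And>w. cmod w < 1 \<Longrightarrow> h w \<noteq> 0"
    "\<exists>r>0. h 0 = of_real r"
proof -
  note dd = disc_map_deriv[OF D W]
  obtain h where h: "h holomorphic_on ball 0 1" "\<And>w. g w = w * h w" "h 0 = deriv g 0"
    using holomorphic_factor_0[OF disc_mapD(2)[OF D] open_ball dd(1)] by metis
  show ?thesis
  proof (rule that[OF h(1,2)])
    show "\<exists>r>0. h 0 = of_real r" using dd(3) h(3) by simp
    show "h w \<noteq> 0" if "cmod w < 1" for w
    proof (cases "w = 0")
      case True then show ?thesis using h(3) dd(3) by auto
    next
      case False then show ?thesis using disc_map_nonzero[OF D W that] h(2)[of w] by auto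
    qed
  qed
qed

text \<open>The map \<open>z \<mapsto> 1 - z ^ d\<close> in the coordinate \<open>\<zeta> = 1 / z\<close> is \<open>\<zeta> ^ d / (\<zeta> ^ d - 1)\<close>, and
  \<open>x \<mapsto> x / (x - 1)\<close> is an involution. Lifting \<open>g' (- w ^ d)\<close> through it gives a
  self-map of the disc which the Schwarz lemma, applied to both semiconjugacies, forces to be
  a rotation.\<close>

lemma disc_map_semiconj:
  assumes D: "disc_map W f g" "disc_map W' f' g'" and W: "open W" "0 \<in> W" and W': "open W'" "0 \<in> W'"
    and d: "0 < d" and one: "1 \<notin> W'"
    and rel: "\<And>z. z ^ d \<noteq> 1 \<Longrightarrow> z \<in> W \<longleftrightarrow> z ^ d / (z ^ d - 1) \<in> W'"
    and unity: "\<And>z. z ^ d = 1 \<Longrightarrow> z \<notin> W"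
    and w: "cmod w < 1"
  shows "g w ^ d / (g w ^ d - 1) = g' (- (w ^ d))"
proof -
  define N where "N z = z ^ d / (z ^ d - 1)" for z :: complex
  obtain h where h: "h holomorphic_on ball 0 1" "\<And>w. g w = w * h w" "\<And>w. cmod w < 1 \<Longrightarrow> h w \<noteq> 0"
    "\<exists>r>0. h 0 = of_real r"
    using disc_map_factor[OF D(1) W] by metis
  obtain h' where h': "h' holomorphic_on ball 0 1" "\<And>w. g' w = w * h' w" "\<And>w. cmod w < 1 \<Longrightarrow> h' w \<noteq> 0"
    "\<exists>r>0. h' 0 = of_real r"
    using disc_map_factor[OF D(2) W'] by metis
  obtain k where k: "k holomorphic_on W'" "\<And>w. f' w = w * k w"
    using holomorphic_factor_0[OF disc_mapD(1)[OF D(2)] W'(1) disc_mapD(7)[OF D(2)]] by metis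
  note holg = disc_mapD(2)[OF D(1)] and holg' = disc_mapD(2)[OF D(2)]
  have pw: "cmod (- (w ^ d)) < 1" if "cmod w < 1" for w
    using that d by (simp add: norm_power power_less_one_iff)
  have gd: "g w ^ d \<noteq> 1" if "cmod w < 1" for w using unity disc_mapD(5)[OF D(1) that] by blast
  have NW: "N (g w) \<in> W'" if "cmod w < 1" for w
    using rel[OF gd[OF that]] disc_mapD(5)[OF D(1) that] by (simp add: N_def)
  have B: "cmod (f' (N (g w))) \<le> cmod w ^ d" if "cmod w < 1" for w
  proof -
    \<comment> \<open>The composite \<open>f' (N (g w))\<close> vanishes at 0 to order at least
      \<open>d\<close>; \<open>j\<close> is its quotient by \<open>w ^ d\<close>, to which
      \<open>Schwarz_order\<close> applies.\<close>
    define j where "j = (\<lambda>w. h w ^ d / (g w ^ d - 1) * k (N (g w)))"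
    have holN: "(\<lambda>w. N (g w)) holomorphic_on ball 0 1"
      unfolding N_def using gd by (intro holomorphic_intros holg) auto
    have "k \<circ> (\<lambda>w. N (g w)) holomorphic_on ball 0 1"
      using NW by (intro holomorphic_on_compose holN holomorphic_on_subset[OF k(1)]) auto
    then have jh: "j holomorphic_on ball 0 1"
      unfolding j_def o_def using gd by (intro holomorphic_intros h(1) holg) auto
    have eq: "f' (N (g w)) = w ^ d * j w" for w
      by (simp add: k(2) j_def N_def h(2) power_mult_distrib)
    have "cmod (w ^ d * j w) \<le> 1" if "cmod w < 1" for w
      using disc_mapD(3)[OF D(2) NW[OF that]] eq[of w] by simp
    from Schwarz_order[OF jh this that] have "cmod (j w) \<le> 1" by simp
    then show ?thesis unfolding eq by (simp add: norm_mult norm_power mult_left_le)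
  qed
  \<comment> \<open>The lift should be a \<open>d\<close>-th root of \<open>w ^ d * u w\<close>. As
    \<open>u\<close> has no zero on the disc, it has a holomorphic logarithm, and the root can be
    taken.\<close>
  define u where "u = (\<lambda>w. - h' (- (w ^ d)) / (g' (- (w ^ d)) - 1))"
  have g1: "g' w \<noteq> 1" if "cmod w < 1" for w using one disc_mapD(5)[OF D(2) that] by auto
  have hol: "(\<lambda>w. F (- (w ^ d))) holomorphic_on ball 0 1" if "F holomorphic_on ball 0 1" for F
  proof -
    have "F \<circ> (\<lambda>w. - (w ^ d)) holomorphic_on ball 0 1"
      using pw by (intro holomorphic_on_compose holomorphic_intros holomorphic_on_subset[OF that]) auto
    then show ?thesis by (simp add: o_def)
  qed
  have uh: "u holomorphic_on ball 0 1" unfolding u_def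
    using g1 pw by (intro holomorphic_intros hol h'(1) holg') auto
  have unz: "u w \<noteq> 0" if "w \<in> ball 0 1" for w
    using that h'(3)[OF pw] g1[OF pw] by (simp add: u_def)
  obtain l where l: "l holomorphic_on ball 0 1" "\<And>w. w \<in> ball 0 1 \<Longrightarrow> u w = exp (l w)"
    using contractible_imp_holomorphic_log[OF uh convex_imp_contractible[OF convex_ball] unz] by metis
  define e where "e = (\<lambda>w. w * exp (l w / of_nat d))"
  have ed: "e w ^ d = g' (- (w ^ d)) / (g' (- (w ^ d)) - 1)" if "cmod w < 1" for w
  proof -
    have "e w ^ d = w ^ d * u w" using that l(2)[of w] d
      by (simp add: e_def power_mult_distrib exp_of_nat_mult[symmetric])
    then show ?thesis by (simp add: u_def h'(2))
  qed
  have ed1: "e w ^ d \<noteq> 1" if "cmod w < 1" for w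
    using ed[OF that] g1[OF pw[OF that]] by (auto simp: divide_eq_1_iff)
  have Ne: "N (e w) = g' (- (w ^ d))" if "cmod w < 1" for w
    using g1[OF pw[OF that]] unfolding N_def ed[OF that] by (simp add: field_simps)
  have eW: "e w \<in> W" if "cmod w < 1" for w
    using rel[OF ed1[OF that]] Ne[OF that] disc_mapD(5)[OF D(2) pw[OF that]] by (simp add: N_def)
  have Eh: "f \<circ> e holomorphic_on ball 0 1"
  proof (intro holomorphic_on_compose holomorphic_on_subset[OF disc_mapD(1)[OF D(1)]])
    show "e holomorphic_on ball 0 1" unfolding e_def using d by (intro holomorphic_intros l(1)) auto
  qed (use eW in auto)
  have E0: "(f \<circ> e) 0 = 0" using disc_mapD(7)[OF D(1)] by (simp add: e_def)
  have E1: "cmod ((f \<circ> e) w) < 1" if "cmod w < 1" for w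
    using disc_mapD(3)[OF D(1) eW[OF that]] by simp
  \<comment> \<open>Inserting the lift into the bound \<open>B\<close> gives the inequality opposite
    to Schwarz for the self-map \<open>f \<circ> e\<close>, which is therefore a rotation.\<close>
  have Ege: "cmod w \<le> cmod ((f \<circ> e) w)" if "cmod w < 1" for w
  proof -
    have "g ((f \<circ> e) w) = e w" using disc_mapD(4)[OF D(1) eW[OF that]] by simp
    then have "f' (N (g ((f \<circ> e) w))) = - (w ^ d)"
      using Ne[OF that] disc_mapD(6)[OF D(2) pw[OF that]] by simp
    with B[OF E1[OF that]] have "cmod w ^ d \<le> cmod ((f \<circ> e) w) ^ d" by (simp add: norm_power)
    then show ?thesis using d by (simp add: power_mono_iff)
  qed
  have "cmod ((f \<circ> e) (1/2)) = cmod (1/2)"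
    using Ege[of "1/2"] Schwarz_Lemma(1)[OF Eh E0 E1, of "1/2"] by simp
  then have "\<exists>z. cmod z < 1 \<and> z \<noteq> 0 \<and> cmod ((f \<circ> e) z) = cmod z"
    by (intro exI[of _ "1/2"]) simp
  then obtain \<alpha> where al: "\<And>w. cmod w < 1 \<Longrightarrow> (f \<circ> e) w = \<alpha> * w" "cmod \<alpha> = 1"
    using Schwarz_Lemma(3)[OF Eh E0 E1, of 0] by auto
  define c where "c = 1 / \<alpha> ^ d"
  have a0: "\<alpha> \<noteq> 0" using al(2) by auto
  have c: "cmod c = 1" using al(2) by (simp add: c_def norm_divide norm_power)
  have semi: "N (g w) = g' (- (c * w ^ d))" if "cmod w < 1" for w
  proof -
    have w': "cmod (w / \<alpha>) < 1" using that al(2) by (simp add: norm_divide)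
    have "g w = e (w / \<alpha>)"
      using disc_mapD(4)[OF D(1) eW[OF w']] al(1)[OF w'] a0 by simp
    then show ?thesis using Ne[OF w'] by (simp add: c_def power_divide)
  qed
  have "c = 1"
  proof -
    \<comment> \<open>Both sides are divided by \<open>w ^ d\<close> and compared at 0: near 0 the
      map \<open>N\<close> looks like \<open>- z ^ d\<close>, so \<open>r ^ d = c * s\<close> with
      \<open>r, s\<close> positive. A positive unimodular number is 1, and the minus sign is
      absorbed by the argument \<open>- (w ^ d)\<close>.\<close>
    define p q where "p = (\<lambda>w. h w ^ d / (g w ^ d - 1))" and "q = (\<lambda>w. - c * h' (- (c * w ^ d)))"
    have "continuous_on (ball 0 1) p" unfolding p_def
      using gd by (intro continuous_intros holomorphic_on_imp_continuous_on h(1) holg) auto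
    then have cp: "p \<midarrow>0\<rightarrow> p 0" by (simp add: continuous_on_eq_continuous_at isCont_def)
    have "continuous_on (ball 0 1) q" unfolding q_def
      using c d by (intro continuous_intros continuous_on_compose2[OF holomorphic_on_imp_continuous_on[OF h'(1)]])
        (auto simp: norm_mult norm_power power_less_one_iff)
    then have cq: "q \<midarrow>0\<rightarrow> q 0" by (simp add: continuous_on_eq_continuous_at isCont_def)
    have "eventually (\<lambda>w. p w = q w) (at 0)"
      unfolding eventually_at
    proof (intro exI[of _ 1] conjI ballI impI)
      fix w :: complex assume w: "w \<noteq> 0 \<and> dist w 0 < 1"
      then have "w ^ d * p w = w ^ d * q w" using semi[of w]
        by (simp add: p_def q_def N_def h(2) h'(2) power_mult_distrib)
      then show "p w = q w" using w by simp
    qed auto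
    then have "p \<midarrow>0\<rightarrow> q 0" using cq by (simp add: tendsto_cong)
    then have "p 0 = q 0" using cp tendsto_unique by (metis trivial_limit_at)
    moreover obtain r s where rs: "r > 0" "h 0 = of_real r" "s > 0" "h' 0 = of_real s" using h(4) h'(4) by blast
    ultimately have "of_real r ^ d = c * of_real s"
      using d by (simp add: p_def q_def h(2) power_0_left)
    then have "c = of_real (r ^ d / s)" using rs by (simp add: field_simps)
    moreover have "r ^ d / s > 0" using rs by simp
    ultimately show "c = 1" using c by (metis norm_of_real abs_of_pos of_real_1)
  qed
  then show ?thesis using semi[OF w] by (simp add: N_def)
qed

section \<open>Hyperbolicity and the exterior parametrisation\<close>

lemma \<sigma>_upper: "cmod z \<le> R \<Longrightarrow> \<sigma> z \<le> R ^ 2 * (1 + R) ^ 3"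
  unfolding \<sigma>_def using norm_one_minus_bounds(3)[of z]
  by (intro mult_mono power_mono) (auto intro: order_trans)

text \<open>By conjugation symmetry and injectivity, \<open>g\<close> takes real values only at real
  points, so \<open>Im g\<close> has constant sign on the upper half disc. A point of the imaginary
  axis close to 0 decides the sign, because the derivative at 0 is positive.\<close>

lemma disc_map_Im_pos:
  assumes D: "disc_map W f g" and W: "open W" "0 \<in> W" and sym: "\<And>z. z \<in> W \<Longrightarrow> cnj z \<in> W"
    and w: "cmod w < 1" "Im w > 0"
  shows "Im (g w) > 0"
proof -
  define U where "U = ball 0 1 \<inter> {w::complex. Im w > 0}"
  have con: "connected U" unfolding U_def
    by (intro convex_connected convex_Int convex_ball convex_halfspace_Im_gt)
  have nz: "Im (g w) \<noteq> 0" if "w \<in> U" for w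
  proof
    assume 0: "Im (g w) = 0"
    have "g (cnj w) = cnj (g w)" using disc_map_cnj[OF D W sym] that by (auto simp: U_def)
    also have "\<dots> = g w" using 0 by (simp add: complex_eq_iff)
    finally have "cnj w = w" using disc_mapD(6)[OF D] that by (metis U_def IntD1 complex_mod_cnj mem_ball_0)
    then show False using that by (auto simp: U_def complex_eq_iff)
  qed
  obtain h r where h: "h holomorphic_on ball 0 1" "\<And>w. g w = w * h w" "r > 0" "h 0 = of_real r"
    using disc_map_factor[OF D W] by metis
  have "continuous (at 0) h"
    using holomorphic_on_imp_continuous_on[OF h(1)] by (simp add: continuous_on_eq_continuous_at)
  then obtain \<delta> where de: "\<delta> > 0" "\<And>w. cmod w < \<delta> \<Longrightarrow> cmod (h w - h 0) < r"
    using h(3) unfolding continuous_at_eps_delta by (auto simp: dist_norm)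
  define t where "t = min \<delta> 1 / 2"
  have t: "0 < t" "t < \<delta>" "t < 1" using de(1) by (auto simp: t_def)
  let ?a = "\<i> * of_real t"
  have "\<bar>Re (h ?a - h 0)\<bar> < r"
    using de(2)[of ?a] t abs_Re_le_cmod[of "h ?a - h 0"] by (auto simp: norm_mult)
  then have "Re (h ?a) > 0" using h(4) by auto
  then have pos: "Im (g ?a) > 0" using t by (simp add: h(2))
  have a: "?a \<in> U" using t by (auto simp: U_def norm_mult)
  have wU: "w \<in> U" using w by (auto simp: U_def)
  have "continuous_on U (\<lambda>w. Im (g w))"
    by (intro continuous_intros continuous_on_subset[OF holomorphic_on_imp_continuous_on[OF disc_mapD(2)[OF D]]]) (auto simp: U_def)
  then have "connected ((\<lambda>w. Im (g w)) ` U)" using con by (rule connected_continuous_image)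
  then show ?thesis
    using connectedD_interval[of "(\<lambda>w. Im (g w)) ` U" "Im (g w)" "Im (g ?a)" 0] wU a pos nz
    by (metis imageE imageI less_imp_le linorder_not_less)
qed

text \<open>The quotient \<open>g w / w\<close>, extended to 0, is real and free of zeros on the
  real diameter and positive at 0, hence positive throughout.\<close>

lemma disc_map_real:
  assumes D: "disc_map W f g" and W: "open W" "0 \<in> W" and sym: "\<And>z. z \<in> W \<Longrightarrow> cnj z \<in> W"
    and t: "\<bar>t\<bar> < 1"
  shows "\<exists>s>0. g (of_real t) = of_real (t * s)"
proof -
  obtain h r where h: "h holomorphic_on ball 0 1" "\<And>w. g w = w * h w" "\<And>w. cmod w < 1 \<Longrightarrow> h w \<noteq> 0"
    "r > 0" "h 0 = of_real r"
    using disc_map_factor[OF D W] by metis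
  have re: "Im (h (of_real x)) = 0" if "\<bar>x\<bar> < 1" for x
  proof (cases "x = 0")
    case False
    have "g (cnj (of_real x)) = cnj (g (of_real x))"
      using that by (intro disc_map_cnj[OF D W sym]) auto
    then have "cnj (g (of_real x)) = g (of_real x)" by simp
    then have "Im (g (of_real x)) = 0" by (simp add: complex_eq_iff)
    then show ?thesis using False by (simp add: h(2))
  qed (use h in simp)
  have "continuous_on {-1<..<1} (\<lambda>x::real. Re (h (of_real x)))"
    by (intro continuous_intros continuous_on_compose2[OF holomorphic_on_imp_continuous_on[OF h(1)]]) auto
  then have con: "connected ((\<lambda>x::real. Re (h (of_real x))) ` {-1<..<1})"
    by (rule connected_continuous_image) simp
  have nz: "Re (h (of_real x)) \<noteq> 0" if "\<bar>x\<bar> < 1" for x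
    using re[OF that] h(3)[of "of_real x"] that by (auto simp: complex_eq_iff)
  have "Re (h (of_real t)) > 0"
  proof (rule ccontr)
    assume "\<not> Re (h (of_real t)) > 0"
    moreover have tt: "t \<in> {-1<..<1}" using t by (simp add: abs_less_iff)
    have "Re (h (of_real t)) \<in> (\<lambda>x::real. Re (h (of_real x))) ` {-1<..<1}"
      using tt by (rule imageI)
    moreover have "Re (h (of_real 0)) \<in> (\<lambda>x::real. Re (h (of_real x))) ` {-1<..<1}"
      by (rule imageI) simp
    ultimately have "0 \<in> (\<lambda>x::real. Re (h (of_real x))) ` {-1<..<1}"
      using connectedD_interval[OF con, of "Re (h (of_real t))" "Re (h (of_real 0))" 0] h(4,5) by simp
    then show False using nz by auto
  qed
  moreover have "g (of_real t) = of_real (t * Re (h (of_real t)))"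
    using re[OF t] by (simp add: h(2) complex_eq_iff)
  ultimately show ?thesis by blast
qed

text \<open>In a separation of \<open>S - {a}\<close> the punctured ball, being connected, lies on
  one side; adding \<open>a\<close> to that side would separate \<open>S\<close>. This serves to
  remove 0 from \<open>K m\<close> before inverting.\<close>

lemma connected_Diff_interior_point:
  fixes S :: "complex set"
  assumes S: "connected S" and r: "ball a r \<subseteq> S" "r > 0"
  shows "connected (S - {a})"
proof (rule ccontr)
  assume "\<not> connected (S - {a})"
  then obtain A B where AB: "openin (top_of_set (S - {a})) A" "openin (top_of_set (S - {a})) B"
      "S - {a} \<subseteq> A \<union> B" "A \<inter> B = {}" "A \<noteq> {}" "B \<noteq> {}"
    unfolding connected_openin by blast
  have opS: "openin (top_of_set S) (S - {a})" by (simp add: openin_delete)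
  have o: "openin (top_of_set S) A" "openin (top_of_set S) B"
    using AB(1,2) opS openin_trans by blast+
  have ball: "openin (top_of_set S) (ball a r)" using r by (intro open_subset) auto
  have con: "connected (ball a r - {a})"
    using connected_open_delete[of "ball a r" a] by auto
  have sub: "A \<subseteq> S - {a}" "B \<subseteq> S - {a}" using AB openin_imp_subset by blast+
  have main: False if AB: "openin (top_of_set S) A" "openin (top_of_set S) B" "S - {a} \<subseteq> A \<union> B" "A \<inter> B = {}"
    "B \<noteq> {}" "A \<subseteq> S - {a}" "B \<subseteq> S - {a}" "ball a r - {a} \<subseteq> A" for A B
  proof -
    have "openin (top_of_set S) (A \<union> ball a r)" using AB(1) ball by (rule openin_Un)
    moreover have a: "a \<in> A \<union> ball a r" using r by simp
    then have "S \<subseteq> (A \<union> ball a r) \<union> B" using AB(3) by blast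
    moreover have "(A \<union> ball a r) \<inter> B = {}" using AB(4,7,8) by blast
    moreover have "A \<union> ball a r \<noteq> {}" using a by blast
    ultimately show False using S AB(2,5) unfolding connected_openin by metis
  qed
  have disj: "(ball a r - {a}) \<inter> A = {} \<or> (ball a r - {a}) \<inter> B = {}"
  proof (rule ccontr)
    assume n: "\<not> ?thesis"
    have s: "ball a r - {a} \<subseteq> S - {a}" using r by blast
    have op: "openin (top_of_set (ball a r - {a})) ((ball a r - {a}) \<inter> X)"
      if X: "openin (top_of_set (S - {a})) X" for X
    proof -
      obtain T where "open T" "X = (S - {a}) \<inter> T" using X by (auto simp: openin_open)
      moreover from this have "(ball a r - {a}) \<inter> X = (ball a r - {a}) \<inter> T" using s by auto
      ultimately show ?thesis by (auto simp: openin_open)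
    qed
    have "ball a r - {a} \<subseteq> (ball a r - {a}) \<inter> A \<union> (ball a r - {a}) \<inter> B" using s AB(3) by blast
    moreover have "((ball a r - {a}) \<inter> A) \<inter> ((ball a r - {a}) \<inter> B) = {}" using AB(4) by blast
    ultimately show False
      using con n op[OF AB(1)] op[OF AB(2)] unfolding connected_openin by metis
  qed
  have cover: "ball a r - {a} \<subseteq> A \<union> B" using r(1) AB(3) by blast
  from disj show False
  proof
    assume "(ball a r - {a}) \<inter> A = {}"
    then have "ball a r - {a} \<subseteq> B" using cover by blast
    then show False using main[OF o(2,1)] AB(3-5) sub by (simp add: Un_commute Int_commute)
  next
    assume "(ball a r - {a}) \<inter> B = {}"
    then have "ball a r - {a} \<subseteq> A" using cover by blast
    then show False using main[OF o] AB(3,4,6) sub by simp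
  qed
qed

section \<open>Metric expansion on the closure of the basin, hyperbolicity, and the inverted
  basin\<close>

context mixed_seq
begin

definition avoids :: "nat \<Rightarrow> complex \<Rightarrow> bool" where
  "avoids m z \<longleftrightarrow> 3/10 \<le> cmod z \<and> trap1 (d (Suc m)) \<le> cmod (1 - z)"

text \<open>The closure of the basin contains both the basin and the Julia set, so one statement
  serves the rays as well as hyperbolicity.\<close>

lemma avoids_closure: assumes "z \<in> closure (- K m)" shows "avoids m z"
proof -
  have z: "z \<notin> interior (K m)" using assms by (simp add: closure_complement)
  have "ball 0 (3/10) \<subseteq> K m" "ball 1 (trap1 (d (Suc m))) \<subseteq> K m"
    using trap0_in_K trap1_in_K by (auto simp: dist_norm)
  then have "ball 0 (3/10) \<subseteq> interior (K m)" "ball 1 (trap1 (d (Suc m))) \<subseteq> interior (K m)"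
    by (simp_all add: interior_maximal)
  with z show ?thesis by (force simp: avoids_def dist_norm not_less)
qed

lemma \<sigma>_avoids:
  assumes "avoids m z" shows "(3/10)^2 * (8/100)^3 \<le> \<sigma> z"
  unfolding \<sigma>_def using assms trap1_bounds[of "d (Suc m)"]
  by (intro mult_mono power_mono) (auto simp: avoids_def)

lemma it_field_differentiable: "it m k field_differentiable at z"
  using it_holomorphic[of m k UNIV] holomorphic_on_imp_differentiable_at by blast

lemma deriv_it_Suc:
  "deriv (it m (Suc k)) z =
     - (of_nat (d (Suc (m + k))) * it m k z ^ (d (Suc (m + k)) - 1)) * deriv (it m k) z"
proof -
  have "it m (Suc k) = fmap (d (Suc (m + k))) \<circ> it m k" by (auto simp: it_Suc)
  moreover have "deriv (fmap e) u = - (of_nat e * u ^ (e - 1))" for e u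
    by (intro DERIV_imp_deriv fmap_has_field_derivative)
  moreover have "fmap e field_differentiable at u" for e u
    using fmap_has_field_derivative field_differentiable_def by blast
  ultimately show ?thesis
    using it_field_differentiable[of m k z] by (simp add: deriv_chain)
qed

lemma expansion:
  assumes "\<And>j. j < k \<Longrightarrow> avoids (m + j) (it m j z)"
  shows "(11/10) ^ k * \<sigma> (it m k z) \<le> cmod (deriv (it m k) z) ^ 5 * \<sigma> z"
  using assms
proof (induction k)
  case 0
  have "it m 0 = (\<lambda>z. z)" by auto
  then show ?case by simp
next
  case (Suc k)
  let ?D = "d (Suc (m + k))" and ?z = "it m k z"
  have a: "avoids (m + k) ?z" using Suc.prems by simp
  have "(11/10) ^ Suc k * \<sigma> (it m (Suc k) z) = (11/10) ^ k * (11/10 * \<sigma> (fmap ?D ?z))"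
    by (simp add: it_Suc)
  also have "\<dots> \<le> (11/10) ^ k * (cmod (of_nat ?D * ?z ^ (?D - 1)) ^ 5 * \<sigma> ?z)"
    using a deg by (intro mult_left_mono \<sigma>_expand) (auto simp: avoids_def)
  also have "\<dots> = cmod (of_nat ?D * ?z ^ (?D - 1)) ^ 5 * ((11/10) ^ k * \<sigma> ?z)" by simp
  also have "\<dots> \<le> cmod (of_nat ?D * ?z ^ (?D - 1)) ^ 5 * (cmod (deriv (it m k) z) ^ 5 * \<sigma> z)"
    using Suc by (intro mult_left_mono) auto
  also have "\<dots> = cmod (deriv (it m (Suc k)) z) ^ 5 * \<sigma> z"
    by (simp add: deriv_it_Suc norm_mult power_mult_distrib)
  finally show ?case .
qed

lemma it_closure_basin:
  assumes "z \<in> closure (- K m)" shows "it m k z \<in> closure (- K (m + k))"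
proof -
  have "it m k ` closure (- K m) \<subseteq> closure (- K (m + k))"
  proof (rule image_closure_subset)
    show "it m k ` (- K m) \<subseteq> closure (- K (m + k))"
      using it_in_K_iff closure_subset[of "- K (m + k)"] by auto
  qed (use continuous_on_it in auto)
  then show ?thesis using assms by blast
qed

lemma expansion_closure:
  assumes "z \<in> closure (- K m)"
  shows "(11/10) ^ k * \<sigma> (it m k z) \<le> cmod (deriv (it m k) z) ^ 5 * \<sigma> z"
  using it_closure_basin[OF assms] avoids_closure by (intro expansion) auto

lemma julia_P: "julia P m = K m \<inter> closure (- K m)"
  using compact_imp_closed[OF compact_K]
  by (simp add: julia_def filled_julia_P frontier_closures)

text \<open>On the Julia set \<open>\<sigma>\<close> lies between two positive constants: below by
  avoidance of the traps, above by the radius 2 of \<open>K m\<close>. Expansion for the weighted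
  metric thus becomes Euclidean, with rate the fifth root of 11/10.\<close>

lemma hyperbolic_P: "hyperbolic_seq P"
proof -
  define c :: real where "c = (3/10)^2 * (8/100)^3 / (2^2 * (1+2)^3)"
  define \<mu> where "\<mu> = root 5 (11/10)"
  have c: "c > 0" by (simp add: c_def)
  have main: "root 5 c * \<mu> ^ i \<le> cmod (deriv (it m i) z)" if z: "z \<in> julia P m" for i m z
  proof -
    have zc: "z \<in> closure (- K m)" "z \<in> K m" using z by (auto simp: julia_P)
    have s1: "(3/10)^2 * (8/100)^3 \<le> \<sigma> (it m i z)"
      by (rule \<sigma>_avoids[OF avoids_closure[OF it_closure_basin[OF zc(1)]]])
    have s2: "\<sigma> z \<le> 2^2 * (1+2)^3" using zc(2) K_subset[of m] by (intro \<sigma>_upper) auto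
    have "(11/10)^i * ((3/10)^2 * (8/100)^3) \<le> (11/10) ^ i * \<sigma> (it m i z)"
      using s1 by (intro mult_left_mono) auto
    also have "\<dots> \<le> cmod (deriv (it m i) z) ^ 5 * \<sigma> z" by (rule expansion_closure[OF zc(1)])
    also have "\<dots> \<le> cmod (deriv (it m i) z) ^ 5 * (2^2 * (1+2)^3)" using s2 by (intro mult_left_mono) auto
    finally have "c * (11/10)^i \<le> cmod (deriv (it m i) z) ^ 5" by (simp add: c_def field_simps)
    then have "root 5 (c * (11/10)^i) \<le> cmod (deriv (it m i) z)"
      by (metis norm_ge_zero real_root_le_iff real_root_power_cancel zero_less_numeral)
    then show ?thesis by (simp add: real_root_mult real_root_power \<mu>_def)
  qed
  have "\<mu> > 1" by (simp add: \<mu>_def)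
  then show ?thesis unfolding hyperbolic_seq_def
    using main c by (intro exI[of _ "root 5 c"] conjI exI[of _ \<mu>]) (auto simp: it_def)
qed

text \<open>The basin with its point at infinity in the coordinate \<open>1 / z\<close>; the point \<open>0\<close> is added
  separately since \<open>inverse 0 = 0 \<in> K m\<close>.\<close>

definition W :: "nat \<Rightarrow> complex set" where
  "W m = {\<zeta>. \<zeta> = 0 \<or> inverse \<zeta> \<notin> K m}"

lemma zero_in_W [simp]: "0 \<in> W m" by (simp add: W_def)
lemma one_notin_W [simp]: "1 \<notin> W m" by (simp add: W_def)

lemma W_alt: "W m = insert 0 (inverse ` (- K m))"
proof -
  have "\<zeta> \<in> inverse ` (- K m)" if "inverse \<zeta> \<notin> K m" for \<zeta>
    using that by (intro image_eqI[of _ _ "inverse \<zeta>"]) auto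
  then show ?thesis by (auto simp: W_def)
qed

lemma ball_subset_W: "ball 0 (1/2) \<subseteq> W m"
proof
  fix \<zeta> :: complex assume z: "\<zeta> \<in> ball 0 (1/2)"
  show "\<zeta> \<in> W m"
  proof (cases "\<zeta> = 0")
    case False
    have "cmod \<zeta> > 0" "cmod \<zeta> < 1/2" using z False by auto
    then have "inverse (cmod \<zeta>) > 2" by (simp add: field_simps)
    then have "cmod (inverse \<zeta>) > 2" by (simp only: norm_inverse)
    then show ?thesis using K_subset[of m] by (auto simp: W_def)
  qed simp
qed

lemma W_subset: "\<zeta> \<in> W m \<Longrightarrow> cmod \<zeta> < 10/3"
proof (cases "\<zeta> = 0")
  case False
  assume "\<zeta> \<in> W m"
  then have "inverse (cmod \<zeta>) > 3/10"
    using trap0_in_K False by (auto simp: W_def not_le[symmetric] simp flip: norm_inverse)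
  moreover have "cmod \<zeta> > 0" using False by simp
  ultimately show ?thesis by (simp add: field_simps)
qed simp

lemma open_W: "open (W m)"
proof -
  have "open (- {0} \<inter> inverse -` (- K m))"
    using compact_imp_closed[OF compact_K]
    by (intro continuous_open_preimage continuous_intros) auto
  moreover have "W m = ball 0 (1/2) \<union> (- {0} \<inter> inverse -` (- K m))"
    using ball_subset_W[of m] by (auto simp: W_def)
  ultimately show ?thesis by auto
qed

text \<open>A bounded open plane set is simply connected as soon as it and its complement are
  connected. Boundedness comes from the trap about 0, and the complement is the inversion of
  \<open>K m - {0}\<close>.\<close>

lemma simply_connected_W: "simply_connected (W m)"
proof -
  have bd: "bounded (W m)" using W_subset by (intro boundedI[of _ "10/3"]) (auto intro: less_imp_le)
  have "connected (inverse ` (- K m))"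
    by (intro connected_continuous_image continuous_intros connected_basin) auto
  moreover have "0 \<in> closure (inverse ` (- K m))"
    unfolding closure_approachable
  proof (intro allI impI)
    fix e :: real assume e: "e > 0"
    define x where "x = max 3 (2 / e)"
    have "2 / e > 1 / e" using e by (intro divide_strict_right_mono) auto
    then have "x > 0" "x > 1 / e" by (simp_all only: x_def less_max_iff_disj) auto
    then have "x > 0" "inverse x < e" using e by (simp_all add: field_simps)
    moreover have "complex_of_real x \<notin> K m" using K_subset[of m] by (auto simp: x_def)
    ultimately show "\<exists>y\<in>inverse ` (- K m). dist y 0 < e"
    proof (intro bexI[of _ "inverse (of_real x)"] imageI)
      have "cmod (inverse (of_real x)) = inverse x" using \<open>x > 0\<close> by (simp only: norm_inverse norm_of_real abs_of_pos)
      then show "dist (inverse (complex_of_real x)) 0 < e" using \<open>inverse x < e\<close> by (simp only: dist_0_norm dist_norm diff_zero)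
    qed simp
  qed
  ultimately have "connected (W m)"
    unfolding W_alt
    by (rule connected_intermediate_closure[OF _ subset_insertI insert_subsetI[OF _ closure_subset]])
  moreover have "- W m = inverse ` (K m - {0})"
  proof -
    have "\<zeta> \<in> inverse ` (K m - {0})" if "inverse \<zeta> \<in> K m" "\<zeta> \<noteq> 0" for \<zeta>
      using that by (intro image_eqI[of _ _ "inverse \<zeta>"]) auto
    then show ?thesis by (auto simp: W_def)
  qed
  moreover have "connected (K m - {0})"
    using trap0_in_K by (intro connected_Diff_interior_point[of _ _ "3/10"] connected_K) auto
  then have "connected (inverse ` (K m - {0}))"
    by (intro connected_continuous_image continuous_intros) auto
  ultimately show ?thesis using simply_connected_iff_simple[OF open_W bd] by simp
qed

section \<open>Riemann maps of the basins, their functional equation and symmetries\<close>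

definition FG :: "nat \<Rightarrow> (complex \<Rightarrow> complex) \<times> (complex \<Rightarrow> complex)" where
  "FG m = (SOME fg. disc_map (W m) (fst fg) (snd fg))"

definition F :: "nat \<Rightarrow> complex \<Rightarrow> complex" where "F m = fst (FG m)"
definition G :: "nat \<Rightarrow> complex \<Rightarrow> complex" where "G m = snd (FG m)"

lemma disc_map_W: "disc_map (W m) (F m) (G m)"
proof -
  have "\<exists>f g. disc_map (W m) f g"
  proof (rule disc_map_exists[OF open_W simply_connected_W zero_in_W])
    show "W m \<noteq> UNIV"
    proof
      assume "W m = UNIV"
      then have "1 \<in> W m" by (simp only: UNIV_I)
      then show False using one_notin_W by blast
    qed
  qed
  then have "\<exists>fg. disc_map (W m) (fst fg) (snd fg)" by simp
  then show ?thesis unfolding F_def G_def FG_def by (rule someI_ex)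
qed

lemma W_rel:
  assumes z: "\<zeta> ^ d (Suc m) \<noteq> 1"
  shows "\<zeta> \<in> W m \<longleftrightarrow> \<zeta> ^ d (Suc m) / (\<zeta> ^ d (Suc m) - 1) \<in> W (Suc m)"
proof (cases "\<zeta> = 0")
  case False
  have "inverse (\<zeta> ^ d (Suc m) / (\<zeta> ^ d (Suc m) - 1)) = fmap (d (Suc m)) (inverse \<zeta>)"
    using False by (simp add: fmap_def field_simps)
  then show ?thesis using False z fmap_in_K_iff[of m "inverse \<zeta>"] by (simp add: W_def)
qed (use deg_ne in \<open>simp add: power_0_left\<close>)

lemma W_unity: "\<zeta> ^ d (Suc m) = 1 \<Longrightarrow> \<zeta> \<notin> W m"
  using fmap_in_K_iff[of m "inverse \<zeta>"] deg_ne[of "Suc m"]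
  by (auto simp: W_def fmap_def power_inverse power_0_left)

lemma G_semiconj:
  assumes "cmod w < 1"
  shows "G m w ^ d (Suc m) / (G m w ^ d (Suc m) - 1) = G (Suc m) (- (w ^ d (Suc m)))"
  using disc_map_semiconj[OF disc_map_W disc_map_W open_W zero_in_W open_W zero_in_W deg_pos one_notin_W W_rel W_unity assms] .

lemma it_cnj: "it m k (cnj z) = cnj (it m k z)"
  by (induction k) (simp_all add: it_Suc fmap_def)

lemma cnj_in_K_iff: "cnj z \<in> K m \<longleftrightarrow> z \<in> K m"
  by (simp add: K_def it_cnj)

lemma cnj_in_W: "z \<in> W m \<Longrightarrow> cnj z \<in> W m"
  using cnj_in_K_iff[of "inverse z" m] by (simp add: W_def complex_cnj_inverse)

lemma rotate_in_W:
  assumes "c ^ d (Suc m) = 1" shows "c * z \<in> W m \<longleftrightarrow> z \<in> W m"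
proof -
  have c0: "c \<noteq> 0" using assms deg_ne[of "Suc m"] by (auto simp: power_0_left)
  have "fmap (d (Suc m)) (inverse (c * z)) = fmap (d (Suc m)) (inverse z)"
    using assms by (simp add: fmap_def power_mult_distrib power_inverse)
  then show ?thesis using fmap_in_K_iff[of m "inverse (c * z)"] fmap_in_K_iff[of m "inverse z"] c0
    by (simp add: W_def)
qed

text \<open>Schwarz lemma in both directions, from the inclusions of \<open>W m\<close> between the
  discs of radii 1/2 and 10/3. The bounds are uniform in \<open>m\<close>.\<close>

lemma G_bounds:
  assumes w: "cmod w < 1" shows "cmod w / 2 \<le> cmod (G m w)" "cmod (G m w) \<le> 10/3 * cmod w"
proof -
  note D = disc_map_W[of m]
  have "cmod w \<le> 2 * cmod (G m w)"
  proof (cases "cmod (G m w) < 1/2")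
    case True
    have h: "(F m \<circ> (\<lambda>z. z / 2)) holomorphic_on ball 0 1"
      by (intro holomorphic_on_compose holomorphic_intros holomorphic_on_subset[OF disc_mapD(1)[OF D]])
         (use ball_subset_W[of m] in \<open>auto simp: norm_divide\<close>)
    have "cmod ((F m \<circ> (\<lambda>z. z / 2)) (2 * G m w)) \<le> cmod (2 * G m w)"
    proof (rule Schwarz_Lemma(1)[OF h])
      show "cmod ((F m \<circ> (\<lambda>z. z / 2)) z) < 1" if "cmod z < 1" for z
      proof -
        have "z / 2 \<in> W m" using that ball_subset_W[of m] by (auto simp: norm_divide)
        then show ?thesis using disc_mapD(3)[OF D] by simp
      qed
    qed (use True disc_mapD(7)[OF D] in \<open>auto simp: norm_mult\<close>)
    then show ?thesis using disc_mapD(6)[OF D w] by (simp add: norm_mult)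
  qed (use w in auto)
  then show "cmod w / 2 \<le> cmod (G m w)" by simp
  have h: "(\<lambda>z. 3/10 * G m z) holomorphic_on ball 0 1"
    by (intro holomorphic_intros disc_mapD(2)[OF D])
  have "cmod (3/10 * G m w) \<le> cmod w"
  proof (rule Schwarz_Lemma(1)[OF h _ _ w])
    show "3/10 * G m 0 = 0" using disc_map_deriv(1)[OF D open_W] by simp
    show "cmod (3/10 * G m z) < 1" if "cmod z < 1" for z
      using W_subset[OF disc_mapD(5)[OF D that]] by (simp add: norm_mult)
  qed
  then show "cmod (G m w) \<le> 10/3 * cmod w" by (simp add: norm_mult)
qed

text \<open>The inverse of the normalised Riemann map of the basin, parametrised by the exterior of
  the unit disc.\<close>

definition \<psi> :: "nat \<Rightarrow> complex \<Rightarrow> complex" where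
  "\<psi> m w = inverse (G m (inverse w))"

lemma norm_inverse_less_1: "cmod w > 1 \<Longrightarrow> cmod (inverse w) < 1"
  by (simp add: norm_inverse inverse_less_1_iff)

lemma G_inverse_nonzero: "cmod w > 1 \<Longrightarrow> G m (inverse w) \<noteq> 0"
  by (rule disc_map_nonzero[OF disc_map_W open_W zero_in_W norm_inverse_less_1]) auto

lemma \<psi>_notin_K: assumes "cmod w > 1" shows "\<psi> m w \<notin> K m"
  using disc_mapD(5)[OF disc_map_W norm_inverse_less_1[OF assms]] G_inverse_nonzero[OF assms]
  by (auto simp: W_def \<psi>_def)

lemma \<psi>_F:
  assumes "z \<notin> K m" shows "cmod (inverse (F m (inverse z))) > 1" "\<psi> m (inverse (F m (inverse z))) = z"
proof -
  have z0: "z \<noteq> 0" using assms by auto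
  have zW: "inverse z \<in> W m" using assms by (simp add: W_def)
  have "F m (inverse z) \<noteq> 0"
    using disc_mapD(4)[OF disc_map_W zW] disc_map_deriv(1)[OF disc_map_W open_W zero_in_W, of m] z0 by auto
  then show "cmod (inverse (F m (inverse z))) > 1"
    using disc_mapD(3)[OF disc_map_W zW] by (simp add: norm_inverse one_less_inverse_iff)
  show "\<psi> m (inverse (F m (inverse z))) = z"
    using disc_mapD(4)[OF disc_map_W zW] by (simp add: \<psi>_def)
qed

lemma F_\<psi>: assumes "cmod w > 1" shows "inverse (F m (inverse (\<psi> m w))) = w"
  using disc_mapD(6)[OF disc_map_W norm_inverse_less_1[OF assms]] by (simp add: \<psi>_def)

lemma \<psi>_bounds:
  assumes "cmod w > 1" shows "3/10 * cmod w \<le> cmod (\<psi> m w)" "cmod (\<psi> m w) \<le> 2 * cmod w"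
proof -
  define a b where "a = cmod w" and "b = cmod (G m (inverse w))"
  have ab: "a > 0" "b > 0" "inverse a / 2 \<le> b" "b \<le> 10/3 * inverse a"
    using G_bounds[OF norm_inverse_less_1[OF assms], of m] G_inverse_nonzero[OF assms, of m] assms
    unfolding a_def b_def norm_inverse by auto
  then have "3/10 * a \<le> inverse b" "inverse b \<le> 2 * a" by (simp_all add: field_simps)
  then show "3/10 * cmod w \<le> cmod (\<psi> m w)" "cmod (\<psi> m w) \<le> 2 * cmod w"
    by (simp_all add: \<psi>_def norm_inverse a_def b_def)
qed

lemma \<psi>_holomorphic: "\<psi> m holomorphic_on - cball 0 1"
proof -
  have "G m \<circ> inverse holomorphic_on - cball 0 1"
    by (intro holomorphic_on_compose holomorphic_intros holomorphic_on_subset[OF disc_mapD(2)[OF disc_map_W]])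
       (auto simp: norm_inverse inverse_less_1_iff)
  then have "(\<lambda>w. G m (inverse w)) holomorphic_on - cball 0 1" by (simp add: o_def)
  then show ?thesis unfolding \<psi>_def
    using G_inverse_nonzero by (intro holomorphic_intros) auto
qed

lemma \<psi>_semiconj:
  assumes "cmod w > 1"
  shows "fmap (d (Suc m)) (\<psi> m w) = \<psi> (Suc m) (- (w ^ d (Suc m)))"
proof -
  let ?x = "G m (inverse w) ^ d (Suc m)"
  have "\<psi> (Suc m) (- (w ^ d (Suc m))) = inverse (G (Suc m) (- (inverse w ^ d (Suc m))))"
    by (simp add: \<psi>_def power_inverse inverse_minus_eq)
  also have "\<dots> = inverse (?x / (?x - 1))"
    using G_semiconj[OF norm_inverse_less_1[OF assms], of m] by simp
  also have "\<dots> = 1 - inverse ?x" using G_inverse_nonzero[OF assms, of m] by (simp add: field_simps)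
  finally show ?thesis by (simp add: fmap_def \<psi>_def power_inverse)
qed

lemma \<psi>_cnj: "cmod w > 1 \<Longrightarrow> \<psi> m (cnj w) = cnj (\<psi> m w)"
  using disc_map_cnj[OF disc_map_W open_W zero_in_W cnj_in_W norm_inverse_less_1]
  by (simp add: \<psi>_def flip: complex_cnj_inverse)

text \<open>Needed with a cube root of unity, to exclude angles above 1/3 for rays landing on the
  real orbit.\<close>

lemma \<psi>_rotate:
  assumes "cmod w > 1" "c ^ d (Suc m) = 1" shows "\<psi> m (c * w) = c * \<psi> m w"
proof -
  have c: "cmod c = 1" using assms(2) deg_pos[of "Suc m"]
    by (metis power_eq_imp_eq_base norm_one norm_power norm_ge_zero power_one zero_le_one)
  have i: "inverse c ^ d (Suc m) = 1" using assms(2) by (simp add: power_inverse)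
  have "G m (inverse c * inverse w) = inverse c * G m (inverse w)"
    using c by (intro disc_map_rotate[OF disc_map_W open_W zero_in_W _ rotate_in_W[OF i] norm_inverse_less_1[OF assms(1)]])
       (simp add: norm_inverse)
  then show ?thesis by (simp add: \<psi>_def)
qed

lemma Im_inverse_pos_iff: "Im (inverse w) > 0 \<longleftrightarrow> Im w < 0"
proof (cases "w = 0")
  case False
  then have "(Re w)\<^sup>2 + (Im w)\<^sup>2 > 0" by (simp add: complex_eq_iff sum_power2_gt_zero_iff)
  then show ?thesis by (auto simp: divide_less_0_iff)
qed simp

lemma \<psi>_Im_neg:
  assumes "cmod w > 1" "Im w < 0" shows "Im (\<psi> m w) < 0"
proof -
  have "Im (G m (inverse w)) > 0"
    using assms Im_inverse_pos_iff
    by (intro disc_map_Im_pos[OF disc_map_W open_W zero_in_W cnj_in_W norm_inverse_less_1]) auto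
  then show ?thesis unfolding \<psi>_def using Im_inverse_pos_iff[of "inverse (G m (inverse w))"] by simp
qed

lemma \<psi>_Im_pos:
  assumes "cmod w > 1" "Im w > 0" shows "Im (\<psi> m w) > 0"
  using \<psi>_Im_neg[of "cnj w" m] \<psi>_cnj[OF assms(1), of m] assms by simp

lemma \<psi>_real:
  assumes "\<bar>t\<bar> > 1" shows "\<exists>s>0. \<psi> m (of_real t) = of_real (t * s)"
proof -
  have "\<bar>inverse t\<bar> < 1" using assms by (simp add: inverse_less_1_iff)
  from disc_map_real[OF disc_map_W open_W zero_in_W cnj_in_W this, of m]
  obtain s where s: "s > 0" "G m (of_real (inverse t)) = of_real (inverse t * s)" by blast
  then have "\<psi> m (of_real t) = of_real (t * inverse s)"
    by (simp add: \<psi>_def flip: of_real_inverse of_real_mult)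
  then show ?thesis using s(1) by (intro exI[of _ "inverse s"]) simp
qed

end

section \<open>Landing of rays\<close>

context mixed_seq
begin

section \<open>Return to a fixed annulus and derivative bounds near the unit circle\<close>

definition degprod :: "nat \<Rightarrow> nat \<Rightarrow> nat" where
  "degprod m k = (\<Prod>j<k. d (Suc (m + j)))"

lemma degprod_0 [simp]: "degprod m 0 = 1" by (simp add: degprod_def)
lemma degprod_Suc: "degprod m (Suc k) = degprod m k * d (Suc (m + k))" by (simp add: degprod_def)

lemma degprod_bounds: "2 ^ k \<le> degprod m k" "degprod m k \<le> 3 ^ k" "0 < degprod m k"
proof -
  show a: "2 ^ k \<le> degprod m k"
  proof (induction k)
    case (Suc k)
    then have "2 ^ k * 2 \<le> degprod m k * d (Suc (m + k))" using deg_ge by (intro mult_mono) auto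
    then show ?case by (simp add: degprod_Suc)
  qed simp
  show "degprod m k \<le> 3 ^ k"
  proof (induction k)
    case (Suc k)
    then have "degprod m k * d (Suc (m + k)) \<le> 3 ^ k * 3" using deg_le by (intro mult_mono) auto
    then show ?case by (simp add: degprod_Suc)
  qed simp
  show "0 < degprod m k" using a by (metis zero_less_power less_le_trans zero_less_numeral)
qed

text \<open>The unimodular factor \<open>e\<close> collects the signs of the successive steps
  \<open>w \<mapsto> - (w ^ d)\<close>; distortion estimates only see moduli.\<close>

lemma it_\<psi>:
  "\<exists>e. cmod e = 1 \<and> (\<forall>w. cmod w > 1 \<longrightarrow> it m k (\<psi> m w) = \<psi> (m + k) (e * w ^ degprod m k))"
proof (induction k)
  case 0
  show ?case by (intro exI[of _ 1]) simp
next
  case (Suc k)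
  then obtain e where e: "cmod e = 1" "\<And>w. cmod w > 1 \<Longrightarrow> it m k (\<psi> m w) = \<psi> (m + k) (e * w ^ degprod m k)"
    by blast
  let ?d = "d (Suc (m + k))"
  have "it m (Suc k) (\<psi> m w) = \<psi> (m + Suc k) (- (e ^ ?d) * w ^ degprod m (Suc k))" if w: "cmod w > 1" for w
  proof -
    have "cmod (e * w ^ degprod m k) > 1"
      using w e(1) degprod_bounds(3)[of m k] by (simp add: norm_mult norm_power one_less_power)
    from \<psi>_semiconj[OF this, of "m + k"] show ?thesis
      using e(2)[OF w] by (simp add: it_Suc degprod_Suc power_mult power_mult_distrib)
  qed
  then show ?case using e(1) by (intro exI[of _ "- (e ^ ?d)"]) (simp add: norm_power)
qed

lemma \<psi>_field_differentiable: "cmod w > 1 \<Longrightarrow> \<psi> m field_differentiable at w"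
  by (rule holomorphic_on_imp_differentiable_at[OF \<psi>_holomorphic]) auto

text \<open>Cauchy's estimate on circles of radius 1/2, where \<open>\<psi> m\<close> is bounded by
  2 * (8 + 1/2) = 17.\<close>

lemma deriv_\<psi>_annulus:
  assumes u: "2 \<le> cmod u" "cmod u \<le> 8" shows "cmod (deriv (\<psi> m) u) \<le> 34"
proof -
  have sub: "cball u (1/2) \<subseteq> - cball 0 1"
  proof
    fix x assume "x \<in> cball u (1/2)"
    then have "cmod (u - x) \<le> 1/2" by (simp add: dist_norm)
    then show "x \<in> - cball 0 1" using u norm_triangle_ineq2[of u x] by auto
  qed
  have "norm ((deriv ^^ 1) (\<psi> m) u) \<le> fact 1 * 17 / (1/2) ^ 1"
  proof (rule Cauchy_inequality)
    show "\<psi> m holomorphic_on ball u (1/2)"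
      by (rule holomorphic_on_subset[OF \<psi>_holomorphic order_trans[OF ball_subset_cball sub]])
    show "continuous_on (cball u (1/2)) (\<psi> m)"
      by (rule continuous_on_subset[OF holomorphic_on_imp_continuous_on[OF \<psi>_holomorphic] sub])
    show "cmod (\<psi> m x) \<le> 17" if x: "cmod (u - x) = 1/2" for x
    proof -
      have "cmod x \<le> cmod u + 1/2" using x norm_triangle_ineq3[of u x] by linarith
      moreover have "cmod x > 1" using x u norm_triangle_ineq2[of u x] by linarith
      then have "cmod (\<psi> m x) \<le> 2 * cmod x" by (rule \<psi>_bounds)
      ultimately show ?thesis using u by linarith
    qed
  qed auto
  then show ?thesis by simp
qed

text \<open>At the first time the modulus reaches 2 it came from below 2 by a power of degree at
  most 3, so it is at most 8.\<close>

lemma exists_return_annulus: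
  assumes w: "1 < cmod w" "cmod w \<le> 2"
  shows "\<exists>k. 2 \<le> cmod w ^ degprod m k \<and> cmod w ^ degprod m k \<le> 8"
proof -
  define k where "k = (LEAST k. 2 \<le> cmod w ^ degprod m k)"
  have "\<exists>k. 2 \<le> cmod w ^ degprod m k"
  proof -
    obtain n where n: "2 < cmod w ^ n" using real_arch_pow[OF w(1)] by blast
    have "n \<le> degprod m n" using degprod_bounds(1)[of n m] less_exp[of n] by linarith
    then have "cmod w ^ n \<le> cmod w ^ degprod m n" using w by (intro power_increasing) auto
    then show ?thesis using n by (intro exI[of _ n]) linarith
  qed
  then have k2: "2 \<le> cmod w ^ degprod m k" unfolding k_def by (rule LeastI_ex)
  moreover have "cmod w ^ degprod m k \<le> 8"
  proof (cases k)
    case 0 then show ?thesis using w by simp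
  next
    case (Suc j)
    then have "cmod w ^ degprod m j < 2"
      using not_less_Least[of j "\<lambda>k. 2 \<le> cmod w ^ degprod m k"] unfolding k_def by auto
    then have "(cmod w ^ degprod m j) ^ d (Suc (m + j)) \<le> 2 ^ d (Suc (m + j))" by (intro power_mono) auto
    also have "\<dots> \<le> (2::real) ^ 3" using deg_le by (intro power_increasing) auto
    finally show ?thesis by (simp add: Suc degprod_Suc power_mult)
  qed
  ultimately show ?thesis by blast
qed

text \<open>Differentiating \<open>it_\<psi>\<close> gives
  \<open>A * cmod (deriv (\<psi> m) w) \<le> 34 * 8 * D\<close>, with \<open>D\<close> the degree of
  the iterate, and metric expansion bounds \<open>A\<close> from below. The constant 2000 = 4^2 *
  5^3 bounds \<open>\<sigma>\<close> for modulus at most 4.\<close>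

lemma deriv_\<psi>_scale:
  assumes w: "1 < cmod w" "cmod w \<le> 2" and k: "2 \<le> cmod w ^ degprod m k" "cmod w ^ degprod m k \<le> 8"
  shows "(11/10) ^ k * ((3/10)^2 * (8/100)^3) * cmod (deriv (\<psi> m) w) ^ 5 \<le> 2000 * (272 * real (degprod m k)) ^ 5"
proof -
  let ?D = "degprod m k" and ?z = "\<psi> m w"
  define A where "A = cmod (deriv (it m k) ?z)"
  obtain e where e: "cmod e = 1" "\<And>w. cmod w > 1 \<Longrightarrow> it m k (\<psi> m w) = \<psi> (m + k) (e * w ^ ?D)"
    using it_\<psi> by blast
  have ew: "cmod (e * w ^ ?D) = cmod w ^ ?D" using e(1) by (simp add: norm_mult norm_power)
  have "(\<psi> m has_field_derivative deriv (\<psi> m) w) (at w)"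
    using \<psi>_field_differentiable[OF w(1)] by (simp add: DERIV_deriv_iff_field_differentiable)
  moreover have "(it m k has_field_derivative deriv (it m k) ?z) (at ?z)"
    using it_field_differentiable by (simp add: DERIV_deriv_iff_field_differentiable)
  ultimately have l: "((\<lambda>w. it m k (\<psi> m w)) has_field_derivative deriv (it m k) ?z * deriv (\<psi> m) w) (at w)"
    by (rule DERIV_chain2[rotated])
  have "(\<psi> (m + k) has_field_derivative deriv (\<psi> (m + k)) (e * w ^ ?D)) (at (e * w ^ ?D))"
    using \<psi>_field_differentiable[of "e * w ^ ?D" "m + k"] ew k by (simp add: DERIV_deriv_iff_field_differentiable)
  moreover have "((\<lambda>w. e * w ^ ?D) has_field_derivative e * (of_nat ?D * w ^ (?D - 1))) (at w)"
    by (auto intro!: derivative_eq_intros)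
  ultimately have "((\<lambda>w. \<psi> (m + k) (e * w ^ ?D)) has_field_derivative
      deriv (\<psi> (m + k)) (e * w ^ ?D) * (e * (of_nat ?D * w ^ (?D - 1)))) (at w)"
    by (rule DERIV_chain2)
  then have "((\<lambda>w. it m k (\<psi> m w)) has_field_derivative
      deriv (\<psi> (m + k)) (e * w ^ ?D) * (e * (of_nat ?D * w ^ (?D - 1)))) (at w)"
    by (rule has_field_derivative_transform_within_open[of _ _ _ "- cball 0 1"]) (use e(2) w in auto)
  with l have eq: "deriv (it m k) ?z * deriv (\<psi> m) w
      = deriv (\<psi> (m + k)) (e * w ^ ?D) * (e * (of_nat ?D * w ^ (?D - 1)))"
    by (rule DERIV_unique)
  have "A * cmod (deriv (\<psi> m) w) = cmod (deriv (it m k) ?z * deriv (\<psi> m) w)"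
    by (simp add: A_def norm_mult)
  also have "\<dots> = cmod (deriv (\<psi> (m + k)) (e * w ^ ?D)) * (?D * cmod w ^ (?D - 1))"
    unfolding eq using e(1) by (simp add: norm_mult norm_power)
  also have "\<dots> \<le> 34 * (real ?D * 8)"
  proof (intro mult_mono)
    show "cmod (deriv (\<psi> (m + k)) (e * w ^ ?D)) \<le> 34"
      using k ew by (intro deriv_\<psi>_annulus) auto
    have "cmod w ^ (?D - 1) \<le> cmod w ^ ?D" using w by (intro power_increasing) auto
    then show "cmod w ^ (?D - 1) \<le> 8" using k by linarith
  qed auto
  finally have A: "A * cmod (deriv (\<psi> m) w) \<le> 272 * real ?D" by simp
  have zc: "?z \<in> closure (- K m)" using \<psi>_notin_K[OF w(1)] closure_subset by blast
  have "(11/10) ^ k * ((3/10)^2 * (8/100)^3) \<le> (11/10) ^ k * \<sigma> (it m k ?z)"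
    by (intro mult_left_mono \<sigma>_avoids[OF avoids_closure[OF it_closure_basin[OF zc]]]) auto
  also have "\<dots> \<le> A ^ 5 * \<sigma> ?z" unfolding A_def by (rule expansion_closure[OF zc])
  also have "\<dots> \<le> A ^ 5 * 2000"
    using \<sigma>_upper[of ?z 4] \<psi>_bounds(2)[OF w(1), of m] w by (intro mult_left_mono) (auto simp: A_def)
  finally have "(11/10) ^ k * ((3/10)^2 * (8/100)^3) * cmod (deriv (\<psi> m) w) ^ 5
      \<le> A ^ 5 * 2000 * cmod (deriv (\<psi> m) w) ^ 5"
    by (intro mult_right_mono) auto
  also have "\<dots> = 2000 * (A * cmod (deriv (\<psi> m) w)) ^ 5" by (simp add: power_mult_distrib)
  also have "\<dots> \<le> 2000 * (272 * real ?D) ^ 5" using A by (intro mult_left_mono power_mono) (auto simp: A_def)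
  finally show ?thesis by simp
qed

text \<open>At the return time \<open>D * ln \<bar>w\<bar> \<le> ln 8\<close>, which trades the
  degree \<open>D\<close> for a power of the logarithmic radius. As \<open>D \<le> 3 ^ k\<close>,
  with \<open>l = log 3 (11/10)\<close> the expansion \<open>(11/10) ^ k\<close> is at least
  \<open>D powr l\<close>; the fifth root of \<open>D powr (5 - l)\<close> leaves the exponent
  \<open>l / 5 - 1 > -1\<close>, integrable at 0.\<close>

lemma deriv_\<psi>_bound:
  "\<exists>C \<kappa>. 0 < \<kappa> \<and> (\<forall>m w. 1 < cmod w \<longrightarrow> cmod w \<le> 2 \<longrightarrow>
     cmod (deriv (\<psi> m) w) \<le> C * ln (cmod w) powr (\<kappa> - 1))"
proof -
  define l where "l = log 3 (11/10)"
  define c0 :: real where "c0 = (3/10)^2 * (8/100)^3"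
  define C1 where "C1 = 2000 * 272 ^ 5 / c0"
  define C where "C = (C1 * ln 8 powr (5 - l)) powr (1/5)"
  have l: "0 < l" "l < 1" by (simp_all add: l_def log_less_iff)
  have c0: "c0 > 0" by (simp add: c0_def)
  have C1: "C1 > 0" using c0 by (simp add: C1_def)
  have "cmod (deriv (\<psi> m) w) \<le> C * ln (cmod w) powr (l / 5 - 1)" if w: "1 < cmod w" "cmod w \<le> 2" for m w
  proof -
    obtain k where k: "2 \<le> cmod w ^ degprod m k" "cmod w ^ degprod m k \<le> 8"
      using exists_return_annulus[OF w] by blast
    define D where "D = real (degprod m k)"
    define x where "x = cmod (deriv (\<psi> m) w)"
    define t where "t = ln (cmod w)"
    have t: "t > 0" unfolding t_def using w by (intro ln_gt_zero) auto
    have D: "D > 0" "D \<le> 3 ^ k" using degprod_bounds(2,3)[of m k]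
      by (simp_all add: D_def flip: of_nat_power_le_of_nat_cancel_iff of_nat_le_iff)
    have x0: "x \<ge> 0" by (simp add: x_def)
    have "D * t = ln (cmod w ^ degprod m k)" using w by (simp add: D_def t_def ln_realpow)
    also have "\<dots> \<le> ln 8" using k by (intro ln_mono) auto
    finally have Dt: "D \<le> ln 8 / t" using t by (simp add: field_simps)
    have "D powr l \<le> (3 ^ k) powr l" using D l by (intro powr_mono2) auto
    also have "\<dots> = (3 powr l) ^ k" by (simp add: powr_realpow[symmetric] powr_powr mult.commute)
    also have "3 powr l = 11/10" by (simp add: l_def)
    finally have Dl: "D powr l \<le> (11/10) ^ k" .
    have "D powr l * c0 * x ^ 5 \<le> (11/10) ^ k * c0 * x ^ 5"
      using Dl c0 x0 by (intro mult_right_mono) auto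
    also have "\<dots> \<le> 2000 * (272 * D) ^ 5"
      using deriv_\<psi>_scale[OF w k] by (simp add: x_def D_def c0_def)
    finally have "x ^ 5 \<le> C1 * (D ^ 5 / D powr l)"
      using c0 D by (simp add: C1_def field_simps power_mult_distrib)
    also have "D ^ 5 / D powr l = D powr (5 - l)" using D by (simp add: powr_diff powr_numeral)
    also have "C1 * D powr (5 - l) \<le> C1 * (ln 8 / t) powr (5 - l)"
      using Dt D C1 l by (intro mult_left_mono powr_mono2) auto
    finally have "x ^ 5 \<le> C1 * (ln 8 / t) powr (5 - l)" .
    then have "(x ^ 5) powr (1/5) \<le> (C1 * (ln 8 / t) powr (5 - l)) powr (1/5)"
      using x0 by (intro powr_mono2) auto
    moreover have "(x ^ 5) powr (1/5) = x"
    proof (cases "x = 0")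
      case False
      then have "x ^ 5 = x powr 5" using x0 by (simp add: powr_numeral)
      then show ?thesis using x0 by (simp add: powr_powr del: powr_numeral)
    qed simp
    moreover have "(C1 * (ln 8 / t) powr (5 - l)) powr (1/5) = C * t powr (l / 5 - 1)"
    proof -
      have "(ln 8 / t) powr (5 - l) = ln 8 powr (5 - l) * t powr (l - 5)"
        using t by (simp add: powr_divide powr_minus_divide[symmetric] divide_powr_uminus)
      then have "(C1 * (ln 8 / t) powr (5 - l)) powr (1/5) = (C1 * ln 8 powr (5 - l)) powr (1/5) * (t powr (l - 5)) powr (1/5)"
        using C1 by (simp add: powr_mult)
      also have "(t powr (l - 5)) powr (1/5) = t powr (l / 5 - 1)"
        by (simp add: powr_powr diff_divide_distrib)
      finally show ?thesis by (simp add: C_def)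
    qed
    ultimately show ?thesis by (simp add: x_def t_def)
  qed
  then show ?thesis using l by (intro exI[of _ C] exI[of _ "l/5"]) auto
qed

text \<open>The derivative bound is integrable in the logarithmic radius, uniformly over all rays.\<close>

lemma \<psi>_radial:
  "\<exists>C \<kappa>. 0 < \<kappa> \<and> (\<forall>m u r s. cmod u = 1 \<longrightarrow> 1 < r \<longrightarrow> r < s \<longrightarrow> s \<le> 2 \<longrightarrow>
     cmod (\<psi> m (of_real s * u) - \<psi> m (of_real r * u)) \<le> C * ln s powr \<kappa>)"
proof -
  obtain C \<kappa> where k: "\<kappa> > 0" and C: "\<And>m w. 1 < cmod w \<Longrightarrow> cmod w \<le> 2 \<Longrightarrow>
     cmod (deriv (\<psi> m) w) \<le> C * ln (cmod w) powr (\<kappa> - 1)"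
    using deriv_\<psi>_bound by metis
  have "cmod (\<psi> m (of_real s * u) - \<psi> m (of_real r * u)) \<le> 2 * C / \<kappa> * ln s powr \<kappa>"
    if u: "cmod u = 1" and rs: "1 < r" "r < s" "s \<le> 2" for m u r s
  proof -
    define f where "f = (\<lambda>x::real. \<psi> m (of_real (exp x) * u))"
    define f' where "f' = (\<lambda>x::real. deriv (\<psi> m) (of_real (exp x) * u) * (of_real (exp x) * u))"
    \<comment> \<open>A primitive of the majorant of the derivative; the factor 2 bounds the modulus
      \<open>exp x\<close> produced by the logarithmic variable.\<close>
    define \<phi> where "\<phi> = (\<lambda>x::real. 2 * C / \<kappa> * x powr \<kappa>)"
    have C0: "C \<ge> 0"
    proof -
      have "0 \<le> C * ln 2 powr (\<kappa> - 1)"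
        using order_trans[OF norm_ge_zero C[of 2 0]] by simp
      then show ?thesis by (simp add: zero_le_mult_iff)
    qed
    have nu: "cmod (of_real (exp x) * u) = exp x" for x by (simp add: norm_mult u)
    have df: "(f has_vector_derivative f' x) (at x)" if "0 < x" for x
    proof -
      have "(\<psi> m has_field_derivative deriv (\<psi> m) (of_real (exp x) * u)) (at (of_real (exp x) * u))"
        using \<psi>_field_differentiable[of "of_real (exp x) * u" m] nu[of x] that
        by (simp add: DERIV_deriv_iff_field_differentiable)
      moreover have "((\<lambda>x. of_real (exp x) * u) has_vector_derivative of_real (exp x) * u) (at x)"
      proof -
        have "((\<lambda>x. exp x *\<^sub>R u) has_vector_derivative exp x *\<^sub>R u) (at x)"
          by (auto intro!: derivative_eq_intros simp: has_real_derivative_iff_has_vector_derivative[symmetric])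
        then show ?thesis by (simp add: scaleR_conv_of_real)
      qed
      ultimately have "(\<psi> m \<circ> (\<lambda>x. of_real (exp x) * u) has_vector_derivative
          of_real (exp x) * u * deriv (\<psi> m) (of_real (exp x) * u)) (at x)"
        by (intro field_vector_diff_chain_at)
      then show ?thesis unfolding f_def f'_def o_def by (simp only: mult.commute)
    qed
    have "norm (f (ln s) - f (ln r)) \<le> \<phi> (ln s) - \<phi> (ln r)"
    proof (rule differentiable_bound_general[where f' = f' and \<phi>' = "\<lambda>x. 2 * C * x powr (\<kappa> - 1)"])
      show "ln r < ln s" using rs by simp
      have "continuous (at x within {ln r..ln s}) f" if "x \<in> {ln r..ln s}" for x
      proof -
        have "ln r > 0" using rs by (intro ln_gt_zero)
        then have "x > 0" using that by auto
        then show ?thesis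
          by (rule continuous_at_imp_continuous_at_within[OF has_vector_derivative_continuous[OF df]])
      qed
      then show "continuous_on {ln r..ln s} f" by (simp add: continuous_on_eq_continuous_within)
      show "continuous_on {ln r..ln s} \<phi>" unfolding \<phi>_def
        using rs ln_gt_zero[of r] by (intro continuous_intros) auto
      fix x assume x: "ln r < x" "x < ln s"
      have x0: "x > 0" using x rs ln_gt_zero[of r] by linarith
      show "(f has_vector_derivative f' x) (at x)" using df x0 .
      have "(\<phi> has_real_derivative 2 * C / \<kappa> * (\<kappa> * x powr (\<kappa> - 1))) (at x)"
        unfolding \<phi>_def using x0 by (intro DERIV_cmult has_real_derivative_powr) 
      then show "(\<phi> has_vector_derivative 2 * C * x powr (\<kappa> - 1)) (at x)"
        using k by (simp add: has_real_derivative_iff_has_vector_derivative mult.assoc)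
      have ex: "exp x \<le> 2"
      proof -
        have "exp x \<le> exp (ln s)" using x by simp
        then show ?thesis using rs by simp
      qed
      have "norm (f' x) = cmod (deriv (\<psi> m) (of_real (exp x) * u)) * exp x"
        by (simp add: f'_def norm_mult u)
      also have "\<dots> \<le> (C * x powr (\<kappa> - 1)) * 2"
        using C[of "of_real (exp x) * u" m] nu[of x] x0 ex C0 by (intro mult_mono) auto
      finally show "norm (f' x) \<le> 2 * C * x powr (\<kappa> - 1)" by simp
    qed
    also have "\<dots> \<le> \<phi> (ln s)" using C0 k by (simp add: \<phi>_def)
    finally show ?thesis using rs by (simp add: f_def \<phi>_def)
  qed
  then show ?thesis using k by blast
qed

text \<open>Landing in terms of \<open>\<psi>\<close>, before the sign correction, where conjugation
  acts simply by \<open>\<theta> \<mapsto> 1 - \<theta>\<close>.\<close>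

definition lands :: "nat \<Rightarrow> real \<Rightarrow> complex \<Rightarrow> bool" where
  "lands m \<theta> p \<longleftrightarrow> ((\<lambda>R. \<psi> m (of_real R * cis (2 * pi * \<theta>))) \<longlongrightarrow> p) (at_right 1)"

text \<open>Basin points \<open>z k = \<psi> m (w k)\<close> tend to \<open>p\<close>. A limit
  \<open>a\<close> of the \<open>w k\<close> lies on the unit circle, since otherwise
  \<open>p\<close> would itself be a basin point. As the oscillation along rays is small uniformly
  in the direction, the limits can be exchanged and the ray in direction \<open>a\<close> lands at
  \<open>p\<close>.\<close>

lemma lands_exists:
  assumes p: "p \<in> julia P m" shows "\<exists>\<theta>\<in>{0..<1}. lands m \<theta> p"
proof -
  have pK: "p \<in> K m" "p \<in> closure (- K m)" using p by (auto simp: julia_P)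
  obtain z where z: "\<And>k. z k \<notin> K m" "z \<longlonglongrightarrow> p" using pK(2) unfolding closure_sequential by auto
  define w where "w k = inverse (F m (inverse (z k)))" for k
  have w1: "cmod (w k) > 1" and \<psi>w: "\<psi> m (w k) = z k" for k using \<psi>_F[OF z(1)] by (auto simp: w_def)
  obtain B where B: "\<And>k. cmod (z k) \<le> B"
    using convergent_imp_bounded[of z] z(2) by (auto simp: convergent_def bounded_iff)
  have "w k \<in> cball 0 (10/3 * B)" for k
    using \<psi>_bounds(1)[OF w1[of k], of m] B[of k] \<psi>w[of k] by auto
  then obtain a h where h: "strict_mono (h :: nat \<Rightarrow> nat)" "(w \<circ> h) \<longlonglongrightarrow> a"
    using compact_cball[of "0::complex" "10/3*B"] unfolding compact_def by metis
  have zh: "(\<lambda>k. z (h k)) \<longlonglongrightarrow> p" using LIMSEQ_subseq_LIMSEQ[OF z(2) h(1)] by (simp add: o_def)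
  have wh: "(\<lambda>k. w (h k)) \<longlonglongrightarrow> a" using h(2) by (simp add: o_def)
  have nwh: "(\<lambda>k. cmod (w (h k))) \<longlonglongrightarrow> cmod a" using wh by (rule tendsto_norm)
  have a1: "cmod a = 1"
  proof (rule ccontr)
    assume "cmod a \<noteq> 1"
    moreover have "cmod a \<ge> 1"
      using nwh by (rule LIMSEQ_le_const) (use w1 less_imp_le in blast)
    ultimately have a: "cmod a > 1" by simp
    then have "isCont (\<psi> m) a"
      using \<psi>_field_differentiable field_differentiable_imp_continuous_at by blast
    then have "(\<lambda>k. \<psi> m (w (h k))) \<longlonglongrightarrow> \<psi> m a" using wh by (rule isCont_tendsto_compose)
    then have "p = \<psi> m a" using zh unfolding \<psi>w by (rule LIMSEQ_unique[rotated])
    then show False using pK(1) \<psi>_notin_K[OF a] by blast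
  qed
  define u where "u k = w (h k) / of_real (cmod (w (h k)))" for k
  have w0: "cmod (w (h k)) \<noteq> 0" for k using w1[of "h k"] by linarith
  have u1: "cmod (u k) = 1" for k using w0[of k] by (simp add: u_def norm_divide)
  have "u \<longlonglongrightarrow> a / of_real (cmod a)"
    unfolding u_def using a1 by (intro tendsto_intros wh nwh) auto
  then have ua: "u \<longlonglongrightarrow> a" by (simp add: a1)
  have wu: "w (h k) = of_real (cmod (w (h k))) * u k" for k using w0[of k] by (simp add: u_def)
  obtain C \<kappa> where k: "\<kappa> > 0" and C: "\<And>m u r s. cmod u = 1 \<Longrightarrow> 1 < r \<Longrightarrow> r < s \<Longrightarrow> s \<le> 2 \<Longrightarrow>
     cmod (\<psi> m (of_real s * u) - \<psi> m (of_real r * u)) \<le> C * ln s powr \<kappa>"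
    using \<psi>_radial by metis
  have lim: "((\<lambda>R. \<psi> m (of_real R * a)) \<longlongrightarrow> p) (at_right 1)"
    unfolding tendsto_iff
  proof (intro allI impI)
    fix \<epsilon> :: real assume e: "\<epsilon> > 0"
    have "((\<lambda>s. C * ln s powr \<kappa>) \<longlongrightarrow> C * (ln 1 powr \<kappa>)) (at_right 1)"
      using k by (intro tendsto_mult tendsto_powr2 tendsto_intros) 
        (auto simp: eventually_at_right_less eventually_at_filter intro!: always_eventually)
    then have "eventually (\<lambda>s. C * ln s powr \<kappa> < \<epsilon> / 4) (at_right 1)"
      using e k by (intro order_tendstoD(2)[of _ 0]) auto
    moreover have "eventually (\<lambda>s. s \<in> {1<..<2}) (at_right (1::real))"
      by (rule eventually_at_right_real) simp
    ultimately have "eventually (\<lambda>s. C * ln s powr \<kappa> < \<epsilon> / 4 \<and> s \<in> {1<..<2}) (at_right 1)"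
      by eventually_elim auto
    then obtain s where s: "C * ln s powr \<kappa> < \<epsilon> / 4" "1 < s" "s < 2"
      using eventually_happens'[of "at_right (1::real)"] by auto
    have "cmod (of_real s * a) > 1" using s a1 by (simp add: norm_mult)
    then have "isCont (\<psi> m) (of_real s * a)"
      using \<psi>_field_differentiable field_differentiable_imp_continuous_at by blast
    moreover have "(\<lambda>k. of_real s * u k) \<longlonglongrightarrow> of_real s * a" by (intro tendsto_intros ua)
    ultimately have "(\<lambda>k. \<psi> m (of_real s * u k)) \<longlonglongrightarrow> \<psi> m (of_real s * a)" by (rule isCont_tendsto_compose)
    then have e1: "eventually (\<lambda>k. dist (\<psi> m (of_real s * u k)) (\<psi> m (of_real s * a)) < \<epsilon> / 4) sequentially"
      using e by (intro tendstoD) auto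
    have e2: "eventually (\<lambda>k. dist (z (h k)) p < \<epsilon> / 4) sequentially" using zh e by (intro tendstoD) auto
    have e3: "eventually (\<lambda>k. cmod (w (h k)) < s) sequentially"
      using order_tendstoD(2)[OF nwh, of s] s a1 by simp
    from e1 e2 e3 have "eventually (\<lambda>k. dist (\<psi> m (of_real s * u k)) (\<psi> m (of_real s * a)) < \<epsilon> / 4 \<and>
        dist (z (h k)) p < \<epsilon> / 4 \<and> cmod (w (h k)) < s) sequentially"
      by eventually_elim auto
    then obtain k where k: "dist (\<psi> m (of_real s * u k)) (\<psi> m (of_real s * a)) < \<epsilon> / 4"
        "dist (z (h k)) p < \<epsilon> / 4" "cmod (w (h k)) < s"
      using eventually_happens'[OF sequentially_bot] by blast
    have "dist (\<psi> m (of_real R * a)) p < \<epsilon>" if R: "1 < R" "R < s" for R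
    proof -
      have "dist (\<psi> m (of_real s * a)) (\<psi> m (of_real R * a)) < \<epsilon> / 4"
        using C[OF a1 R, of m] s by (simp add: dist_norm)
      moreover have "dist (\<psi> m (of_real s * u k)) (\<psi> m (of_real (cmod (w (h k))) * u k)) < \<epsilon> / 4"
        using C[OF u1 w1 k(3), of m k] s by (simp add: dist_norm)
      then have "dist (\<psi> m (of_real s * u k)) (z (h k)) < \<epsilon> / 4"
        using wu[of k] \<psi>w by metis
      ultimately show ?thesis using k(1,2)
        dist_triangle[of "\<psi> m (of_real R * a)" p "\<psi> m (of_real s * a)"]
        dist_triangle[of "\<psi> m (of_real s * a)" p "\<psi> m (of_real s * u k)"]
        dist_triangle[of "\<psi> m (of_real s * u k)" p "z (h k)"]
        by (simp add: dist_commute)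
    qed
    then show "eventually (\<lambda>R. dist (\<psi> m (of_real R * a)) p < \<epsilon>) (at_right 1)"
      unfolding eventually_at_right[OF s(2)] using s(2) by blast
  qed
  define \<theta> where "\<theta> = Arg2pi a / (2 * pi)"
  have "a = cis (Arg2pi a)" using Arg2pi_eq[of a] a1 by (simp add: cis_conv_exp)
  then have "cis (2 * pi * \<theta>) = a" by (simp add: \<theta>_def)
  moreover have "\<theta> \<in> {0..<1}" using Arg2pi[of a] by (auto simp: \<theta>_def divide_simps)
  ultimately show ?thesis using lim by (intro bexI[of _ \<theta>]) (simp_all add: lands_def)
qed

end

section \<open>Angles of the rays\<close>

lemma cis_2pi_eq_iff: "cis (2 * pi * x) = cis (2 * pi * y) \<longleftrightarrow> x - y \<in> \<int>"
proof -
  have "cis (2 * pi * x) = cis (2 * pi * y) \<longleftrightarrow> (\<exists>n::int. 2 * pi * x = 2 * pi * y + 2 * pi * n)"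
    using sin_cos_eq_iff[of "2 * pi * x" "2 * pi * y"] by (auto simp: complex_eq_iff)
  also have "\<dots> \<longleftrightarrow> (\<exists>n::int. 2 * pi * (x - y) = 2 * pi * n)" by (simp add: algebra_simps)
  also have "\<dots> \<longleftrightarrow> (\<exists>n::int. x - y = n)" by simp
  also have "\<dots> \<longleftrightarrow> x - y \<in> \<int>" by (auto simp: Ints_def)
  finally show ?thesis .
qed

lemma cis_2pi_add_half: "cis (2 * pi * (x + 1/2)) = - cis (2 * pi * x)"
  by (simp add: distrib_left cis_mult[symmetric])

text \<open>The closed arcs over \<open>[a, b]\<close> and \<open>[b, a + 1]\<close> cover the
  circle and meet only at the two removed points, so a connected set in the complement cannot meet
  both.\<close>

lemma arc_component:
  fixes a b :: real
  assumes ab: "0 < a" "a < b" "b < 1"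
  defines "I \<equiv> (\<lambda>\<theta>. cis (2 * pi * \<theta>)) ` {a<..<b}"
  shows "I \<in> components (sphere 0 1 - (\<lambda>\<theta>. cis (2 * pi * \<theta>)) ` {a, b})"
    and "arc_length I = b - a"
proof -
  let ?e = "\<lambda>\<theta>. cis (2 * pi * \<theta>)"
  let ?S = "sphere 0 1 - ?e ` {a, b}"
  have cont: "continuous_on X ?e" for X by (intro continuous_intros)
  have int01: "n = 0 \<or> n = -1" if "-1 \<le> real_of_int n" "real_of_int n \<le> 0" for n :: int
    using that by linarith
  have inI: "\<theta> \<in> {a<..<b}" if "\<theta> \<in> {0..<1}" "?e \<theta> \<in> I" for \<theta>
  proof -
    obtain x where x: "x \<in> {a<..<b}" "?e \<theta> = ?e x" using \<open>?e \<theta> \<in> I\<close> unfolding I_def by blast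
    then obtain n :: int where n: "\<theta> - x = n" unfolding cis_2pi_eq_iff by (auto elim: Ints_cases)
    then have "-1 < real_of_int n" "real_of_int n < 1" using x \<open>\<theta> \<in> {0..<1}\<close> ab by auto
    then have "n = 0" by linarith
    then show ?thesis using n x by simp
  qed
  have disj: "z \<in> ?e ` {a, b}" if z: "z \<in> ?e ` {a..b}" "z \<in> ?e ` {b..a+1}" for z
  proof -
    obtain x where x: "x \<in> {a..b}" "z = ?e x" using z(1) by blast
    obtain y where y: "y \<in> {b..a+1}" "z = ?e y" using z(2) by blast
    note xy = x(1) y(1) x(2) y(2)
    then have "x - y \<in> \<int>" using cis_2pi_eq_iff by metis
    then obtain n :: int where n: "x - y = n" by (auto elim: Ints_cases)
    have "n = 0 \<or> n = -1" using n xy by (intro int01) auto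
    then have "x = b \<or> x = a" using n xy by auto
    then show ?thesis using xy(3) by auto
  qed
  have cover: "z \<in> ?e ` {a..b} \<or> z \<in> ?e ` {b..a+1}" if z: "cmod z = 1" for z
  proof -
    define t where "t = Arg2pi z / (2 * pi)"
    have "z = cis (Arg2pi z)" using Arg2pi_eq[of z] z by (simp add: cis_conv_exp)
    then have zt: "z = ?e t" by (simp add: t_def)
    have t: "0 \<le> t" "t < 1" using Arg2pi[of z] by (auto simp: t_def divide_simps)
    have zt1: "z = ?e (t + 1)" using zt cis_2pi_eq_iff[of "t+1" t] by simp
    consider "t < a" | "a \<le> t" "t \<le> b" | "b < t" by linarith
    then show ?thesis
    proof cases
      case 1
      then have "t + 1 \<in> {b..a+1}" using ab t by auto
      then show ?thesis using zt1 by blast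
    next
      case 2 then show ?thesis using zt by auto
    next
      case 3
      then have "t \<in> {b..a+1}" using ab t by auto
      then show ?thesis using zt by blast
    qed
  qed
  have IS: "I \<subseteq> ?S"
  proof
    fix z assume "z \<in> I"
    then obtain x where x: "x \<in> {a<..<b}" "z = ?e x" by (auto simp: I_def)
    have "z \<notin> ?e ` {a, b}" using inI[of a] inI[of b] \<open>z \<in> I\<close> ab by auto
    then show "z \<in> ?S" using x by simp
  qed
  have Ieq: "z \<in> I" if z: "z \<in> ?S" "z \<in> ?e ` {a..b}" for z
  proof -
    obtain x where x: "x \<in> {a..b}" "z = ?e x" using z(2) by blast
    then have "x \<noteq> a" "x \<noteq> b" using z(1) by auto
    then show ?thesis using x by (auto simp: I_def)
  qed
  have conI: "connected I" unfolding I_def by (intro connected_continuous_image cont) auto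
  have neI: "I \<noteq> {}" using ab by (auto simp: I_def)
  show "I \<in> components ?S"
    unfolding in_components_maximal
  proof (intro conjI allI impI neI IS conI)
    fix X assume X: "X \<noteq> {} \<and> I \<subseteq> X \<and> X \<subseteq> ?S \<and> connected X"
    have cl: "closed (?e ` {a..b})" "closed (?e ` {b..a+1})"
      by (intro compact_imp_closed compact_continuous_image cont; simp)+
    have XS: "cmod x = 1" "x \<in> ?S" if "x \<in> X" for x using X that by auto
    then have "X \<subseteq> ?e ` {a..b} \<union> ?e ` {b..a+1}" using cover by blast
    moreover have "?e ` {a..b} \<inter> ?e ` {b..a+1} \<inter> X = {}" using X disj by blast
    moreover have "?e ` {a..b} \<inter> X \<noteq> {}"
    proof -
      have "I \<subseteq> ?e ` {a..b}" unfolding I_def by (intro image_mono) auto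
      then show ?thesis using X neI by blast
    qed
    moreover have "connected X" using X by blast
    ultimately have "?e ` {b..a+1} \<inter> X = {}"
      using connected_closedD[OF _ _ _ cl] by metis
    have "X \<subseteq> I"
    proof
      fix x assume x: "x \<in> X"
      then have "x \<notin> ?e ` {b..a+1}" using \<open>?e ` {b..a+1} \<inter> X = {}\<close> by blast
      then show "x \<in> I" using cover[OF XS(1)[OF x]] Ieq[OF XS(2)[OF x]] by blast
    qed
    then show "X = I" using X by blast
  qed
  have "{\<theta>\<in>{0..<1}. ?e \<theta> \<in> I} = {a<..<b}"
  proof (intro equalityI subsetI)
    fix x assume "x \<in> {a<..<b}"
    then have "?e x \<in> I" unfolding I_def by (rule imageI)
    then show "x \<in> {\<theta>\<in>{0..<1}. ?e \<theta> \<in> I}" using ab \<open>x \<in> {a<..<b}\<close> by simp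
  qed (use inI in blast)
  then show "arc_length I = b - a" using ab by (simp add: arc_length_def)
qed

section \<open>Boettcher maps with sign correction\<close>

context mixed_seq
begin

text \<open>The recursion is chosen so that \<open>- ((sg m * w) ^ d) = sg (Suc m) * w ^ d\<close>
  for \<open>d = d (Suc m)\<close>, which makes the corrected map conjugate to a pure power.\<close>

fun sg :: "nat \<Rightarrow> real" where
  "sg 0 = 1"
| "sg (Suc m) = - (sg m ^ d (Suc m))"

lemma sg_cases: "sg m = 1 \<or> sg m = -1"
  by (induction m) (auto simp: minus_one_power_iff)

lemma sg_sq [simp]: "complex_of_real (sg m) * of_real (sg m) = 1"
  using sg_cases[of m] by auto

lemma norm_sg [simp]: "\<bar>sg m\<bar> = 1" using sg_cases[of m] by auto

text \<open>The signs make up for the leading coefficients \<open>-1\<close> of the polynomials.\<close>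

definition \<phi> :: "nat \<Rightarrow> complex \<Rightarrow> complex" where
  "\<phi> m z = of_real (sg m) * inverse (F m (inverse z))"

lemma \<phi>_\<psi>: "cmod w > 1 \<Longrightarrow> \<phi> m (\<psi> m (of_real (sg m) * w)) = w"
proof -
  assume w: "cmod w > 1"
  then have "cmod (of_real (sg m) * w) > 1" by (simp add: norm_mult)
  from F_\<psi>[OF this] show ?thesis by (simp add: \<phi>_def flip: mult.assoc)
qed

lemma \<psi>_\<phi>:
  assumes "z \<notin> K m" shows "cmod (\<phi> m z) > 1" "\<psi> m (of_real (sg m) * \<phi> m z) = z"
  using \<psi>_F[OF assms] by (simp_all add: \<phi>_def norm_mult flip: mult.assoc)

lemma inj_on_\<phi>: "inj_on (\<phi> m) (- K m)"
  using \<psi>_\<phi>(2) by (intro inj_on_inverseI[of _ "\<lambda>w. \<psi> m (of_real (sg m) * w)"]) auto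

lemma \<psi>_sg_notin_K: "cmod w > 1 \<Longrightarrow> \<psi> m (of_real (sg m) * w) \<notin> K m"
  by (rule \<psi>_notin_K) (simp add: norm_mult)

lemma bottcher_inv_\<phi>:
  assumes "cmod w > 1" shows "bottcher_inv P \<phi> m w = \<psi> m (of_real (sg m) * w)"
  unfolding basin_P using inj_on_\<phi> \<psi>_sg_notin_K[OF assms] \<phi>_\<psi>[OF assms]
  by (intro inv_into_f_eq) auto

lemma bottcher_maps_\<phi>: "bottcher_maps P \<phi>"
  unfolding bottcher_maps_def
proof (intro conjI allI ballI impI)
  fix m
  have "F m \<circ> inverse holomorphic_on - K m"
    by (intro holomorphic_on_compose holomorphic_intros holomorphic_on_subset[OF disc_mapD(1)[OF disc_map_W]])
       (auto simp: W_def)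
  then have h: "(\<lambda>z. F m (inverse z)) holomorphic_on - K m" by (simp add: o_def)
  have "F m (inverse z) \<noteq> 0" if "z \<notin> K m" for z
    using \<psi>_F(1)[OF that] by auto
  then show "\<phi> m holomorphic_on basin_inf P m"
    unfolding \<phi>_def basin_P by (intro holomorphic_intros h) auto
  show "bij_betw (\<phi> m) (basin_inf P m) (- cball 0 1)"
    unfolding bij_betw_def basin_P
  proof (intro conjI inj_on_\<phi> equalityI subsetI)
    fix w assume "w \<in> - cball (0::complex) 1"
    then have "cmod w > 1" by simp
    then show "w \<in> \<phi> m ` (- K m)"
      using \<phi>_\<psi> \<psi>_sg_notin_K by (intro image_eqI[of _ _ "\<psi> m (of_real (sg m) * w)"]) auto
  next
    fix w assume "w \<in> \<phi> m ` (- K m)"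
    then obtain z where "z \<notin> K m" "w = \<phi> m z" by blast
    then show "w \<in> - cball 0 1" using \<psi>_\<phi>(1)[of z m] by simp
  qed
  have "eventually (\<lambda>z. cmod (z / 2) \<le> cmod (\<phi> m z)) at_infinity"
    unfolding eventually_at_infinity
  proof (intro exI[of _ 3] allI impI)
    fix z :: complex assume "3 \<le> cmod z"
    then have z: "z \<notin> K m" using K_subset[of m] by auto
    have "cmod (of_real (sg m) * \<phi> m z) > 1" using \<psi>_\<phi>(1)[OF z] by (simp add: norm_mult)
    from \<psi>_bounds(2)[OF this, of m] \<psi>_\<phi>(2)[OF z] show "cmod (z / 2) \<le> cmod (\<phi> m z)"
      by (simp add: norm_mult norm_divide)
  qed
  moreover have "filterlim (\<lambda>z::complex. norm (z / 2)) at_top at_infinity"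
    unfolding norm_divide
    using filterlim_at_top_mult_tendsto_pos[OF tendsto_const[of "1/2::real"] _ filterlim_norm_at_top] by simp
  ultimately have "filterlim (\<lambda>z. norm (\<phi> m z)) at_top at_infinity"
    by (rule filterlim_at_top_mono[rotated])
  then show "filterlim (\<phi> m) at_infinity at_infinity"
    by (rule filterlim_norm_at_top_imp_at_infinity)
  fix w assume "w \<in> - cball (0::complex) 1"
  then have w: "cmod w > 1" by simp
  define v where "v = of_real (sg m) * w"
  have v: "cmod v > 1" using w by (simp add: v_def norm_mult)
  let ?d = "d (Suc m)"
  have vd: "- (v ^ ?d) = of_real (sg (Suc m)) * w ^ ?d" by (simp add: v_def power_mult_distrib)
  have "\<phi> (Suc m) (poly (P (Suc m)) (bottcher_inv P \<phi> m w)) = \<phi> (Suc m) (\<psi> (Suc m) (- (v ^ ?d)))"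
    using \<psi>_semiconj[OF v, of m] by (simp add: bottcher_inv_\<phi>[OF w] poly_P v_def)
  also have "\<dots> = w ^ ?d" unfolding vd
    using w deg_pos by (intro \<phi>_\<psi>) (simp add: norm_power one_less_power)
  finally show "\<phi> (Suc m) (poly (P (Suc m)) (bottcher_inv P \<phi> m w)) = w ^ degree (P (Suc m))"
    by (simp add: degree_P)
next
  fix m assume "\<forall>m\<ge>1. lead_coeff (P m) = 1"
  then have "lead_coeff (P 1) = 1" by blast
  then show "((\<lambda>z. \<phi> m z / z) \<longlongrightarrow> 1) at_infinity" using lead_coeff_P[of 1] by simp
qed

section \<open>The repelling orbit on the real line\<close>

primrec rit :: "nat \<Rightarrow> real \<Rightarrow> real" where
  "rit 0 x = x"
| "rit (Suc k) x = 1 - rit k x ^ d (Suc k)"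

text \<open>The backward branch \<open>y \<mapsto> root d (1 - y)\<close> maps the interval into
  itself for both degrees, because \<open>(38/100)^2 \<le> 1 - 855/1000\<close> and
  \<open>1 - 38/100 \<le> (855/1000)^3\<close>. The endpoints also keep the interval outside the
  discs of radius 3/10 about 0 and 14/100 about 1.\<close>

lemma rit_preimage:
  assumes "y \<in> {38/100..855/1000}"
  shows "\<exists>x. rit n x = y \<and> (\<forall>k\<le>n. rit k x \<in> {38/100..855/1000})"
  using assms
proof (induction n arbitrary: y)
  case 0 then show ?case by (intro exI[of _ y]) auto
next
  case (Suc n)
  let ?d = "d (Suc n)"
  define y' where "y' = root ?d (1 - y)"
  have dp: "?d > 0" by (rule deg_pos)
  have y: "145/1000 \<le> 1 - y" "1 - y \<le> 62/100" using Suc.prems by auto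
  have y'd: "y' ^ ?d = 1 - y" unfolding y'_def using dp y by (intro real_root_pow_pos2) auto
  have y'0: "y' \<ge> 0" unfolding y'_def using y by (intro real_root_ge_zero) auto
  have "(38/100) ^ ?d \<le> (145/1000::real)" "(62/100::real) \<le> (855/1000) ^ ?d"
    using deg[of "Suc n"] by (auto simp: power2_eq_square power3_eq_cube)
  then have "(38/100) ^ ?d \<le> y' ^ ?d" "y' ^ ?d \<le> (855/1000) ^ ?d" using y y'd by linarith+
  then have "y' \<in> {38/100..855/1000}" using y'0 dp by (simp add: power_mono_iff)
  from Suc.IH[OF this] obtain x where x: "rit n x = y'" "\<forall>k\<le>n. rit k x \<in> {38/100..855/1000}" by blast
  have "rit (Suc n) x = y" using x(1) y'd by simp
  then show ?case using x(2) Suc.prems by (intro exI[of _ x]) (auto simp: le_Suc_eq)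
qed

text \<open>The interval is not forward invariant, so the initial point is found as a common point
  of the nested compact sets of points that stay for \<open>n\<close> steps.\<close>

lemma exists_real_orbit: "\<exists>x. \<forall>k. rit k x \<in> {38/100..855/1000}"
proof -
  define X where "X n = {x. \<forall>k\<le>n. rit k x \<in> {38/100..855/1000}}" for n
  have cr: "continuous_on UNIV (rit k)" for k
    by (induction k) (auto intro!: continuous_intros)
  have "closed (X n)" for n
  proof -
    have "X n = (\<Inter>k\<in>{..n}. rit k -` {38/100..855/1000})" by (auto simp: X_def)
    moreover have "closed (rit k -` {38/100..855/1000})" for k
      using cr[of k] by (intro continuous_closed_vimage) (auto simp: continuous_on_eq_continuous_at)
    ultimately show ?thesis by auto
  qed
  moreover have "X n \<subseteq> {38/100..855/1000}" for n
  proof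
    fix x assume "x \<in> X n"
    then have "rit 0 x \<in> {38/100..855/1000}" unfolding X_def by blast
    then show "x \<in> {38/100..855/1000}" by simp
  qed
  ultimately have "compact (X n)" for n
    by (metis compact_Int_closed inf.absorb2 compact_Icc)
  moreover have "X n \<noteq> {}" for n
    using rit_preimage[of "1/2" n] by (auto simp: X_def)
  moreover have "X n \<subseteq> X m" if "m \<le> n" for m n using that by (auto simp: X_def)
  ultimately have "\<Inter> (range X) \<noteq> {}" by (intro compact_nest)
  then obtain x where "\<And>n. x \<in> X n" by blast
  then show ?thesis by (intro exI[of _ x]) (auto simp: X_def)
qed

definition pr :: "nat \<Rightarrow> real" where
  "pr m = rit m (SOME x. \<forall>k. rit k x \<in> {38/100..855/1000})"

definition p :: "nat \<Rightarrow> complex" where "p m = of_real (pr m)"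

lemma pr_bounds: "38/100 \<le> pr m" "pr m \<le> 855/1000"
  using someI_ex[OF exists_real_orbit] by (auto simp: pr_def)

lemma fmap_p: "fmap (d (Suc m)) (p m) = p (Suc m)"
  by (simp add: p_def pr_def fmap_def)

lemma orbit_p: "orbit_seq P p"
  by (simp add: orbit_seq_def poly_P fmap_p)

lemma it_p: "it m k (p m) = p (m + k)"
  by (induction k) (simp_all add: it_Suc fmap_p)

lemma it_unit_interval:
  assumes "x \<in> {0..1}" shows "\<exists>y\<in>{0..1}. it m k (of_real x) = of_real y"
proof (induction k)
  case (Suc k)
  then obtain y where y: "y \<in> {0..1}" "it m k (of_real x) = of_real y" by blast
  then have "1 - y ^ d (Suc (m + k)) \<in> {0..1}" by (auto intro: power_le_one)
  then show ?case using y(2) by (intro bexI[of _ "1 - y ^ d (Suc (m + k))"]) (simp_all add: it_Suc fmap_def)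
qed (use assms in auto)

lemma unit_interval_in_K: assumes "x \<in> {0..1}" shows "complex_of_real x \<in> K m"
proof -
  have "cmod (it m k (of_real x)) \<le> 2" for k
    using it_unit_interval[OF assms, of m k] by auto
  then show ?thesis by (simp add: K_def)
qed

lemma avoids_p: "avoids m (p m)"
proof -
  have "1 - p m = of_real (1 - pr m)" by (simp add: p_def)
  then have "cmod (1 - p m) = 1 - pr m" using pr_bounds[of m] by (simp only: norm_of_real)
  then show ?thesis using pr_bounds[of m] by (simp add: avoids_def p_def trap1_def)
qed

text \<open>If \<open>p m\<close> were interior to \<open>K m\<close>, Cauchy's estimate on a disc
  of radius \<open>r\<close> would bound the derivatives of all iterates at \<open>p m\<close> by
  \<open>2 / r\<close>, against their exponential growth.\<close>

lemma p_in_julia: "p m \<in> julia P m"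
proof -
  have pK: "p m \<in> K m" unfolding p_def using pr_bounds[of m] by (intro unit_interval_in_K) auto
  have "p m \<in> closure (- K m)"
  proof (rule ccontr)
    assume "p m \<notin> closure (- K m)"
    then have "p m \<in> interior (K m)" by (simp add: closure_complement)
    then obtain r where r: "r > 0" "cball (p m) r \<subseteq> K m" by (auto simp: mem_interior_cball)
    have b: "cmod (deriv (it m k) (p m)) \<le> 2 / r" for k
    proof -
      have "norm ((deriv ^^ 1) (it m k) (p m)) \<le> fact 1 * 2 / r ^ 1"
      proof (rule Cauchy_inequality)
        show "cmod (it m k x) \<le> 2" if "cmod (p m - x) = r" for x
          using r(2) that by (auto simp: K_def dist_norm)
      qed (use r it_holomorphic continuous_on_it in auto)
      then show ?thesis by simp
    qed
    define c0 :: real where "c0 = (3/10)^2 * (8/100)^3"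
    have c0: "c0 > 0" by (simp add: c0_def)
    obtain k where k: "(2 / r) ^ 5 * \<sigma> (p m) / c0 < (11/10) ^ k"
      using real_arch_pow[of "11/10" "(2 / r) ^ 5 * \<sigma> (p m) / c0"] by auto
    have s0: "\<sigma> (p m) \<ge> 0" by (simp add: \<sigma>_def)
    have "(11/10) ^ k * c0 \<le> (11/10) ^ k * \<sigma> (it m k (p m))"
      unfolding it_p c0_def by (intro mult_left_mono \<sigma>_avoids[OF avoids_p]) auto
    also have "\<dots> \<le> cmod (deriv (it m k) (p m)) ^ 5 * \<sigma> (p m)"
      by (intro expansion) (simp add: it_p avoids_p)
    also have "\<dots> \<le> (2 / r) ^ 5 * \<sigma> (p m)" using b s0 by (intro mult_right_mono power_mono) auto
    finally have "(11/10) ^ k \<le> (2 / r) ^ 5 * \<sigma> (p m) / c0" using c0 by (subst pos_le_divide_eq)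
    then show False using k by linarith
  qed
  then show ?thesis using pK by (simp add: julia_P)
qed

section \<open>Rays landing on the real orbit\<close>

lemma norm_R_cis: "R > 1 \<Longrightarrow> cmod (of_real R * cis t) > 1"
  by (simp add: norm_mult)

lemma eventually_at_right_1I: "(\<And>R::real. R > 1 \<Longrightarrow> T R) \<Longrightarrow> eventually T (at_right 1)"
  by (rule eventually_mono[OF eventually_at_right_less]) auto

lemma lands_cnj:
  assumes "lands m \<theta> (p m)" shows "lands m (1 - \<theta>) (p m)"
proof -
  have "((\<lambda>R. cnj (\<psi> m (of_real R * cis (2 * pi * \<theta>)))) \<longlongrightarrow> cnj (p m)) (at_right 1)"
    using assms unfolding lands_def by (rule tendsto_cnj)
  moreover have "eventually (\<lambda>R. cnj (\<psi> m (of_real R * cis (2 * pi * \<theta>))) = \<psi> m (of_real R * cis (2 * pi * (1 - \<theta>)))) (at_right 1)"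
  proof (rule eventually_at_right_1I)
    fix R :: real assume "1 < R"
    have "cis (2 * pi * (1 - \<theta>)) = cis (2 * pi * (- \<theta>))" unfolding cis_2pi_eq_iff by simp
    also have "\<dots> = cnj (cis (2 * pi * \<theta>))" by (simp add: cis_cnj)
    finally show "cnj (\<psi> m (of_real R * cis (2 * pi * \<theta>))) = \<psi> m (of_real R * cis (2 * pi * (1 - \<theta>)))"
      using \<psi>_cnj[OF norm_R_cis[OF \<open>1 < R\<close>, of "2 * pi * \<theta>"], of m] by simp
  qed
  ultimately show ?thesis unfolding lands_def p_def by (simp add: tendsto_cong)
qed



text \<open>The rays of angles 0 and 1/2 are real by symmetry. The first avoids
  \<open>[0, 1]\<close>, being outside \<open>K m\<close>, so it stays beyond 1, and the second
  stays negative; neither can tend to a point well inside \<open>[0, 1]\<close>.\<close>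

lemma not_lands_real: "\<not> lands m 0 (p m)" "\<not> lands m (1/2) (p m)"
proof -
  show "\<not> lands m 0 (p m)"
  proof
    assume "lands m 0 (p m)"
    then have "((\<lambda>R. Re (\<psi> m (of_real R))) \<longlongrightarrow> Re (p m)) (at_right 1)"
      unfolding lands_def by (intro tendsto_Re) simp
    moreover have "eventually (\<lambda>R. 1 \<le> Re (\<psi> m (of_real R))) (at_right 1)"
    proof (rule eventually_at_right_1I)
      fix R :: real assume R: "R > 1"
      then obtain s where s: "s > 0" "\<psi> m (of_real R) = of_real (R * s)" using \<psi>_real[of R m] by auto
      have "complex_of_real (R * s) \<notin> K m" using \<psi>_notin_K[of "of_real R" m] R s by simp
      then have "\<not> R * s \<le> 1" using unit_interval_in_K[of "R * s" m] R s(1) by auto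
      then show "1 \<le> Re (\<psi> m (of_real R))" using s by simp
    qed
    ultimately have "1 \<le> Re (p m)" by (intro tendsto_lowerbound[of "\<lambda>R. Re (\<psi> m (of_real R))"]) auto
    then show False using pr_bounds[of m] by (simp add: p_def)
  qed
  show "\<not> lands m (1/2) (p m)"
  proof
    assume "lands m (1/2) (p m)"
    then have "((\<lambda>R. Re (\<psi> m (of_real (- R)))) \<longlongrightarrow> Re (p m)) (at_right 1)"
      unfolding lands_def by (intro tendsto_Re) simp
    moreover have "eventually (\<lambda>R. Re (\<psi> m (of_real (- R))) \<le> 0) (at_right 1)"
    proof (rule eventually_at_right_1I)
      fix R :: real assume R: "R > 1"
      then obtain s where s: "s > 0" "\<psi> m (of_real (- R)) = of_real (- R * s)" using \<psi>_real[of "-R" m] by auto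
      then show "Re (\<psi> m (of_real (- R))) \<le> 0" using R by simp
    qed
    ultimately have "Re (p m) \<le> 0" by (intro tendsto_upperbound[of "\<lambda>R. Re (\<psi> m (of_real (- R)))"]) auto
    then show False using pr_bounds[of m] by (simp add: p_def)
  qed
qed

text \<open>The argument of \<open>z\<close> is between 0 and \<open>pi / 4\<close>, so multiplied
  by 2 or 3 it stays below \<open>pi\<close>.\<close>

lemma Im_power_pos:
  assumes "Im z > 0" "Im z < Re z" "e = 2 \<or> e = 3" shows "Im (z ^ e) > 0"
  using assms(3)
proof
  assume "e = 2" then show ?thesis using assms by (simp add: power2_eq_square)
next
  assume e: "e = 3"
  have "Im z * Im z < Re z * Re z" using assms by (intro mult_strict_mono) auto
  then have "0 < Im z * (3 * (Re z * Re z) - Im z * Im z)"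
    using assms by (intro mult_pos_pos) (auto intro: order.strict_trans2)
  then show ?thesis by (simp add: e power3_eq_cube algebra_simps)
qed

text \<open>The derivative of the polynomials along the orbit \<open>p\<close> is negative, so a ray landing at
  \<open>p m\<close> from the upper half plane is mapped to one landing from the lower half plane. Since the
  parametrisations respect the half planes, this pins down the angle.\<close>

lemma lands_step:
  fixes \<theta> :: real
  assumes th: "0 < \<theta>" "\<theta> < 1/2" and l: "lands m \<theta> (p m)"
  shows "real (d (Suc m)) * \<theta> < 1/2" "lands (Suc m) (1/2 - real (d (Suc m)) * \<theta>) (p (Suc m))"
proof -
  let ?d = "d (Suc m)"
  define w where "w R = of_real R * cis (2 * pi * \<theta>)" for R
  define z where "z R = \<psi> m (w R)" for R
  have w1: "cmod (w R) > 1" if "R > 1" for R unfolding w_def by (rule norm_R_cis[OF that])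
  have z_eq: "z = (\<lambda>R. \<psi> m (of_real R * cis (2 * pi * \<theta>)))" by (simp add: fun_eq_iff z_def w_def)
  have zp: "(z \<longlongrightarrow> p m) (at_right 1)" unfolding z_eq using l by (simp add: lands_def)
  have sp: "sin (2 * pi * t) > 0" if "0 < t" "t < 1/2" for t
    using that by (intro sin_gt_zero) (auto simp: field_simps)
  have Imz: "Im (z R) > 0" if "R > 1" for R
    unfolding z_def using w1[OF that] that sp[OF th] by (intro \<psi>_Im_pos) (auto simp: w_def)
  have wd: "w R ^ ?d = of_real (R ^ ?d) * cis (2 * pi * (?d * \<theta>))" for R
    by (simp add: w_def power_mult_distrib Complex.DeMoivre algebra_simps)
  have ne: "at_right (1::real) \<noteq> bot" by simp
  have "((\<lambda>R. Re (z R) - Im (z R)) \<longlongrightarrow> Re (p m) - Im (p m)) (at_right 1)"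
    by (intro tendsto_intros zp)
  then have "eventually (\<lambda>R. 0 < Re (z R) - Im (z R)) (at_right 1)"
    using pr_bounds[of m] by (intro order_tendstoD(1)) (auto simp: p_def)
  then have "eventually (\<lambda>R. R > 1 \<and> Im (z R) < Re (z R)) (at_right 1)"
    using eventually_at_right_less[of "1::real"] by eventually_elim auto
  then obtain R where R: "R > 1" "Im (z R) < Re (z R)"
    using eventually_happens'[OF ne] by blast
  have wd1: "cmod (- (w R ^ ?d)) > 1"
    using w1[OF R(1)] deg_pos[of "Suc m"] by (simp add: norm_power one_less_power)
  have "Im (z R ^ ?d) > 0" using Im_power_pos[OF Imz[OF R(1)] R(2) deg] .
  then have "Im (fmap ?d (z R)) < 0" by (simp add: fmap_def)
  then have neg: "Im (\<psi> (Suc m) (- (w R ^ ?d))) < 0"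
    unfolding z_def \<psi>_semiconj[OF w1[OF R(1)], of m] .
  \<comment> \<open>\<open>\<psi>\<close> sends the upper half plane to itself and the real line to
    itself, so a value in the lower half plane forces its argument \<open>- (w R ^ ?d)\<close> there
    too.\<close>
  have "Im (w R ^ ?d) > 0"
  proof (rule ccontr)
    assume "\<not> Im (w R ^ ?d) > 0"
    then consider "Im (- (w R ^ ?d)) > 0" | "Im (- (w R ^ ?d)) = 0" by fastforce
    then show False
    proof cases
      case 1 then show False using \<psi>_Im_pos[OF wd1 1, of "Suc m"] neg by simp
    next
      case 2
      then have eq: "- (w R ^ ?d) = of_real (Re (- (w R ^ ?d)))" by (simp add: complex_eq_iff)
      have "\<bar>Re (- (w R ^ ?d))\<bar> > 1" using wd1 eq by (metis norm_of_real)
      from \<psi>_real[OF this, of "Suc m"] obtain s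
        where "\<psi> (Suc m) (- (w R ^ ?d)) = of_real (Re (- (w R ^ ?d)) * s)"
        unfolding eq[symmetric] by blast
      then show False using neg by (simp only: Im_complex_of_real)
    qed
  qed
  then have "0 < R ^ ?d * sin (2 * pi * (?d * \<theta>))" unfolding wd by simp
  then have s: "sin (2 * pi * (?d * \<theta>)) > 0" using R(1) by (simp add: zero_less_mult_iff)
  have not_mid: "\<not> (1/2 \<le> ?d * \<theta> \<and> ?d * \<theta> \<le> 1)"
  proof
    assume "1/2 \<le> ?d * \<theta> \<and> ?d * \<theta> \<le> 1"
    then have "0 \<le> sin (2 * pi * (?d * \<theta>) - pi)"
      by (intro sin_ge_zero) (auto simp: field_simps)
    then show False using s by (simp add: sin_diff)
  qed
  \<comment> \<open>This can only occur for degree 3 and angles in (1/3, 1/2). Rotating back by a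
    third of a turn keeps the parameter in the upper half plane, so the ray lies in the upper half
    plane rotated by \<open>2 * pi / 3\<close>; the positive point \<open>p m\<close> is outside the
    closure of that set.\<close>
  have not_high: "\<not> ?d * \<theta> > 1"
  proof
    assume hi: "?d * \<theta> > 1"
    have d3: "?d = 3" using deg[of "Suc m"] hi th by auto
    define c where "c = cis (2 * pi / 3)"
    have c3: "c ^ ?d = 1" by (simp add: d3 c_def Complex.DeMoivre)
    have cc: "cnj c * c = 1" by (simp add: c_def cis_cnj cis_mult)
    have pos: "Im (cnj c * z R) > 0" if R: "R > 1" for R
    proof -
      define v where "v = of_real R * cis (2 * pi * (\<theta> - 1/3))"
      have v1: "cmod v > 1" unfolding v_def by (rule norm_R_cis[OF R])
      have wv: "w R = c * v" by (simp add: w_def v_def c_def cis_mult algebra_simps)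
      have "z R = c * \<psi> m v" unfolding z_def wv by (rule \<psi>_rotate[OF v1 c3])
      then have "cnj c * z R = \<psi> m v" using cc by (simp flip: mult.assoc)
      moreover have "Im (\<psi> m v) > 0"
        using v1 R sp[of "\<theta> - 1/3"] th hi d3 by (intro \<psi>_Im_pos) (auto simp: v_def)
      ultimately show ?thesis by simp
    qed
    have "((\<lambda>R. Im (cnj c * z R)) \<longlongrightarrow> Im (cnj c * p m)) (at_right 1)"
      by (intro tendsto_intros zp)
    then have "0 \<le> Im (cnj c * p m)"
      by (rule tendsto_lowerbound) (use pos less_imp_le in \<open>auto intro!: eventually_at_right_1I\<close>)
    moreover have "Im (cnj c * p m) = - (sin (2 * pi / 3) * pr m)" by (simp add: c_def p_def)
    moreover have "sin (2 * pi / 3) > 0" by (intro sin_gt_zero) auto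
    moreover have "0 < sin (2 * pi / 3) * pr m" using calculation(3) pr_bounds[of m] by (intro mult_pos_pos) auto
    ultimately show False by linarith
  qed
  show lt: "?d * \<theta> < 1/2" using not_mid not_high by linarith
  \<comment> \<open>The image ray has angle \<open>1/2 + d * \<theta>\<close> and comes from below;
    conjugation reflects it to the angle \<open>1/2 - d * \<theta>\<close> in (0, 1/2).\<close>
  have "((\<lambda>R. cnj (fmap ?d (z R))) \<longlongrightarrow> cnj (fmap ?d (p m))) (at_right 1)"
    unfolding fmap_def by (intro tendsto_intros zp)
  then have "((\<lambda>R. cnj (fmap ?d (z R))) \<longlongrightarrow> p (Suc m)) (at_right 1)"
    unfolding fmap_p by (simp add: p_def)
  moreover have "eventually (\<lambda>R. cnj (fmap ?d (z R)) = \<psi> (Suc m) (of_real (R ^ ?d) * cis (2 * pi * (1/2 - ?d * \<theta>)))) (at_right 1)"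
  proof (rule eventually_at_right_1I)
    fix R :: real assume R: "R > 1"
    have wd1: "cmod (- (w R ^ ?d)) > 1"
      using w1[OF R] deg_pos[of "Suc m"] by (simp add: norm_power one_less_power)
    have "cis (2 * pi * (1/2 - ?d * \<theta>)) = cis (pi + - (2 * pi * (?d * \<theta>)))" by (simp add: algebra_simps)
    also have "\<dots> = - cnj (cis (2 * pi * (?d * \<theta>)))" by (simp only: cis_mult[symmetric] cis_cnj cis_pi) simp
    finally have "cnj (- (w R ^ ?d)) = of_real (R ^ ?d) * cis (2 * pi * (1/2 - ?d * \<theta>))"
      unfolding wd by simp
    then show "cnj (fmap ?d (z R)) = \<psi> (Suc m) (of_real (R ^ ?d) * cis (2 * pi * (1/2 - ?d * \<theta>)))"
      using \<psi>_semiconj[OF w1[OF R], of m] \<psi>_cnj[OF wd1, of "Suc m"] by (simp add: z_def)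
  qed
  ultimately have lim: "((\<lambda>R. \<psi> (Suc m) (of_real (R ^ ?d) * cis (2 * pi * (1/2 - ?d * \<theta>)))) \<longlongrightarrow> p (Suc m)) (at_right 1)"
    by (rule Lim_transform_eventually)
  \<comment> \<open>The image ray is traversed with radius \<open>R ^ d\<close>; this limit
    reparametrises it by its own radius.\<close>
  have rt: "filterlim (root ?d) (at_right 1) (at_right 1)"
    unfolding filterlim_at
  proof
    show "(root ?d \<longlongrightarrow> 1) (at_right 1)"
      using tendsto_real_root[OF tendsto_ident_at[of "1::real" "{1<..}"], of ?d] deg_pos[of "Suc m"] by simp
    show "eventually (\<lambda>x. root ?d x \<in> {1<..} \<and> root ?d x \<noteq> 1) (at_right 1)"
      by (rule eventually_at_right_1I) (use deg_pos[of "Suc m"] in auto)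
  qed
  from filterlim_compose[OF lim rt]
  have "((\<lambda>x. \<psi> (Suc m) (of_real (root ?d x ^ ?d) * cis (2 * pi * (1/2 - ?d * \<theta>)))) \<longlongrightarrow> p (Suc m)) (at_right 1)" .
  moreover have "eventually (\<lambda>x. \<psi> (Suc m) (of_real (root ?d x ^ ?d) * cis (2 * pi * (1/2 - ?d * \<theta>))) =
      \<psi> (Suc m) (of_real x * cis (2 * pi * (1/2 - ?d * \<theta>)))) (at_right 1)"
    by (rule eventually_at_right_1I) (use deg_pos[of "Suc m"] in \<open>simp add: real_root_pow_pos\<close>)
  ultimately show "lands (Suc m) (1/2 - ?d * \<theta>) (p (Suc m))"
    unfolding lands_def by (rule Lim_transform_eventually)
qed

text \<open>One step multiplies the difference of two such angles by at least 2 and leaves both in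
  (0, 1/2), so after \<open>n\<close> steps the original difference is at most
  \<open>(1/2) ^ n\<close>.\<close>

lemma lands_unique:
  assumes "0 < \<theta>" "\<theta> < 1/2" "lands m \<theta> (p m)" "0 < \<theta>'" "\<theta>' < 1/2" "lands m \<theta>' (p m)"
  shows "\<theta> = \<theta>'"
proof -
  have "\<bar>\<theta> - \<theta>'\<bar> \<le> (1/2) ^ n" for n
    using assms
  proof (induction n arbitrary: m \<theta> \<theta>')
    case (Suc n)
    let ?d = "real (d (Suc m))"
    note s = lands_step[OF Suc.prems(1-3)] and s' = lands_step[OF Suc.prems(4-6)]
    have d: "?d \<ge> 2" using deg_ge[of "Suc m"] by simp
    have "\<bar>(1/2 - ?d * \<theta>) - (1/2 - ?d * \<theta>')\<bar> \<le> (1/2) ^ n"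
      using s s' Suc.prems d by (intro Suc.IH) auto
    moreover have "(1/2 - ?d * \<theta>) - (1/2 - ?d * \<theta>') = ?d * (\<theta>' - \<theta>)" by (simp add: algebra_simps)
    ultimately have "?d * \<bar>\<theta> - \<theta>'\<bar> \<le> (1/2) ^ n"
      by (simp add: abs_mult abs_minus_commute)
    moreover have "2 * \<bar>\<theta> - \<theta>'\<bar> \<le> ?d * \<bar>\<theta> - \<theta>'\<bar>" using d by (intro mult_right_mono) auto
    ultimately show ?case by simp
  qed auto
  moreover have "(\<lambda>n. (1/2::real) ^ n) \<longlonglongrightarrow> 0" by (intro LIMSEQ_power_zero) auto
  ultimately have "\<bar>\<theta> - \<theta>'\<bar> \<le> 0" by (intro LIMSEQ_le_const[of "\<lambda>n. (1/2) ^ n"]) auto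
  then show ?thesis by simp
qed

lemma exists_angle: "\<exists>\<theta>. 0 < \<theta> \<and> \<theta> < 1/2 \<and> lands m \<theta> (p m)"
proof -
  obtain \<theta> where th: "\<theta> \<in> {0..<1}" "lands m \<theta> (p m)" using lands_exists[OF p_in_julia] by blast
  have "\<theta> \<noteq> 0" "\<theta> \<noteq> 1/2" using not_lands_real th(2) by metis+
  then consider "0 < \<theta>" "\<theta> < 1/2" | "1/2 < \<theta>" using th(1) by fastforce
  then show ?thesis
  proof cases
    case 2
    then show ?thesis using th lands_cnj[OF th(2)] by (intro exI[of _ "1 - \<theta>"]) auto
  qed (use th in blast)
qed

definition \<alpha> :: "nat \<Rightarrow> real" where
  "\<alpha> m = (SOME \<theta>. 0 < \<theta> \<and> \<theta> < 1/2 \<and> lands m \<theta> (p m))"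

lemma \<alpha>: "0 < \<alpha> m" "\<alpha> m < 1/2" "lands m (\<alpha> m) (p m)"
  using someI_ex[OF exists_angle[of m]] unfolding \<alpha>_def by auto

lemma \<alpha>_Suc: "\<alpha> (Suc m) = 1/2 - d (Suc m) * \<alpha> m"
proof (rule lands_unique[of _ "Suc m"])
  show "1/2 - d (Suc m) * \<alpha> m < 1/2" using \<alpha>(1)[of m] deg_pos[of "Suc m"] by simp
qed (use \<alpha> lands_step[OF \<alpha>] in auto)

lemma \<alpha>_bounds: "\<alpha> m < 1/4" "d (Suc m) * \<alpha> m < 1/2"
proof -
  show *: "d (Suc m) * \<alpha> m < 1/2" using \<alpha>_Suc[of m] \<alpha>(1)[of "Suc m"] by simp
  have "2 * \<alpha> m \<le> d (Suc m) * \<alpha> m" using \<alpha>(1)[of m] deg_ge[of "Suc m"] by (intro mult_right_mono) auto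
  then show "\<alpha> m < 1/4" using * by linarith
qed

lemma lands_iff:
  assumes "\<theta> \<in> {0..<1}" shows "lands m \<theta> (p m) \<longleftrightarrow> \<theta> = \<alpha> m \<or> \<theta> = 1 - \<alpha> m"
proof
  assume l: "lands m \<theta> (p m)"
  have "\<theta> \<noteq> 0" "\<theta> \<noteq> 1/2" using not_lands_real l by metis+
  then consider "0 < \<theta>" "\<theta> < 1/2" | "1/2 < \<theta>" using assms by fastforce
  then show "\<theta> = \<alpha> m \<or> \<theta> = 1 - \<alpha> m"
  proof cases
    case 1 then show ?thesis using lands_unique[OF 1 l \<alpha>] by blast
  next
    case 2
    then have "1 - \<theta> = \<alpha> m" using assms lands_cnj[OF l] by (intro lands_unique[OF _ _ _ \<alpha>]) auto
    then show ?thesis by auto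
  qed
qed (use \<alpha>(3) lands_cnj in auto)

text \<open>In terms of \<open>\<psi>\<close> the two angles are \<open>\<alpha> m\<close> and
  \<open>1 - \<alpha> m\<close>; the Boettcher angles are turned by 1/2 when the sign is -1.\<close>

definition A :: "nat \<Rightarrow> real set" where
  "A m = (if sg m = 1 then {\<alpha> m, 1 - \<alpha> m} else {1/2 - \<alpha> m, 1/2 + \<alpha> m})"

lemma ray_lands_iff:
  assumes th: "\<theta> \<in> {0..<1}" shows "ray_lands_at P \<phi> m \<theta> (p m) \<longleftrightarrow> \<theta> \<in> A m"
proof -
  have "ray_lands_at P \<phi> m \<theta> (p m) \<longleftrightarrow>
      ((\<lambda>R. bottcher_inv P \<phi> m (of_real R * cis (2 * pi * \<theta>))) \<longlongrightarrow> p m) (at_right 1)"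
    using p_in_julia by (simp add: ray_lands_at_def)
  also have "\<dots> \<longleftrightarrow> ((\<lambda>R. \<psi> m (of_real (sg m) * (of_real R * cis (2 * pi * \<theta>)))) \<longlongrightarrow> p m) (at_right 1)"
    by (intro tendsto_cong eventually_at_right_1I bottcher_inv_\<phi> norm_R_cis)
  also have "\<dots> \<longleftrightarrow> \<theta> \<in> A m"
  proof (cases "sg m = 1")
    case True
    then show ?thesis using lands_iff[OF th, of m] by (simp add: A_def lands_def)
  next
    case False
    then have l: "sg m = -1" using sg_cases by blast
    have "of_real (sg m) * (of_real R * cis (2 * pi * \<theta>)) = of_real R * cis (2 * pi * (\<theta> + 1/2))" for R
      unfolding cis_2pi_add_half by (simp add: l)
    then have "?thesis \<longleftrightarrow> (lands m (\<theta> + 1/2) (p m) \<longleftrightarrow> \<theta> \<in> A m)" by (simp only: lands_def)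
    moreover have "lands m (\<theta> + 1/2) (p m) \<longleftrightarrow> \<theta> \<in> A m"
    proof (cases "\<theta> < 1/2")
      case True
      then have "\<theta> + 1/2 \<in> {0..<1}" using th by auto
      then show ?thesis using lands_iff[of "\<theta> + 1/2" m] l \<alpha>(1,2)[of m] True th by (auto simp: A_def)
    next
      case False
      have "cis (2 * pi * (\<theta> + 1/2)) = cis (2 * pi * (\<theta> - 1/2))" unfolding cis_2pi_eq_iff by simp
      then have "lands m (\<theta> + 1/2) (p m) \<longleftrightarrow> lands m (\<theta> - 1/2) (p m)" by (simp only: lands_def)
      moreover have "\<theta> - 1/2 \<in> {0..<1}" using False th by auto
      ultimately show ?thesis using lands_iff[of "\<theta> - 1/2" m] l \<alpha>(1,2)[of m] False th by (auto simp: A_def)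
    qed
    ultimately show ?thesis by blast
  qed
  finally show ?thesis .
qed

section \<open>The realised portrait, its arc length and irrationality\<close>

lemma frac_eqI: "0 \<le> y \<Longrightarrow> y < 1 \<Longrightarrow> x - y \<in> \<int> \<Longrightarrow> frac x = (y::real)"
  using frac_unique_iff[of x y] by blast

lemma portrait: "formal_orbit_portrait 3 2 d A"
  unfolding formal_orbit_portrait_def
proof (intro conjI allI impI)
  fix m :: nat
  show "2 \<le> d m" "enat (d m) \<le> 3" using deg_ge deg_le by (auto simp: numeral_eq_enat)
  have A2: "A k \<subseteq> {0..<1} \<and> card (A k) = 2 \<and> finite (A k)" for k
    using \<alpha>(1,2)[of k] by (auto simp: A_def card_insert_if)
  then show "A m \<subseteq> {0..<1}" "finite (A m)" "card (A m) = 2" by auto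
  let ?f = "\<lambda>\<theta>. frac (real (d (Suc m)) * \<theta>)"
  have "?f ` A m = A (Suc m)"
  proof -
    note a = \<alpha>(1,2)[of m] \<alpha>(1,2)[of "Suc m"]
    \<comment> \<open>A quadratic step always ends with sign -1, a cubic step reverses the sign; the
      identities in \<open>fr\<close> and \<open>fr3\<close> list the images for either initial
      sign.\<close>
    have fr: "frac (2 * \<alpha> m) = 1/2 - \<alpha> (Suc m) \<and> frac (2 * (1 - \<alpha> m)) = 1/2 + \<alpha> (Suc m) \<and>
      frac (2 * (1/2 - \<alpha> m)) = 1/2 + \<alpha> (Suc m) \<and> frac (2 * (1/2 + \<alpha> m)) = 1/2 - \<alpha> (Suc m)"
      if "d (Suc m) = 2"
    proof -
      have e: "\<alpha> (Suc m) = 1/2 - 2 * \<alpha> m" using \<alpha>_Suc[of m] that by simp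
      show ?thesis using a unfolding e by (intro conjI frac_eqI) auto
    qed
    have fr3: "frac (3 * \<alpha> m) = 1/2 - \<alpha> (Suc m) \<and> frac (3 * (1 - \<alpha> m)) = 1/2 + \<alpha> (Suc m) \<and>
      frac (3 * (1/2 - \<alpha> m)) = \<alpha> (Suc m) \<and> frac (3 * (1/2 + \<alpha> m)) = 1 - \<alpha> (Suc m)"
      if "d (Suc m) = 3"
    proof -
      have e: "\<alpha> (Suc m) = 1/2 - 3 * \<alpha> m" using \<alpha>_Suc[of m] that by simp
      show ?thesis using a unfolding e by (intro conjI frac_eqI) auto
    qed
    show ?thesis
      using deg[of "Suc m"] sg_cases[of m] fr fr3 by (auto simp: A_def)
  qed
  moreover from this have "inj_on ?f (A m)"
    using A2 by (intro eq_card_imp_inj_on) auto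
  ultimately show "bij_betw ?f (A m) (A (Suc m))" by (simp add: bij_betw_def)
  have "\<exists>x y. A m = {x, y}" by (auto simp: A_def)
  then show "preserves_cyclic_order ?f (A m)"
    unfolding preserves_cyclic_order_def cyclic_less_def by auto
qed auto

lemma realized_P: "realized_by d A P p"
  unfolding realized_by_def
  using bounded_P orbit_p degree_P connected_P p_in_julia bottcher_maps_\<phi> ray_lands_iff by blast

lemma arc_A0: "\<exists>I\<in>complementary_arcs A 0. arc_length I = 1 - 2 * \<alpha> 0"
proof -
  have A0: "A 0 = {\<alpha> 0, 1 - \<alpha> 0}" by (simp add: A_def)
  show ?thesis
    using arc_component[of "\<alpha> 0" "1 - \<alpha> 0"] \<alpha>(1,2)[of 0] unfolding complementary_arcs_def A0
    by (intro bexI[of _ "(\<lambda>\<theta>. cis (2 * pi * \<theta>)) ` {\<alpha> 0<..<1 - \<alpha> 0}"]) auto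
qed

lemma \<alpha>_eq: "\<alpha> m = (1/2 - \<alpha> (Suc m)) / d (Suc m)"
  using \<alpha>_Suc[of m] deg_pos[of "Suc m"] by simp

text \<open>Bootstrapping in \<open>\<alpha>_eq\<close>: the range (0, 1/4) of the next angle gives
  a lower bound 1/12 for each angle, which in turn gives the upper bound 5/24. Then degree 2 forces
  \<open>\<alpha> m > 7/48\<close> and degree 3 forces \<open>\<alpha> m < 5/36\<close>, and 1/7
  lies between.\<close>

lemma degree_from_\<alpha>: "d (Suc m) = (if \<alpha> m > 1/7 then 2 else 3)"
proof -
  have lo: "\<alpha> k > 1/12" for k
    using \<alpha>_eq[of k] \<alpha>_bounds(1)[of "Suc k"] deg[of "Suc k"] by auto
  have hi: "\<alpha> k < 5/24" for k
    using \<alpha>_eq[of k] lo[of "Suc k"] deg[of "Suc k"] by auto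
  show ?thesis using \<alpha>_eq[of m] lo[of "Suc m"] hi[of "Suc m"] deg[of "Suc m"] by auto
qed

lemma \<alpha>_rational_imp_periodic:
  assumes "\<alpha> 0 \<in> \<rat>" shows "\<exists>N k. 0 < k \<and> (\<forall>m\<ge>N. d (Suc (m + k)) = d (Suc m))"
proof -
  obtain a b :: int where ab: "b > 0" "\<alpha> 0 = of_int a / of_int b" using Rats_cases'[OF assms] by metis
  \<comment> \<open>The recursion is integral apart from the term 1/2, so the denominator
    \<open>2 * b\<close> never grows and the bounded angles take finitely many values.\<close>
  have int: "2 * of_int b * \<alpha> m \<in> \<int>" for m
  proof (induction m)
    case 0 then show ?case using ab by simp
  next
    case (Suc m)
    have "2 * of_int b * \<alpha> (Suc m) = of_int b - of_nat (d (Suc m)) * (2 * of_int b * \<alpha> m)"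
      by (simp add: \<alpha>_Suc algebra_simps)
    then show ?case using Suc by (metis Ints_diff Ints_mult Ints_of_int Ints_of_nat)
  qed
  have "range \<alpha> \<subseteq> (\<lambda>n::int. of_int n / (2 * of_int b)) ` {0..b}"
  proof
    fix x assume "x \<in> range \<alpha>"
    then obtain m where m: "x = \<alpha> m" by blast
    obtain n :: int where n: "2 * of_int b * \<alpha> m = of_int n" using int[of m] by (auto elim: Ints_cases)
    have "0 \<le> real_of_int n" using n[symmetric] \<alpha>(1)[of m] ab(1) by simp
    moreover have "2 * of_int b * \<alpha> m \<le> 2 * of_int b * (1/2)" using \<alpha>(2)[of m] ab(1) by (intro mult_left_mono) auto
    then have "real_of_int n \<le> of_int b" unfolding n by simp
    ultimately have "n \<in> {0..b}" by simp
    moreover have "x = of_int n / (2 * of_int b)" unfolding m n[symmetric] using ab(1) by simp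
    ultimately show "x \<in> (\<lambda>n::int. of_int n / (2 * of_int b)) ` {0..b}" by blast
  qed
  then have "finite (range \<alpha>)" by (rule finite_subset) simp
  then have "\<not> inj \<alpha>" using finite_imageD by blast
  then obtain i j where "\<alpha> i = \<alpha> j" "i \<noteq> j" by (auto simp: inj_def)
  then obtain i j where ij: "\<alpha> i = \<alpha> j" "i < j" by (metis nat_neq_iff)
  \<comment> \<open>Since the angle determines the next degree, it determines the next angle, and
    one coincidence propagates.\<close>
  have eq: "\<alpha> (i + n) = \<alpha> (j + n)" for n
  proof (induction n)
    case (Suc n)
    then have "d (Suc (i + n)) = d (Suc (j + n))" by (simp add: degree_from_\<alpha>)
    then show ?case using Suc by (simp add: \<alpha>_Suc)
  qed (use ij in simp)
  have "d (Suc (m + (j - i))) = d (Suc m)" if "i \<le> m" for m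
  proof -
    have m: "m = i + (m - i)" "m + (j - i) = j + (m - i)" using ij(2) that by auto
    have "\<alpha> (m + (j - i)) = \<alpha> m" using eq[of "m - i"] m by metis
    then show ?thesis by (simp add: degree_from_\<alpha>)
  qed
  then show ?thesis using ij(2) by (intro exI[of _ i] exI[of _ "j - i"]) auto
qed

end

text \<open>Beyond \<open>n ^ 2\<close> the next square is \<open>2 * n + 1\<close> away, which
  exceeds \<open>k\<close> for the chosen \<open>n\<close>; the summand \<open>N\<close> in
  \<open>n\<close> pushes the index past \<open>N\<close>.\<close>

lemma squares_not_periodic:
  fixes k N :: nat
  assumes "0 < k" shows "\<exists>m\<ge>N. (\<exists>n. Suc m = n ^ 2) \<and> \<not> (\<exists>n. Suc (m + k) = n ^ 2)"
proof -
  define n where "n = N + k + 1"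
  have n: "n \<le> n ^ 2" "n > 0" by (simp_all add: n_def power2_eq_square)
  have "Suc (n ^ 2 - 1 + k) \<noteq> q ^ 2" for q
  proof
    assume q: "Suc (n ^ 2 - 1 + k) = q ^ 2"
    then have q': "q ^ 2 = n ^ 2 + k" using n by simp
    then have "n ^ 2 < q ^ 2" using assms by simp
    then have "n < q" by (rule power_less_imp_less_base) simp
    then have "(n + 1) ^ 2 \<le> q ^ 2" by (intro power_mono) auto
    moreover have "(n + 1) ^ 2 = n ^ 2 + 2 * n + 1" by (simp add: power2_eq_square)
    ultimately show False using q' by (simp add: n_def)
  qed
  then show ?thesis using n by (intro exI[of _ "n ^ 2 - 1"]) (auto simp: n_def intro!: exI[of _ n])
qed

theorem theorem1p10:
  shows "\<exists>P :: nat \<Rightarrow> complex poly.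
    bounded_poly_seq P \<and> connected_seq P \<and> unicritical_seq P \<and> hyperbolic_seq P \<and>
    (\<forall>m\<ge>1. degree (P m) = 2 \<or> degree (P m) = 3) \<and>
    (\<exists>m\<ge>1. degree (P m) = 2) \<and> (\<exists>m\<ge>1. degree (P m) = 3) \<and>
    (\<exists>d N dm A p. N \<ge> 2 \<and> formal_orbit_portrait d N dm A \<and> realized_by dm A P p \<and>
       (\<exists>m. \<exists>I\<in>complementary_arcs A m. arc_length I \<notin> \<rat>))"
proof -
  define d :: "nat \<Rightarrow> nat" where "d m = (if \<exists>n. m = n ^ 2 then 3 else 2)" for m
  interpret mixed_seq d by unfold_locales (simp add: d_def)
  have irr: "\<alpha> 0 \<notin> \<rat>"
  proof
    assume "\<alpha> 0 \<in> \<rat>"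
    then obtain N k where k: "0 < k" "\<And>m. m \<ge> N \<Longrightarrow> d (Suc (m + k)) = d (Suc m)"
      using \<alpha>_rational_imp_periodic by blast
    obtain m where "m \<ge> N" "\<exists>n. Suc m = n ^ 2" "\<not> (\<exists>n. Suc (m + k) = n ^ 2)"
      using squares_not_periodic[OF k(1)] by blast
    then show False using k(2)[of m] by (simp add: d_def)
  qed
  obtain I where I: "I \<in> complementary_arcs A 0" "arc_length I = 1 - 2 * \<alpha> 0" using arc_A0 by blast
  have "arc_length I \<notin> \<rat>"
  proof
    assume "arc_length I \<in> \<rat>"
    then have "(1 - arc_length I) / 2 \<in> \<rat>" by (intro Rats_divide Rats_diff) auto
    then show False using irr I(2) by simp
  qed
  have "d 1 = 3" unfolding d_def by (auto intro!: exI[of _ 1])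
  moreover have "d 2 = 2"
  proof -
    have "n ^ 2 \<noteq> 2" for n :: nat
    proof
      assume n: "n ^ 2 = 2"
      have "n < 2" using n power_mono[of 2 n 2] by (cases "n < 2") auto
      then show False using n by (auto simp: less_2_cases_iff)
    qed
    then show ?thesis unfolding d_def by metis
  qed
  ultimately have deg23: "(\<exists>m\<ge>1. degree (P m) = 2) \<and> (\<exists>m\<ge>1. degree (P m) = 3)"
    unfolding degree_P by (metis le_refl one_le_numeral)
  have "\<exists>d N dm A p. N \<ge> 2 \<and> formal_orbit_portrait d N dm A \<and> realized_by dm A P p \<and>
       (\<exists>m. \<exists>I\<in>complementary_arcs A m. arc_length I \<notin> \<rat>)"
    using portrait realized_P I(1) \<open>arc_length I \<notin> \<rat>\<close> by (metis le_refl)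
  moreover have "\<forall>m\<ge>1. degree (P m) = 2 \<or> degree (P m) = 3" using deg by (simp add: degree_P)
  ultimately show ?thesis
    using bounded_P connected_P unicritical_P hyperbolic_P deg23 by (intro exI[of _ P] conjI) blast+
qed

end
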